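(* Let $n<k\le 2n-1$, and let $H:\mathbb{R}^{2n}\to\mathbb{R}$, written $H(z)=H(z_I,z_{II})$ with $z=(z_I,z_{II})\in\mathbb{R}^{2n-k}\times\mathbb{R}^k$, satisfy: (i) $H\in C^1(\mathbb{R}^{2n},\mathbb{R})$; (ii) $H(z_I,z_{II}+m)=H(z_I,z_{II})$ for all $z=(z_I,z_{II})\in\mathbb{R}^{2n}$ and all $m\in\mathbb{Z}^k$; (iii) there exist constants $r>0$ and $\mu>1$ such that $0<\mu H(z)\le z_I\cdot H_{z_I}(z)$ for all $z\in\mathbb{R}^{2n}$ with $|z_I|\ge r$; (iv) there exist positive numbers $a,b$ and $s<\mu-\frac12$ such that $|H_{z_{II}}(z)|\le a|z_I|^s+b$ for all $z=(z_I,z_{II})\in\mathbb{R}^{2n-k}\times\mathbb{R}^k$. Then for every $v\in\mathbb{Z}^k_1\cap\left(\{0\}\times\mathbb{Z}^{2n-k}\times\{0\}\right)$, where both zeros denote $0\in\mathbb{R}^{k-n}$, there exists $\delta>0$ such that, with $$I(s)=\begin{cases}(0,+\infty), & s<\frac{\mu}{2},\\ (0,\delta), & \frac{\mu}{2}\le s<\mu-\frac12,\end{cases}$$ for every $T\in I(s)$ the boundary value problem $$\dot z(t)=JH'(z(t)),\qquad z(T)=z(0)+(0,v),$$ where $(0,v)\in\mathbb{R}^{2n-k}\times\mathbb{R}^k$, has at least $k$ distinct solutions, i.e. ${}^{\#}\mathcal{P}_H(T,v)\ge k$.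
   Context: For $1\le k\le 2n-1$ and $z=(z_1,\dots,z_{2n})\in\mathbb{R}^{2n}$ write $z=(z_I,z_{II})$ with $z_I=(z_1,\dots,z_{2n-k})$ and $z_{II}=(z_{2n-k+1},\dots,z_{2n})$, and $H_{z_I}=(H_{z_1},\dots,H_{z_{2n-k}})$, $H_{z_{II}}=(H_{z_{2n-k+1}},\dots,H_{z_{2n}})$ (partial derivatives). $H'$ is the gradient of $H$, and $J=\begin{pmatrix}0&-I_n\\ I_n&0\end{pmatrix}$. $\mathbb{Z}^k_1$ is the set of all prime rotational vectors: $v=(v_1,\dots,v_k)\in\mathbb{Z}^k\setminus\{0\}$ is prime if one of its coordinates equals $1$ while the others are zero, or two of its coordinates are relatively prime. A solution of the boundary value problem is a $C^1$ function $z$ which, extended to $\mathbb{R}$ by $z(t+T)=z(t)+(0,v)$, satisfies $\dot z=JH'(z)$ on $\mathbb{R}$. Two solutions $z^{(1)},z^{(2)}$ are regarded as the same if $z^{(2)}(t)=z^{(1)}(t+\theta)+(0,m)$ for all $t$, for some $\theta\in\mathbb{R}$ and $m\in\mathbb{Z}^k$; otherwise they are distinct. $\mathcal{P}_H(T,v)$ is the set of distinct solutions and ${}^{\#}\mathcal{P}_H(T,v)$ its cardinality. *)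

theory Defs
  imports "HOL-Analysis.Analysis"
begin

(* The space R^(2n) is real^'d together with an enumeration e of its coordinates,
   bij_betw e {1..2*n} UNIV, so that the i-th coordinate z_i is z $ e i (1 <= i <= 2n). *)

definition gradient :: "('a::real_inner \<Rightarrow> real) \<Rightarrow> 'a \<Rightarrow> 'a" where
  "gradient f z = (THE D. GDERIV f z :> D)"

definition C1_fun :: "('a::real_inner \<Rightarrow> real) \<Rightarrow> bool" where
  "C1_fun f \<longleftrightarrow> (\<forall>z. f differentiable (at z)) \<and> continuous_on UNIV (gradient f)"

lemma gradient_eq:
  assumes "GDERIV f z :> D"
  shows "gradient f z = D"
  unfolding gradient_def
proof (rule the_equality, rule assms)
  fix D' assume "GDERIV f z :> D'"
  with assms have "(\<lambda>h. inner h D') = (\<lambda>h. inner h D)"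
    unfolding gderiv_def by (rule has_derivative_unique[rotated])
  then have "inner h D' = inner h D" for h
    by meson
  then show "D' = D"
    by (metis inner_commute vector_eq_rdot)
qed

lemma GDERIV_gradient:
  fixes f :: "'a::euclidean_space \<Rightarrow> real"
  assumes "f differentiable (at z)"
  shows "GDERIV f z :> gradient f z"
proof -
  obtain f' where f': "(f has_derivative f') (at z)"
    using assms by (auto simp: differentiable_def)
  then have lin: "linear f'"
    by (rule has_derivative_linear)
  have "f' h = inner h (\<Sum>b\<in>Basis. f' b *\<^sub>R b)" for h
  proof -
    have "f' h = f' (\<Sum>b\<in>Basis. inner h b *\<^sub>R b)"
      by (simp add: euclidean_representation)
    also have "\<dots> = (\<Sum>b\<in>Basis. inner h b * f' b)"
      by (simp add: linear_sum[OF lin] linear_cmul[OF lin])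
    finally show ?thesis
      by (simp add: inner_sum_right mult.commute)
  qed
  then have "GDERIV f z :> (\<Sum>b\<in>Basis. f' b *\<^sub>R b)"
    using f' unfolding gderiv_def by (metis (no_types, lifting) ext)
  then show ?thesis
    using gradient_eq by metis
qed

lemma gradient_component:
  fixes f :: "real ^ 'd \<Rightarrow> real"
  assumes "f differentiable (at z)"
  shows "((\<lambda>h. f (z + h *\<^sub>R axis j 1)) has_real_derivative gradient f z $ j) (at 0)"
proof -
  have f: "(f has_derivative (\<lambda>h. inner h (gradient f z))) (at (z + 0 *\<^sub>R axis j 1))"
    using GDERIV_gradient[OF assms] by (simp add: gderiv_def)
  have g: "((\<lambda>h::real. z + h *\<^sub>R axis j 1) has_derivative (\<lambda>h. h *\<^sub>R axis j 1)) (at 0)"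
    by (auto intro!: derivative_eq_intros)
  have "((\<lambda>h. f (z + h *\<^sub>R axis j 1)) has_derivative
          (\<lambda>h. inner (h *\<^sub>R axis j 1) (gradient f z))) (at 0)"
    using has_derivative_compose[OF g f] .
  then show ?thesis
    by (simp add: has_field_derivative_def inner_axis' mult_commute_abs)
qed

definition J_matrix :: "(nat \<Rightarrow> 'd::finite) \<Rightarrow> nat \<Rightarrow> real ^ 'd ^ 'd" where
  "J_matrix e n = (\<chi> p q.
     if \<exists>i\<in>{1..n}. p = e i \<and> q = e (n + i) then - 1
     else if \<exists>i\<in>{1..n}. p = e (n + i) \<and> q = e i then 1
     else 0)"

(* Z^k, as functions on {1..k} extended by 0. *)
definition int_vectors :: "nat \<Rightarrow> (nat \<Rightarrow> int) set" where
  "int_vectors k = {v. \<forall>i. i \<notin> {1..k} \<longrightarrow> v i = 0}"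

definition prime_rotational_vectors :: "nat \<Rightarrow> (nat \<Rightarrow> int) set" where
  "prime_rotational_vectors k = {v \<in> int_vectors k. v \<noteq> (\<lambda>_. 0) \<and>
     ((\<exists>i\<in>{1..k}. v i = 1 \<and> (\<forall>j\<in>{1..k} - {i}. v j = 0)) \<or>
      (\<exists>i\<in>{1..k}. \<exists>j\<in>{1..k}. i \<noteq> j \<and> coprime (v i) (v j)))}"

(* The vector (0,v) of R^(2n-k) x R^k. *)
definition embed_II :: "(nat \<Rightarrow> 'd::finite) \<Rightarrow> nat \<Rightarrow> nat \<Rightarrow> (nat \<Rightarrow> int) \<Rightarrow> real ^ 'd" where
  "embed_II e n k v = (\<Sum>i=1..k. real_of_int (v i) *\<^sub>R axis (e (2 * n - k + i)) 1)"

definition norm_I :: "(nat \<Rightarrow> 'd::finite) \<Rightarrow> nat \<Rightarrow> nat \<Rightarrow> real ^ 'd \<Rightarrow> real" where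
  "norm_I e n k z = L2_set (\<lambda>i. z $ e i) {1..2 * n - k}"

definition norm_II :: "(nat \<Rightarrow> 'd::finite) \<Rightarrow> nat \<Rightarrow> nat \<Rightarrow> real ^ 'd \<Rightarrow> real" where
  "norm_II e n k z = L2_set (\<lambda>i. z $ e i) {2 * n - k + 1..2 * n}"

definition inner_I :: "(nat \<Rightarrow> 'd::finite) \<Rightarrow> nat \<Rightarrow> nat \<Rightarrow> real ^ 'd \<Rightarrow> real ^ 'd \<Rightarrow> real" where
  "inner_I e n k z w = (\<Sum>i=1..2 * n - k. z $ e i * w $ e i)"

(* Solutions of the boundary value problem, identified with their extensions to the whole line. *)
definition bvp_solutions ::
  "(nat \<Rightarrow> 'd::finite) \<Rightarrow> nat \<Rightarrow> nat \<Rightarrow> (real ^ 'd \<Rightarrow> real) \<Rightarrow> real \<Rightarrow> (nat \<Rightarrow> int) \<Rightarrow> (real \<Rightarrow> real ^ 'd) set"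
  where
  "bvp_solutions e n k H T v = {z. z C1_differentiable_on UNIV \<and>
     (\<forall>t. z (t + T) = z t + embed_II e n k v) \<and>
     (\<forall>t. (z has_vector_derivative (J_matrix e n *v gradient H (z t))) (at t))}"

definition same_solution ::
  "(nat \<Rightarrow> 'd::finite) \<Rightarrow> nat \<Rightarrow> nat \<Rightarrow> (real \<Rightarrow> real ^ 'd) \<Rightarrow> (real \<Rightarrow> real ^ 'd) \<Rightarrow> bool" where
  "same_solution e n k z1 z2 \<longleftrightarrow>
     (\<exists>\<theta>. \<exists>m\<in>int_vectors k. \<forall>t. z2 t = z1 (t + \<theta>) + embed_II e n k m)"

definition same_solution_rel ::
  "(nat \<Rightarrow> 'd::finite) \<Rightarrow> nat \<Rightarrow> nat \<Rightarrow> (real ^ 'd \<Rightarrow> real) \<Rightarrow> real \<Rightarrow> (nat \<Rightarrow> int) \<Rightarrow>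
     ((real \<Rightarrow> real ^ 'd) \<times> (real \<Rightarrow> real ^ 'd)) set" where
  "same_solution_rel e n k H T v = {(z1, z2). z1 \<in> bvp_solutions e n k H T v \<and>
     z2 \<in> bvp_solutions e n k H T v \<and> same_solution e n k z1 z2}"

definition distinct_solutions ::
  "(nat \<Rightarrow> 'd::finite) \<Rightarrow> nat \<Rightarrow> nat \<Rightarrow> (real ^ 'd \<Rightarrow> real) \<Rightarrow> real \<Rightarrow> (nat \<Rightarrow> int) \<Rightarrow>
     (real \<Rightarrow> real ^ 'd) set set" where
  "distinct_solutions e n k H T v = bvp_solutions e n k H T v // same_solution_rel e n k H T v"

lemma equiv_same_solution_rel:
  "equiv (bvp_solutions e n k H T v) (same_solution_rel e n k H T v)"
proof (rule equivI)
  show "same_solution_rel e n k H T v \<subseteq> bvp_solutions e n k H T v \<times> bvp_solutions e n k H T v"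
    by (auto simp: same_solution_rel_def)
  have "same_solution e n k z z" for z
    unfolding same_solution_def
    by (rule exI[of _ 0], rule bexI[of _ "\<lambda>_. 0"]) (auto simp: embed_II_def int_vectors_def)
  then show "refl_on (bvp_solutions e n k H T v) (same_solution_rel e n k H T v)"
    by (auto simp: refl_on_def same_solution_rel_def)
  have "same_solution e n k z2 z1" if sm: "same_solution e n k z1 z2" for z1 z2
  proof -
    obtain \<theta> m where m: "m \<in> int_vectors k"
      and eq: "\<And>t. z2 t = z1 (t + \<theta>) + embed_II e n k m"
      using sm by (auto simp: same_solution_def)
    have "z1 t = z2 (t + - \<theta>) + embed_II e n k (\<lambda>i. - m i)" for t
      by (simp add: eq embed_II_def sum_negf)
    moreover have "(\<lambda>i. - m i) \<in> int_vectors k"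
      using m by (simp add: int_vectors_def)
    ultimately show ?thesis
      unfolding same_solution_def by blast
  qed
  then show "sym (same_solution_rel e n k H T v)"
    by (auto simp: sym_def same_solution_rel_def)
  have "same_solution e n k z1 z3"
    if sm: "same_solution e n k z1 z2" "same_solution e n k z2 z3" for z1 z2 z3
  proof -
    obtain \<theta> m where m: "m \<in> int_vectors k"
      and eq: "\<And>t. z2 t = z1 (t + \<theta>) + embed_II e n k m"
      using sm(1) by (auto simp: same_solution_def)
    obtain \<theta>' m' where m': "m' \<in> int_vectors k"
      and eq': "\<And>t. z3 t = z2 (t + \<theta>') + embed_II e n k m'"
      using sm(2) by (auto simp: same_solution_def)
    have "z3 t = z1 (t + (\<theta>' + \<theta>)) + embed_II e n k (\<lambda>i. m i + m' i)" for t
      by (simp add: eq eq' embed_II_def sum.distrib scaleR_left_distrib add.assoc)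
    moreover have "(\<lambda>i. m i + m' i) \<in> int_vectors k"
      using m m' by (simp add: int_vectors_def)
    ultimately show ?thesis
      unfolding same_solution_def by blast
  qed
  then show "trans (same_solution_rel e n k H T v)"
    unfolding trans_def same_solution_rel_def by blast
qed

definition period_interval :: "real \<Rightarrow> real \<Rightarrow> real \<Rightarrow> real set" where
  "period_interval \<mu> \<delta> s = (if s < \<mu> / 2 then {0<..} else {0<..<\<delta>})"

end

theory Submission
  imports Defs "HOL-Complex_Analysis.Great_Picard"
begin

text \<open>
  Cut H off to a Hamiltonian that is linear in the norm of \<open>z_I\<close> far out; conservation of energy and
  the bound on the action keep the solutions that matter inside the region where nothing was changed.
  Sample loops at N equidistant times, so that the action becomes a function of finitely many variables,
  bounded above on a linking set and large on the set it links with. Descend by explicit gradient steps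
  from the linking set. Were there fewer than k classes of solutions, then for large N a sequence
  with small gradient and bounded action would lie near a lattice translate of one of them, and every
  descending trajectory that stays high would slow down near such a translate. The k torus coordinates
  modulo the direction of v leave k - 1 coordinates; assigning one of them to each class, the theorem of
  Poincare and Miranda (with Tietze extension) gives a point of the linking set whose trajectory stays
  high and meets each class only at translates that have a prescribed non-attained value in its own
  coordinate, a contradiction. This replaces the usual cup-length argument.
\<close>

section \<open>The theorem of Poincare and Miranda\<close>

text \<open>Sampling makes every space finite-dimensional, but critical points of the sampled action
  are not solutions; so only almost critical loops are compared with solutions, uniformly in the
  number N of samples. By the hypothesis on v, every coordinate moved by V has its conjugate among
  z_I. Hence lattice translations pair trivially with V and the action is invariant under all of
  them, and the linear term |V| |z_I| / T that V causes is dominated by the superlinear growth of H.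
  The slope K of the cut-off exceeds |V| / T. This excludes solutions in the linear region, bounds
  z_I along almost critical sequences and makes the action coercive on the linking set. The
  restriction on T enters only through the radius R of the cut-off. A solution that leaves |z_I|
  \<le> R has energy h \<ge> c R^\<mu> and action at least (\<mu> - 1) h T minus an error of order
  T^2 R^(2 s); this must exceed the minimax bound T C0 + |V|^2. If 2 s < \<mu>, a large R does it
  for every T; otherwise T has to be small. The value avoided is 1 / (2 V_i0): modulo V, lattice
  vectors have coordinates in the integer multiples of 1 / V_i0.\<close>

lemma tendsto_fun_iff:
  fixes f :: "'a \<Rightarrow> 'i \<Rightarrow> 'b::topological_space"
  shows "(f \<longlongrightarrow> l) F \<longleftrightarrow> (\<forall>i. ((\<lambda>x. f x i) \<longlongrightarrow> l i) F)"
proof -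
  have "(f \<longlongrightarrow> l) F \<longleftrightarrow> limitin (product_topology (\<lambda>i. euclidean) UNIV) f l F"
    by (simp add: euclidean_product_topology)
  then show ?thesis
    by (simp add: limitin_componentwise)
qed

lemma continuous_on_apply [continuous_intros]: "continuous_on S (\<lambda>x. x i)"
  by (rule continuous_on_subset[OF continuous_on_product_coordinates]) auto

text \<open>The dimension of the box grows with the number of samples and so cannot be a type. The
  cube therefore sits in a function space, with zeros off \<open>I\<close>; a countable index type
  makes that space metric, so compactness yields convergent subsequences.\<close>

definition box_on :: "'i set \<Rightarrow> ('i \<Rightarrow> real) \<Rightarrow> ('i \<Rightarrow> real) set" where
  "box_on I L = {x. (\<forall>i\<in>I. \<bar>x i\<bar> \<le> L i) \<and> (\<forall>i. i \<notin> I \<longrightarrow> x i = 0)}"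

lemma compact_box_on: "compact (box_on I L)"
proof -
  have eq: "box_on I L = (\<Pi>\<^sub>E i\<in>UNIV. if i \<in> I then {- L i..L i} else {0})"
    by (auto simp: box_on_def abs_le_iff PiE_UNIV_domain Pi_iff split: if_splits; force)
  have "compactin (product_topology (\<lambda>i. euclidean) UNIV) (box_on I L)"
    unfolding eq by (rule iffD2[OF compactin_PiE]) auto
  then show ?thesis
    by (simp add: euclidean_product_topology)
qed

text \<open>Kuhn's combinatorial lemma, applied to the signs of \<open>F\<close> on a grid with p
  subdivisions, yields a small cell in which every component shows both signs. As p tends to
  infinity such cells accumulate, by compactness, at a common zero.\<close>

lemma poincare_miranda:
  fixes F :: "('i::countable \<Rightarrow> real) \<Rightarrow> 'i \<Rightarrow> real"
  assumes fin: "finite I" and L: "\<And>i. i \<in> I \<Longrightarrow> 0 < L i"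
    and cont: "\<And>i. i \<in> I \<Longrightarrow> continuous_on (box_on I L) (\<lambda>x. F x i)"
    and up: "\<And>x i. x \<in> box_on I L \<Longrightarrow> i \<in> I \<Longrightarrow> x i = L i \<Longrightarrow> 0 \<le> F x i"
    and lo: "\<And>x i. x \<in> box_on I L \<Longrightarrow> i \<in> I \<Longrightarrow> x i = - L i \<Longrightarrow> F x i \<le> 0"
  shows "\<exists>x\<in>box_on I L. \<forall>i\<in>I. F x i = 0"
proof -
  define n where "n = card I"
  obtain b where b: "bij_betw b {..<n} I"
    using ex_bij_betw_nat_finite[OF fin] by (auto simp: n_def atLeast0LessThan)
  define ix where "ix = inv_into {..<n} b"
  have bI: "b j \<in> I" and ixb: "ix (b j) = j" if "j < n" for j
    using b that by (auto simp: bij_betw_def ix_def)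
  have ixI: "ix i < n" and bix: "b (ix i) = i" if "i \<in> I" for i
    using b that unfolding ix_def bij_betw_def
    by (metis inv_into_into lessThan_iff, metis f_inv_into_f)
  define pt where "pt p x = (\<lambda>i. if i \<in> I then - L i + 2 * L i * (real (x (ix i)) / real p) else 0)"
    for p :: nat and x :: "nat \<Rightarrow> nat"
  have ptB: "pt p x \<in> box_on I L" if "0 < p" "\<forall>j<n. x j \<le> p" for p x
  proof -
    have "\<bar>pt p x i\<bar> \<le> L i" if "i \<in> I" for i
    proof -
      have "0 \<le> real (x (ix i)) / real p" "real (x (ix i)) / real p \<le> 1"
        using \<open>0 < p\<close> \<open>\<forall>j<n. x j \<le> p\<close> ixI[OF that] by auto
      then have "0 \<le> L i * (real (x (ix i)) / real p)" "L i * (real (x (ix i)) / real p) \<le> L i"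
        using L[OF that] mult_left_le[of "real (x (ix i)) / real p" "L i"] by simp_all
      then show ?thesis using that by (simp add: pt_def abs_le_iff)
    qed
    then show ?thesis by (auto simp: box_on_def pt_def)
  qed
  \<comment> \<open>Kuhn's lemma prescribes the labels on opposite faces. \<open>F\<close> may
    vanish there, so they are imposed instead of being read off the sign; the boundary conditions
    keep \<open>lab0\<close> and \<open>lab1\<close> true.\<close>
  define label where "label p x j = (if x j = 0 then 0 else if x j = p then 1
      else if F (pt p x) (b j) < 0 then 0 else (1::nat))" for p and x :: "nat \<Rightarrow> nat" and j
  have lab0: "F (pt p x) (b j) \<le> 0"
    if "0 < p" "\<forall>j<n. x j \<le> p" "j < n" "label p x j = 0" for p x j
  proof (cases "x j = 0")
    case True
    then have "pt p x (b j) = - L (b j)"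
      using that by (simp add: pt_def bI ixb)
    then show ?thesis using lo ptB that bI by blast
  qed (use that in \<open>auto simp: label_def split: if_splits\<close>)
  have lab1: "0 \<le> F (pt p x) (b j)"
    if "0 < p" "\<forall>j<n. x j \<le> p" "j < n" "label p x j \<noteq> 0" for p x j
  proof (cases "x j = p")
    case True
    then have "pt p x (b j) = L (b j)"
      using that by (simp add: pt_def bI ixb)
    then show ?thesis using up ptB that bI by blast
  qed (use that in \<open>auto simp: label_def split: if_splits\<close>)
  have ptd: "\<bar>pt p x i - pt p y i\<bar> \<le> 2 * \<bar>L i\<bar> / real p"
    if "0 < p" "\<forall>j<n. y j \<le> x j \<and> x j \<le> y j + 1" for p x y i
  proof (cases "i \<in> I")
    case True
    have "\<bar>real (x (ix i)) - real (y (ix i))\<bar> \<le> 1"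
      using that(2) ixI[OF True] by (auto simp: abs_le_iff)
    moreover have "pt p x i - pt p y i = 2 * L i / real p * (real (x (ix i)) - real (y (ix i)))"
      using True by (simp add: pt_def algebra_simps diff_divide_distrib)
    ultimately show ?thesis
      using that(1) by (simp add: abs_mult divide_right_mono mult_left_le)
  qed (simp add: pt_def)
  define W where "W p q r s \<longleftrightarrow> (\<forall>j<n. q j < p) \<and> (\<forall>i<n. (\<forall>j<n. q j \<le> r i j \<and> r i j \<le> q j + 1) \<and>
      (\<forall>j<n. q j \<le> s i j \<and> s i j \<le> q j + 1) \<and> label p (r i) i = 0 \<and> label p (s i) i \<noteq> 0)" for p q r s
  have ex: "\<exists>q r s. W p q r s" if p: "0 < p" for p
  proof -
    obtain q where q1: "\<forall>i<n. q i < p" and q2: "\<forall>i<n. \<exists>r s. (\<forall>j<n. q j \<le> r j \<and> r j \<le> q j + 1) \<and>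
        (\<forall>j<n. q j \<le> s j \<and> s j \<le> q j + 1) \<and> label p r i \<noteq> label p s i"
      by (rule kuhn_lemma[OF p, of n "label p"]) (use p in \<open>auto simp: label_def\<close>)
    have "\<exists>r s. (\<forall>j<n. q j \<le> r j \<and> r j \<le> q j + 1) \<and>
        (\<forall>j<n. q j \<le> s j \<and> s j \<le> q j + 1) \<and> label p r i = 0 \<and> label p s i \<noteq> 0" if i: "i < n" for i
    proof -
      obtain r s where rs: "\<forall>j<n. q j \<le> r j \<and> r j \<le> q j + 1"
        "\<forall>j<n. q j \<le> s j \<and> s j \<le> q j + 1" "label p r i \<noteq> label p s i" using q2 i by blast
      show ?thesis
      proof (cases "label p r i = 0")
        case True then show ?thesis using rs by metis
      next
        case False
        then have "label p s i = 0" using rs(3) by (auto simp: label_def split: if_splits)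
        then show ?thesis using rs False by metis
      qed
    qed
    then show ?thesis using q1 unfolding W_def by metis
  qed
  obtain q r s where W: "\<And>p. 0 < p \<Longrightarrow> W p (q p) (r p) (s p)"
    using ex by metis
  have q: "\<And>p j. 0 < p \<Longrightarrow> j < n \<Longrightarrow> q p j < p"
    and rs: "\<And>p i j. 0 < p \<Longrightarrow> i < n \<Longrightarrow> j < n \<Longrightarrow> q p j \<le> r p i j \<and> r p i j \<le> q p j + 1"
      "\<And>p i j. 0 < p \<Longrightarrow> i < n \<Longrightarrow> j < n \<Longrightarrow> q p j \<le> s p i j \<and> s p i j \<le> q p j + 1"
      "\<And>p i. 0 < p \<Longrightarrow> i < n \<Longrightarrow> label p (r p i) i = 0 \<and> label p (s p i) i \<noteq> 0"
    using W unfolding W_def by blast+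
  define Q where "Q k = pt (Suc k) (q (Suc k))" for k
  have "Q k \<in> box_on I L" for k
    unfolding Q_def by (rule ptB) (use q[of "Suc k"] in \<open>auto intro: less_imp_le\<close>)
  then obtain x \<phi> where x: "x \<in> box_on I L" and \<phi>: "strict_mono \<phi>" "(Q \<circ> \<phi>) \<longlonglongrightarrow> x"
    using compact_box_on[of I L] unfolding compact_def by blast
  have lim0: "(\<lambda>k. 2 * \<bar>L c\<bar> / real (Suc (\<phi> k))) \<longlonglongrightarrow> 0" for c
  proof -
    have "(\<lambda>k. 2 * \<bar>L c\<bar> / real (Suc k)) \<longlonglongrightarrow> 0"
      using tendsto_mult[OF tendsto_const[of "2 * \<bar>L c\<bar>"] LIMSEQ_inverse_real_of_nat]
      by (simp add: divide_inverse)
    from LIMSEQ_subseq_LIMSEQ[OF this \<phi>(1)] show ?thesis by (simp add: o_def)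
  qed
  \<comment> \<open>Every vertex of the cell lies within one mesh width of \<open>Q\<close>, so all
    choices of vertices share the limit \<open>x\<close>.\<close>
  have conv: "(\<lambda>k. pt (Suc (\<phi> k)) (y (Suc (\<phi> k)))) \<longlonglongrightarrow> x"
    if y: "\<And>p j. 0 < p \<Longrightarrow> j < n \<Longrightarrow> q p j \<le> y p j \<and> y p j \<le> q p j + 1" for y
    unfolding tendsto_fun_iff
  proof
    fix c
    have "(\<lambda>k. pt (Suc (\<phi> k)) (y (Suc (\<phi> k))) c - Q (\<phi> k) c) \<longlonglongrightarrow> 0"
      unfolding Q_def
      by (rule Lim_null_comparison[OF always_eventually lim0[of c]])
         (intro allI, unfold real_norm_def, rule ptd, use y in auto)
    moreover have "(\<lambda>k. Q (\<phi> k) c) \<longlonglongrightarrow> x c"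
      using \<phi>(2) by (auto simp: tendsto_fun_iff o_def)
    ultimately show "(\<lambda>k. pt (Suc (\<phi> k)) (y (Suc (\<phi> k))) c) \<longlonglongrightarrow> x c"
      using tendsto_add by fastforce
  qed
  have "F x i = 0" if i: "i \<in> I" for i
  proof -
    have le: "q p j + 1 \<le> p" if "0 < p" "j < n" for p j using q[OF that] by simp
    have box: "pt (Suc (\<phi> k)) (y (Suc (\<phi> k))) \<in> box_on I L"
      if y: "\<And>p j. 0 < p \<Longrightarrow> j < n \<Longrightarrow> q p j \<le> y p j \<and> y p j \<le> q p j + 1" for y k
      by (rule ptB) (use y le in \<open>meson zero_less_Suc order_trans\<close>)+
    have lims: "(\<lambda>k. F (pt (Suc (\<phi> k)) (y (Suc (\<phi> k)))) i) \<longlonglongrightarrow> F x i"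
      if y: "\<And>p j. 0 < p \<Longrightarrow> j < n \<Longrightarrow> q p j \<le> y p j \<and> y p j \<le> q p j + 1" for y
      using continuous_on_tendsto_compose[OF cont[OF i] conv[OF y] x always_eventually[OF allI[OF box[OF y]]]] .
    have j: "ix i < n" using ixI[OF i] .
    have "F (pt (Suc (\<phi> k)) (r (Suc (\<phi> k)) (ix i))) i \<le> 0" for k
    proof -
      have "\<forall>j<n. r (Suc (\<phi> k)) (ix i) j \<le> Suc (\<phi> k)"
        using rs(1)[OF _ j] le by (meson zero_less_Suc order_trans)
      then show ?thesis
        using lab0[OF zero_less_Suc _ j] rs(3)[OF zero_less_Suc j] bix[OF i] by metis
    qed
    moreover have "0 \<le> F (pt (Suc (\<phi> k)) (s (Suc (\<phi> k)) (ix i))) i" for k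
    proof -
      have "\<forall>j<n. s (Suc (\<phi> k)) (ix i) j \<le> Suc (\<phi> k)"
        using rs(2)[OF _ j] le by (meson zero_less_Suc order_trans)
      then show ?thesis
        using lab1[OF zero_less_Suc _ j] rs(3)[OF zero_less_Suc j] bix[OF i] by metis
    qed
    ultimately show ?thesis
      using LIMSEQ_le_const2[OF lims[OF rs(1)[OF _ j]]] LIMSEQ_le_const[OF lims[OF rs(2)[OF _ j]]]
      by (meson antisym)
  qed
  then show ?thesis using x by blast
qed

text \<open>In the directions \<open>K\<close> the missing component is built as s_i - b(s) -
  \<tau>, where b extends s_i - \<open>lam j\<close> from \<open>Z j\<close> by Tietze's theorem.
  Since b stays within \<open>B\<close>, the boundary signs hold on a large box, and on
  \<open>Z j\<close> a zero says exactly \<open>lam j s = \<tau>\<close>.\<close>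

lemma poincare_miranda_avoiding:
  fixes I K :: "'i::countable set" and idx :: "nat \<Rightarrow> 'i" and lam :: "nat \<Rightarrow> ('i \<Rightarrow> real) \<Rightarrow> real"
    and \<phi> :: "('i \<Rightarrow> real) \<Rightarrow> 'i \<Rightarrow> real"
  assumes fin: "finite I" and K: "K \<subseteq> I" and L: "\<And>i. i \<in> I \<Longrightarrow> 0 < L i"
    and idx: "inj_on idx {..<l}" "idx ` {..<l} \<subseteq> K"
    and cont: "\<And>i. i \<in> I - K \<Longrightarrow> continuous_on (box_on I L) (\<lambda>s. \<phi> s i)"
    and up: "\<And>s i. s \<in> box_on I L \<Longrightarrow> i \<in> I - K \<Longrightarrow> s i = L i \<Longrightarrow> 0 \<le> \<phi> s i"
    and lo: "\<And>s i. s \<in> box_on I L \<Longrightarrow> i \<in> I - K \<Longrightarrow> s i = - L i \<Longrightarrow> \<phi> s i \<le> 0"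
    and Z: "\<And>j. j < l \<Longrightarrow> closed (Z j)" "\<And>j. j < l \<Longrightarrow> Z j \<subseteq> box_on I L"
    and lam: "\<And>j. j < l \<Longrightarrow> continuous_on (Z j) (lam j)"
    and B: "\<And>j s. j < l \<Longrightarrow> s \<in> Z j \<Longrightarrow> \<bar>s (idx j) - lam j s\<bar> \<le> B" "0 \<le> B"
    and LB: "\<And>i. i \<in> K \<Longrightarrow> B + \<bar>\<tau>\<bar> \<le> L i"
  shows "\<exists>s\<in>box_on I L. (\<forall>i\<in>I - K. \<phi> s i = 0) \<and> (\<forall>j<l. s \<in> Z j \<longrightarrow> lam j s = \<tau>)"
proof -
  have "\<exists>b. continuous_on (box_on I L) b \<and> (\<forall>s\<in>Z j. b s = s (idx j) - lam j s) \<and>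
      (\<forall>s\<in>box_on I L. \<bar>b s\<bar> \<le> B)" if j: "j < l" for j
  proof -
    have "continuous_on (Z j) (\<lambda>s. s (idx j) - lam j s)"
      by (intro continuous_intros lam[OF j])
    then obtain g where "continuous_on (box_on I L) g" "\<And>x. x \<in> Z j \<Longrightarrow> g x = x (idx j) - lam j x"
      "\<And>x. x \<in> box_on I L \<Longrightarrow> norm (g x) \<le> B"
      by (rule Tietze[of "Z j" _ "box_on I L" B])
        (use j Z B in \<open>auto simp: closed_subset\<close>)
    then show ?thesis by auto
  qed
  then obtain b where b: "\<And>j. j < l \<Longrightarrow> continuous_on (box_on I L) (b j)"
      "\<And>j s. j < l \<Longrightarrow> s \<in> Z j \<Longrightarrow> b j s = s (idx j) - lam j s"
      "\<And>j s. j < l \<Longrightarrow> s \<in> box_on I L \<Longrightarrow> \<bar>b j s\<bar> \<le> B"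
    by metis
  define inv where "inv = inv_into {..<l} idx"
  have inv: "inv (idx j) = j" if "j < l" for j
    using that idx(1) by (simp add: inv_def)
  \<comment> \<open>Directions of \<open>K\<close> assigned to no index get b = 0, so their equation
    only fixes s_i = \<tau>.\<close>
  define F where "F s i = (if i \<in> K then
      s i - (if i \<in> idx ` {..<l} then b (inv i) s else 0) - \<tau> else \<phi> s i)" for s i
  have bd: "\<bar>if i \<in> idx ` {..<l} then b (inv i) s else 0\<bar> \<le> B" if "s \<in> box_on I L" for s i
    using that b(3) inv B(2) by auto
  have "\<exists>x\<in>box_on I L. \<forall>i\<in>I. F x i = 0"
  proof (rule poincare_miranda[OF fin L])
    show "continuous_on (box_on I L) (\<lambda>x. F x i)" if "i \<in> I" for i
    proof (cases "i \<in> K")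
      case True
      have "continuous_on (box_on I L) (\<lambda>x. x i)"
        by (rule continuous_on_apply)
      moreover have "continuous_on (box_on I L) (\<lambda>x. if i \<in> idx ` {..<l} then b (inv i) x else 0)"
        by (cases "i \<in> idx ` {..<l}") (auto simp: inv b(1))
      ultimately show ?thesis
        unfolding F_def using True by (simp add: continuous_on_diff)
    qed (use that cont in \<open>simp add: F_def\<close>)
    show "0 \<le> F x i" if "x \<in> box_on I L" "i \<in> I" "x i = L i" for x i
      using bd[OF that(1), of i] LB[of i] up[OF that(1)] that(2,3) by (auto simp: F_def)
    show "F x i \<le> 0" if "x \<in> box_on I L" "i \<in> I" "x i = - L i" for x i
      using bd[OF that(1), of i] LB[of i] lo[OF that(1)] that(2,3) by (auto simp: F_def)
  qed auto
  then obtain s where s: "s \<in> box_on I L" "\<And>i. i \<in> I \<Longrightarrow> F s i = 0" by blast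
  have "lam j s = \<tau>" if "j < l" "s \<in> Z j" for j
  proof -
    have "idx j \<in> K" using that idx by auto
    then have "F s (idx j) = s (idx j) - b j s - \<tau>"
      using that by (auto simp: F_def inv)
    then show ?thesis using s(2) \<open>idx j \<in> K\<close> K b(2) that by fastforce
  qed
  moreover have "\<phi> s i = 0" if "i \<in> I - K" for i
    using s(2)[of i] that by (simp add: F_def)
  ultimately show ?thesis using s(1) by blast
qed

section \<open>Critical classes met by a discrete descent\<close>

text \<open>\<open>g\<close> is one descent step for \<open>f\<close>, of length at most \<open>st\<close>; \<open>gn\<close> plays the role of the norm of the
  gradient, and \<open>near \<rho> x c\<close> says that \<open>x\<close> is \<open>\<rho>\<close>-close to the critical class \<open>c\<close>, whose level is \<open>A c\<close>.
  The condition \<open>8 * \<epsilon> < \<eta> * \<delta>\<close> makes leaving a class cost more than the uncertainty of its level,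
  so a trajectory cannot come back at the same level.\<close>

locale descent =
  fixes X :: "'z set" and f gn st :: "'z \<Rightarrow> real" and g :: "'z \<Rightarrow> 'z" and d :: "'z \<Rightarrow> 'z \<Rightarrow> real"
    and near :: "real \<Rightarrow> 'z \<Rightarrow> 'c \<Rightarrow> bool" and A :: "'c \<Rightarrow> real"
    and a \<beta> \<tau> \<eta> \<eta>' \<delta> \<epsilon> :: real
  assumes gX: "x \<in> X \<Longrightarrow> g x \<in> X"
    and gd: "x \<in> X \<Longrightarrow> d x (g x) \<le> st x" and st: "x \<in> X \<Longrightarrow> 0 \<le> st x" "x \<in> X \<Longrightarrow> st x \<le> \<tau>"
    and gn: "0 \<le> gn x"
    and dec: "x \<in> X \<Longrightarrow> f (g x) \<le> f x - gn x * st x / 2"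
    and full: "x \<in> X \<Longrightarrow> 2 * \<eta>' \<le> gn x \<Longrightarrow> a + 1 \<le> f x \<Longrightarrow> st x = \<tau>"
    and fixed: "x \<in> X \<Longrightarrow> f x \<le> a \<Longrightarrow> g x = x"
    and near_step: "near \<rho> x c \<Longrightarrow> d x y \<le> \<sigma> \<Longrightarrow> x \<in> X \<Longrightarrow> y \<in> X \<Longrightarrow> near (\<rho> + \<sigma>) y c"
    and near_mono: "near \<rho> x c \<Longrightarrow> \<rho> \<le> \<rho>' \<Longrightarrow> near \<rho>' x c"
    and slow: "x \<in> X \<Longrightarrow> gn x \<le> 2 * \<eta>' \<Longrightarrow> f x \<le> \<beta> \<Longrightarrow> \<exists>c. near \<delta> x c \<and> \<bar>f x - A c\<bar> \<le> \<epsilon>"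
    and slow': "x \<in> X \<Longrightarrow> gn x < \<eta> \<Longrightarrow> f x \<le> \<beta> \<Longrightarrow> \<exists>c. near \<delta> x c"
    and sep: "x \<in> X \<Longrightarrow> near (2 * \<delta>) x c \<Longrightarrow> near (2 * \<delta>) x c' \<Longrightarrow> c = c'"
    and cst: "0 < \<tau>" "0 < \<delta>" "0 < \<eta>" "0 < \<eta>'" "\<tau> \<le> \<delta> / 2" "8 * \<epsilon> < \<eta> * \<delta>"
begin

lemma iter_X: "x \<in> X \<Longrightarrow> (g ^^ i) x \<in> X"
  by (induction i) (auto intro: gX)

lemma f_step: "x \<in> X \<Longrightarrow> f (g x) \<le> f x"
  using dec[of x] gn[of x] st(1)[of x] by (smt (verit) divide_nonneg_pos mult_nonneg_nonneg)

lemma f_iter: "x \<in> X \<Longrightarrow> f ((g ^^ i) x) \<le> f x"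
  by (induction i) (auto intro: order_trans f_step iter_X)

text \<open>\<rho> bounds the distance from the class, growing with the path since the last visit to
  its \<delta>-neighbourhood. Between \<delta> and 2 \<delta> the gradient is at least \<eta>, since
  by \<open>sep\<close> a slower point would be \<delta>-near the same class; so distance is paid
  for at the rate \<eta> / 2. The allowance \<tau> is for the one step that leaves the
  neighbourhood.\<close>

lemma escape:
  assumes x: "x \<in> X" "near \<delta> x c" "f x \<le> \<beta>"
  shows "f ((g ^^ i) x) \<le> f x \<and>
    ((\<exists>\<rho>\<le>2 * \<delta>. near \<rho> ((g ^^ i) x) c \<and> f ((g ^^ i) x) + \<eta> / 2 * (\<rho> - \<delta> - \<tau>) \<le> f x) \<or>
     f ((g ^^ i) x) \<le> f x - \<eta> / 2 * (\<delta> - \<tau>))"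
proof (induction i)
  case 0
  show ?case using x cst by (auto intro!: exI[of _ \<delta>])
next
  case (Suc i)
  define y where "y = (g ^^ i) x"
  have y: "y \<in> X" "f y \<le> \<beta>" "f y \<le> f x" using iter_X x Suc by (auto simp: y_def)
  have gy: "f (g y) \<le> f y" using f_step y by auto
  show ?case
  proof (cases "f y \<le> f x - \<eta> / 2 * (\<delta> - \<tau>)")
    case True then show ?thesis using gy y by (simp add: y_def)
  next
    case False
    then obtain \<rho> where \<rho>: "\<rho> \<le> 2 * \<delta>" "near \<rho> y c" "f y + \<eta> / 2 * (\<rho> - \<delta> - \<tau>) \<le> f x"
      using Suc by (auto simp: y_def)
    show ?thesis
    \<comment> \<open>Back inside, the count restarts: the new \<rho> is \<delta> plus one step, and
      its cost term is not positive.\<close>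
    proof (cases "near \<delta> y c")
      case True
      then have "near (\<delta> + st y) (g y) c" using near_step gd gX y by blast
      moreover have "\<delta> + st y \<le> 2 * \<delta>" "\<eta> / 2 * (st y - \<tau>) \<le> 0"
        using st[OF y(1)] cst by (auto intro: mult_nonneg_nonpos)
      ultimately show ?thesis using gy y
        by (auto simp: y_def intro!: exI[of _ "\<delta> + st y"])
    next
      case F: False
      have "\<eta> \<le> gn y"
      proof (rule ccontr)
        assume "\<not> \<eta> \<le> gn y"
        then obtain c' where "near \<delta> y c'" using slow' y by force
        moreover have "near (2 * \<delta>) y c'" "near (2 * \<delta>) y c"
          using near_mono calculation \<rho> cst by (auto intro: near_mono)
        ultimately show False using sep[OF y(1)] F by metis
      qed
      then have fgy: "f (g y) \<le> f y - \<eta> / 2 * st y"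
        using dec[OF y(1)] st(1)[OF y(1)] mult_right_mono[of \<eta> "gn y" "st y"] by simp
      have "near (\<rho> + st y) (g y) c" using near_step gd gX y \<rho> by blast
      have *: "f (g y) + \<eta> / 2 * (\<rho> + st y - \<delta> - \<tau>) \<le> f x"
      proof -
        have "\<eta> / 2 * (\<rho> + st y - \<delta> - \<tau>) = \<eta> / 2 * (\<rho> - \<delta> - \<tau>) + \<eta> / 2 * st y"
          by (simp add: field_simps)
        then show ?thesis using \<rho>(3) fgy by linarith
      qed
      show ?thesis
      proof (cases "\<rho> + st y \<le> 2 * \<delta>")
        case True
        then show ?thesis using * gy y \<open>near (\<rho> + st y) (g y) c\<close> by (auto simp: y_def)
      next
        case False
        then have "\<eta> / 2 * (\<delta> - \<tau>) \<le> \<eta> / 2 * (\<rho> + st y - \<delta> - \<tau>)"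
          using cst by (intro mult_left_mono) auto
        then show ?thesis using * gy y by (auto simp: y_def)
      qed
    qed
  qed
qed

text \<open>Equal levels allow a drop of at most 2 \<epsilon>, while leaving the class costs at
  least \<eta> \<delta> / 4, which is more; hence the trajectory is still within 2 \<delta> of
  \<open>c\<close>.\<close>

lemma no_return:
  assumes x: "x \<in> X" "f x \<le> \<beta>" and "near \<delta> x c" "\<bar>f x - A c\<bar> \<le> \<epsilon>"
    and "near \<delta> ((g ^^ i) x) c'" "\<bar>f ((g ^^ i) x) - A c'\<bar> \<le> \<epsilon>" "A c = A c'"
  shows "c = c'"
proof -
  have "\<eta> / 4 * \<delta> \<le> \<eta> / 2 * (\<delta> - \<tau>)"
    using mult_left_mono[of "\<delta> / 2" "\<delta> - \<tau>" "\<eta> / 2"] cst by simp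
  then have "\<not> f ((g ^^ i) x) \<le> f x - \<eta> / 2 * (\<delta> - \<tau>)"
    using assms(4,6,7) cst(6) by linarith
  then obtain \<rho> where "\<rho> \<le> 2 * \<delta>" "near \<rho> ((g ^^ i) x) c"
    using escape[OF x(1) assms(3) x(2), of i] by blast
  then have "near (2 * \<delta>) ((g ^^ i) x) c" "near (2 * \<delta>) ((g ^^ i) x) c'"
    using near_mono assms(5) cst by (auto intro: near_mono)
  then show ?thesis using sep iter_X x by blast
qed

text \<open>A step with gradient above 2 \<eta>' has full length and lowers \<open>f\<close> by at
  least \<eta>' \<tau>; \<open>n\<close> such steps would use up the whole range from \<beta> down
  to \<open>a\<close>.\<close>

lemma slow_visit:
  assumes "x \<in> X" "f x \<le> \<beta>" "\<beta> - a < real n * (\<eta>' * \<tau>)" "a + 1 \<le> f ((g ^^ n) x)"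
  shows "\<exists>i<n. gn ((g ^^ i) x) \<le> 2 * \<eta>'"
proof (rule ccontr)
  assume neg: "\<not> ?thesis"
  have "f ((g ^^ i) x) \<le> f x - real i * (\<eta>' * \<tau>)" if "i \<le> n" for i
    using that
  proof (induction i)
    case (Suc i)
    define y where "y = (g ^^ i) x"
    have y: "y \<in> X" using iter_X assms by (simp add: y_def)
    have "(g ^^ (n - i + i)) x = (g ^^ (n - i)) y" unfolding funpow_add y_def by simp
    then have "(g ^^ n) x = (g ^^ (n - i)) y" using Suc.prems by simp
    then have "a + 1 \<le> f y" using assms(4) f_iter[OF y] by (metis order_trans)
    moreover have "2 * \<eta>' \<le> gn y" using neg Suc.prems unfolding y_def by (meson Suc_le_lessD linear)
    ultimately have "st y = \<tau>" using full y by blast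
    moreover have "2 * \<eta>' * \<tau> \<le> gn y * \<tau>"
      using \<open>2 * \<eta>' \<le> gn y\<close> cst(1) by (intro mult_right_mono) auto
    ultimately have "f (g y) \<le> f y - \<eta>' * \<tau>"
      using dec[OF y] by simp
    then show ?case using Suc by (simp add: y_def algebra_simps)
  qed simp
  from this[of n] show False using assms by simp
qed

text \<open>By \<open>sep\<close> at most one class is \<delta>-near, so at a slow point the choice
  is forced.\<close>

definition slow_class :: "'z \<Rightarrow> 'c" where
  "slow_class x = (SOME c. near \<delta> x c \<and> \<bar>f x - A c\<bar> \<le> \<epsilon>)"

lemma slow_class:
  assumes "x \<in> X" "gn x \<le> 2 * \<eta>'" "f x \<le> \<beta>"
  shows "near \<delta> x (slow_class x)" "\<bar>f x - A (slow_class x)\<bar> \<le> \<epsilon>"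
  using someI_ex[OF slow[OF assms]] by (auto simp: slow_class_def)

lemma slow_class_eq:
  assumes "x \<in> X" "gn x \<le> 2 * \<eta>'" "f x \<le> \<beta>" "y \<in> X" "gn y \<le> 2 * \<eta>'" "f y \<le> \<beta>" "d x y \<le> \<delta>"
  shows "slow_class y = slow_class x"
proof -
  have "near (2 * \<delta>) y (slow_class x)"
    using near_step[OF slow_class(1)[OF assms(1-3)] assms(7,1,4)] by simp
  moreover have "near (2 * \<delta>) y (slow_class y)"
    using slow_class(1)[OF assms(4-6)] by (rule near_mono) (use cst in simp)
  ultimately show ?thesis using sep assms(4) by blast
qed

text \<open>This attaches a class to a trajectory and a level, independently of the time of the
  visit.\<close>

lemma slow_class_iter_eq:
  assumes x: "x \<in> X" "f x \<le> \<beta>" and "gn ((g ^^ i) x) \<le> 2 * \<eta>'" "gn ((g ^^ k) x) \<le> 2 * \<eta>'"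
    and "A (slow_class ((g ^^ i) x)) = A (slow_class ((g ^^ k) x))"
  shows "slow_class ((g ^^ i) x) = slow_class ((g ^^ k) x)"
  using assms(3-)
proof (induction i k rule: linorder_wlog)
  case (le i k)
  have *: "(g ^^ j) x \<in> X" "f ((g ^^ j) x) \<le> \<beta>" for j
    using iter_X f_iter[of x j] x by auto
  have "(g ^^ k) x = (g ^^ (k - i)) ((g ^^ i) x)"
    using le(1) by (metis comp_apply funpow_add le_add_diff_inverse2)
  then show ?case
    using no_return[OF *(1)[of i] *(2)[of i], of _ "k - i"] slow_class[OF *(1)[of i] _ *(2)[of i]]
      slow_class[OF *(1)[of k] _ *(2)[of k]] le by metis
qed metis

text \<open>\<open>Z j\<close> collects the parameters whose trajectory slows down, within
  \<open>n\<close> steps, near a class of index \<open>j\<close>. On it the label of that class is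
  continuous: it is locally constant at each time and does not depend on the time by
  \<open>slow_class_iter_eq\<close>. So \<open>poincare_miranda_avoiding\<close> can prescribe the
  impossible value \<theta> for all indices at once. The remaining equations put the end of the
  trajectory where \<open>low\<close> applies, so it does slow down somewhere.\<close>

theorem critical_classes:
  fixes I K :: "'i::countable set" and \<Phi> :: "('i \<Rightarrow> real) \<Rightarrow> 'z" and idx :: "nat \<Rightarrow> 'i"
    and \<phi> \<kappa> :: "'z \<Rightarrow> 'i \<Rightarrow> real" and J :: "'c \<Rightarrow> nat" and lab :: "'c \<Rightarrow> real"
  assumes fin: "finite I" and K: "K \<subseteq> I"
    and idx: "inj_on idx {..<l}" "idx ` {..<l} \<subseteq> K" and J: "\<And>x c. near \<delta> x c \<Longrightarrow> J c < l"
    and AJ: "\<And>c c'. J c = J c' \<Longrightarrow> A c = A c'"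
    and \<kappa>: "\<And>x c. x \<in> X \<Longrightarrow> near \<delta> x c \<Longrightarrow> \<bar>\<kappa> x (idx (J c)) - lab c\<bar> \<le> B"
      "\<And>x y i. x \<in> X \<Longrightarrow> y \<in> X \<Longrightarrow> \<bar>\<kappa> x i - \<kappa> y i\<bar> \<le> C * d x y" and BC: "0 \<le> B" "0 \<le> C"
    and lab: "\<And>x c. near \<delta> x c \<Longrightarrow> lab c \<noteq> \<theta>"
    and \<Phi>: "\<And>s. \<Phi> s \<in> X" "\<And>s. f (\<Phi> s) \<le> \<beta>" "\<And>s i. i \<in> K \<Longrightarrow> \<kappa> (\<Phi> s) i = s i"
      "\<And>s i. i \<in> I - K \<Longrightarrow> \<phi> (\<Phi> s) i = s i"
    and Lm: "0 < Lm" "\<And>s i. i \<in> I - K \<Longrightarrow> \<bar>s i\<bar> = Lm \<Longrightarrow> f (\<Phi> s) \<le> a"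
    and low: "\<And>x. x \<in> X \<Longrightarrow> \<forall>i\<in>I - K. \<phi> x i = 0 \<Longrightarrow> a + 1 \<le> f x"
    and cont: "\<And>i. continuous_on UNIV (\<lambda>s. gn ((g ^^ i) (\<Phi> s)))"
      "\<And>i j. continuous_on UNIV (\<lambda>s. \<phi> ((g ^^ i) (\<Phi> s)) j)"
      "\<And>i s. ((\<lambda>s'. d ((g ^^ i) (\<Phi> s)) ((g ^^ i) (\<Phi> s'))) \<longlongrightarrow> 0) (at s)"
  shows False
proof -
  obtain n :: nat where n: "(\<beta> - a) / (\<eta>' * \<tau>) < real n"
    using reals_Archimedean2 by blast
  then have n: "\<beta> - a < real n * (\<eta>' * \<tau>)"
    using cst by (simp add: divide_less_eq)
  define x where "x i s = (g ^^ i) (\<Phi> s)" for i s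
  have xX: "x i s \<in> X" and xf: "f (x i s) \<le> \<beta>" for i s
    using iter_X[OF \<Phi>(1)] order_trans[OF f_iter[OF \<Phi>(1)] \<Phi>(2)] by (auto simp: x_def)
  \<comment> \<open>In the torus directions the box must exceed the uncertainty \<open>B\<close> of
    a label, the drift of \<kappa> in \<open>n\<close> steps and the target \<theta>.\<close>
  define M where "M = B + real n * C * \<tau> + \<bar>\<theta>\<bar> + 1"
  have M: "0 < M" using BC cst by (auto simp: M_def intro!: add_nonneg_pos)
  define L where "L i = (if i \<in> K then M else Lm)" for i
  define S where "S i = {s \<in> box_on I L. gn (x i s) \<le> 2 * \<eta>'}" for i
  have cl_box: "closed (box_on I L)" using compact_box_on compact_imp_closed by blast
  have S: "closed (S i)" for i
  proof -
    have "S i = box_on I L \<inter> {s. gn (x i s) \<le> 2 * \<eta>'}" by (auto simp: S_def)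
    then show ?thesis
      using closed_Int[OF cl_box closed_Collect_le[OF cont(1)[of i] continuous_on_const, of "2 * \<eta>'"]]
      by (simp add: x_def)
  qed
  have loc: "continuous_on (S i) (\<lambda>s. h (slow_class (x i s)))" for i and h :: "'c \<Rightarrow> real"
    unfolding continuous_on_def
  proof
    fix s assume s: "s \<in> S i"
    have "\<forall>\<^sub>F s' in at s. d (x i s) (x i s') < \<delta>"
      using order_tendstoD(2)[OF cont(3) cst(2)] by (simp add: x_def)
    then have "\<forall>\<^sub>F s' in at s within S i. d (x i s) (x i s') < \<delta>"
      by (metis at_le filter_leD subset_UNIV)
    moreover have "\<forall>\<^sub>F s' in at s within S i. s' \<in> S i"
      by (simp add: eventually_at_filter)
    ultimately have "\<forall>\<^sub>F s' in at s within S i. h (slow_class (x i s')) = h (slow_class (x i s))"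
    proof eventually_elim
      case (elim s')
      then show ?case using slow_class_eq[OF xX _ xf xX _ xf] s by (auto simp: S_def)
    qed
    then show "((\<lambda>s. h (slow_class (x i s))) \<longlongrightarrow> h (slow_class (x i s))) (at s within S i)"
      by (rule tendsto_eventually)
  qed
  \<comment> \<open>The cast to a real lets \<open>loc\<close> apply to the index, so that its level
    sets are closed.\<close>
  define Z' where "Z' j i = {s \<in> S i. real (J (slow_class (x i s))) = real j}" for j i
  have Z': "closed (Z' j i)" for j i
    unfolding Z'_def by (rule continuous_closed_preimage_constant[OF loc S])
  define Z where "Z j = (\<Union>i<n. Z' j i)" for j
  define lam where "lam j s = lab (slow_class (x (SOME i. i < n \<and> s \<in> Z' j i) s))" for j s
  have lam: "lam j s = lab (slow_class (x i s))" if "i < n" "s \<in> Z' j i" for i j s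
  proof -
    define k where "k = (SOME i. i < n \<and> s \<in> Z' j i)"
    have k: "k < n" "s \<in> Z' j k" using someI[of "\<lambda>i. i < n \<and> s \<in> Z' j i" i] that by (auto simp: k_def)
    have "slow_class (x k s) = slow_class (x i s)"
      unfolding x_def
      by (rule slow_class_iter_eq) (use \<Phi> k that in \<open>auto simp: Z'_def S_def x_def intro!: AJ\<close>)
    then show ?thesis by (simp add: lam_def k_def)
  qed
  have drift: "\<bar>\<kappa> (x i s) j - \<kappa> (\<Phi> s) j\<bar> \<le> real i * (C * \<tau>)" for i s j
  proof (induction i)
    case (Suc i)
    have "\<bar>\<kappa> (x i s) j - \<kappa> (g (x i s)) j\<bar> \<le> C * d (x i s) (g (x i s))"
      by (rule \<kappa>(2)[OF xX gX[OF xX]])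
    also have "\<dots> \<le> C * \<tau>"
      using gd[OF xX] st(2)[OF xX] BC by (meson mult_left_mono order_trans)
    finally show ?case using Suc by (simp add: x_def algebra_simps)
  qed (simp add: x_def)
  have "\<exists>s\<in>box_on I L. (\<forall>i\<in>I - K. \<phi> (x n s) i = 0) \<and> (\<forall>j<l. s \<in> Z j \<longrightarrow> lam j s = \<theta>)"
  proof (rule poincare_miranda_avoiding[OF fin K _ idx])
    show "0 < L i" for i using M Lm by (simp add: L_def)
    show "continuous_on (box_on I L) (\<lambda>s. \<phi> (x n s) i)" for i
      using cont(2)[of n i] continuous_on_subset by (auto simp: x_def)
    \<comment> \<open>On the faces in the remaining directions the start is at level
      \<open>a\<close> or below, where the descent stands still; the boundary signs of \<phi>
      therefore survive the \<open>n\<close> steps.\<close>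
    have fx: "x n s = \<Phi> s" if "i \<in> I - K" "\<bar>s i\<bar> = Lm" for s i
    proof -
      have "g (\<Phi> s) = \<Phi> s" using fixed[OF \<Phi>(1)] Lm(2) that by blast
      then have "(g ^^ m) (\<Phi> s) = \<Phi> s" for m by (induction m) auto
      then show ?thesis by (simp add: x_def)
    qed
    show "0 \<le> \<phi> (x n s) i" if "i \<in> I - K" "s i = L i" for s i
      using fx[of i s] that \<Phi>(4)[of i s] Lm(1) by (simp add: L_def)
    show "\<phi> (x n s) i \<le> 0" if "i \<in> I - K" "s i = - L i" for s i
      using fx[of i s] that \<Phi>(4)[of i s] Lm(1) by (simp add: L_def)
    show "closed (Z j)" for j unfolding Z_def using Z' by auto
    show "Z j \<subseteq> box_on I L" for j by (auto simp: Z_def Z'_def S_def)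
    show "continuous_on (Z j) (lam j)" for j
      unfolding Z_def
    proof (rule continuous_on_closed_Union)
      fix i assume i: "i \<in> {..<n}"
      have "continuous_on (Z' j i) (\<lambda>s. lab (slow_class (x i s)))"
        by (rule continuous_on_subset[OF loc]) (auto simp: Z'_def)
      then show "continuous_on (Z' j i) (lam j)"
        using continuous_on_eq lam i by (metis (no_types, lifting) lessThan_iff)
    qed (use Z' in auto)
    show "\<bar>s (idx j) - lam j s\<bar> \<le> B + real n * (C * \<tau>)" if jl: "j < l" "s \<in> Z j" for j s
    proof -
      obtain i where i: "i < n" "s \<in> Z' j i" using jl by (auto simp: Z_def)
      have "\<bar>\<kappa> (x i s) (idx j) - lab (slow_class (x i s))\<bar> \<le> B"
        using \<kappa>(1)[OF xX slow_class(1)[OF xX _ xf]] i by (auto simp: Z'_def S_def)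
      moreover have "real i * (C * \<tau>) \<le> real n * (C * \<tau>)"
        using i BC cst by (intro mult_right_mono) auto
      moreover have "\<kappa> (\<Phi> s) (idx j) = s (idx j)" using \<Phi>(3) jl idx by blast
      ultimately show ?thesis using drift[of i s "idx j"] lam[OF i] by linarith
    qed
    show "0 \<le> B + real n * (C * \<tau>)" using BC cst by simp
    show "B + real n * (C * \<tau>) + \<bar>\<theta>\<bar> \<le> L i" if "i \<in> K" for i
      using that by (simp add: L_def M_def)
  qed
  then obtain s where s: "s \<in> box_on I L" "\<forall>i\<in>I - K. \<phi> (x n s) i = 0"
    "\<And>j. j < l \<Longrightarrow> s \<in> Z j \<Longrightarrow> lam j s = \<theta>" by blast
  have "a + 1 \<le> f (x n s)" using low[OF xX s(2)] .
  then obtain i where i: "i < n" "gn (x i s) \<le> 2 * \<eta>'"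
    using slow_visit[OF \<Phi>(1,2) n] by (auto simp: x_def)
  define j where "j = J (slow_class (x i s))"
  have "s \<in> Z' j i" using i s(1) by (simp add: Z'_def S_def j_def)
  moreover have "s \<in> Z j" using calculation i by (auto simp: Z_def)
  moreover have "near \<delta> (x i s) (slow_class (x i s))" using slow_class(1)[OF xX i(2) xf] .
  ultimately show False using lam[OF i(1)] s(3)[of j] J lab by (metis j_def)
qed

end

section \<open>The discretized action\<close>

text \<open>\<open>P\<close> indexes the non-periodic coordinates \<open>z_I\<close>, \<open>Mom\<close> all momenta, and \<open>cj\<close> sends an index to the
  conjugate one. A loop is sampled as a two-sided sequence. Forward differences in the rows of \<open>Mom\<close> and
  backward ones in the others make \<open>dA\<close> symmetric under summation by parts, so that \<open>rho\<close> is exactly the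
  gradient of \<open>act\<close>.\<close>

locale dsys =
  fixes P Mom :: "'d::finite set" and cj :: "'d \<Rightarrow> 'd" and V :: "real ^ 'd" and T :: real
    and H :: "real ^ 'd \<Rightarrow> real" and G :: "real ^ 'd \<Rightarrow> real ^ 'd" and CG :: real
  assumes T0: "0 < T"
    and cj: "cj (cj c) = c" "cj c \<in> Mom \<longleftrightarrow> c \<notin> Mom"
    and PM: "P \<subseteq> Mom"
    and V: "V $ c \<noteq> 0 \<Longrightarrow> cj c \<in> P"
    and H: "(H has_derivative (\<lambda>h. h \<bullet> G z)) (at z)"
    and G: "uniformly_continuous_on UNIV G"
    and CG: "norm (G z) \<le> CG"
begin

lemma V_Mom: "c \<in> Mom \<Longrightarrow> V $ c = 0"
  using V[of c] PM cj by auto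

definition hs :: "nat \<Rightarrow> real" where "hs N = T / real N"

text \<open>A discrete symplectic derivative: momentum rows hold the forward difference of the
  conjugate position, position rows minus the backward difference of the conjugate momentum. Thus
  \<open>dA Z j = hs N *\<^sub>R G (Z j)\<close> discretizes Hamilton's equations.\<close>

definition dA :: "(int \<Rightarrow> real ^ 'd) \<Rightarrow> int \<Rightarrow> real ^ 'd" where
  "dA Z j = (\<chi> c. (if c \<in> Mom then Z (j + 1) $ cj c else Z (j - 1) $ cj c) - Z j $ cj c)"

definition X :: "nat \<Rightarrow> (int \<Rightarrow> real ^ 'd) set" where "X N = {Z. \<forall>j. Z (j + int N) = Z j + V}"
definition Per :: "nat \<Rightarrow> (int \<Rightarrow> real ^ 'd) set" where "Per N = {Z. \<forall>j. Z (j + int N) = Z j}"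

text \<open>The weight \<open>hs N\<close> makes this a Riemann sum of the L2 product over one
  period, so that bounds in \<open>nr\<close> can be uniform in \<open>N\<close>.\<close>

definition ip :: "nat \<Rightarrow> (int \<Rightarrow> real ^ 'd) \<Rightarrow> (int \<Rightarrow> real ^ 'd) \<Rightarrow> real" where
  "ip N e e' = hs N * (\<Sum>j<N. e (int j) \<bullet> e' (int j))"

definition nr :: "nat \<Rightarrow> (int \<Rightarrow> real ^ 'd) \<Rightarrow> real" where
  "nr N e = sqrt (hs N) * L2_set (\<lambda>j. norm (e (int j))) {..<N}"

definition rho :: "nat \<Rightarrow> (int \<Rightarrow> real ^ 'd) \<Rightarrow> int \<Rightarrow> real ^ 'd" where
  "rho N Z j = dA Z j /\<^sub>R hs N - G (Z j)"

definition act :: "nat \<Rightarrow> (int \<Rightarrow> real ^ 'd) \<Rightarrow> real" where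
  "act N Z = (\<Sum>j<N. \<Sum>c\<in>Mom. Z (int j) $ c * dA Z (int j) $ c) - hs N * (\<Sum>j<N. H (Z (int j)))"

section \<open>Discrete L2 geometry of sampled loops\<close>

lemma hs_pos: "0 < N \<Longrightarrow> 0 < hs N"
  using T0 by (simp add: hs_def)

lemma hs_nonneg: "0 \<le> hs N"
  using T0 by (simp add: hs_def)

lemma N_hs: "0 < N \<Longrightarrow> real N * hs N = T"
  by (simp add: hs_def)

lemma nr_nonneg: "0 \<le> nr N e"
  by (simp add: nr_def hs_nonneg)

lemma nr_square: "(nr N e)\<^sup>2 = ip N e e"
  using hs_nonneg[of N] by (simp add: nr_def ip_def power_mult_distrib L2_set_def sum_nonneg power2_norm_eq_inner)

lemma abs_ip_le: "\<bar>ip N e e'\<bar> \<le> nr N e * nr N e'"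
proof -
  have "\<bar>\<Sum>j<N. e (int j) \<bullet> e' (int j)\<bar> \<le> (\<Sum>j<N. \<bar>norm (e (int j))\<bar> * \<bar>norm (e' (int j))\<bar>)"
    by (rule order_trans[OF sum_abs sum_mono]) (simp add: Cauchy_Schwarz_ineq2)
  also have "\<dots> \<le> L2_set (\<lambda>j. norm (e (int j))) {..<N} * L2_set (\<lambda>j. norm (e' (int j))) {..<N}"
    by (rule L2_set_mult_ineq)
  finally have "hs N * \<bar>\<Sum>j<N. e (int j) \<bullet> e' (int j)\<bar> \<le> hs N *
      (L2_set (\<lambda>j. norm (e (int j))) {..<N} * L2_set (\<lambda>j. norm (e' (int j))) {..<N})"
    by (rule mult_left_mono) (rule hs_nonneg)
  also have "\<dots> = nr N e * nr N e'"
    using hs_nonneg[of N] by (simp add: nr_def)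
  finally show ?thesis by (simp add: ip_def abs_mult hs_nonneg)
qed

lemma nr_triangle: "nr N (\<lambda>j. e j + e' j) \<le> nr N e + nr N e'"
proof -
  have "L2_set (\<lambda>j. norm (e (int j) + e' (int j))) {..<N} \<le>
      L2_set (\<lambda>j. norm (e (int j)) + norm (e' (int j))) {..<N}"
    by (rule L2_set_mono) (auto simp: norm_triangle_ineq)
  also have "\<dots> \<le> L2_set (\<lambda>j. norm (e (int j))) {..<N} + L2_set (\<lambda>j. norm (e' (int j))) {..<N}"
    by (rule L2_set_triangle_ineq)
  finally show ?thesis
    using mult_left_mono[OF _ real_sqrt_ge_zero[OF hs_nonneg[of N]]]
    by (simp add: nr_def flip: distrib_left)
qed

lemma nr_scale: "nr N (\<lambda>j. t *\<^sub>R e j) = \<bar>t\<bar> * nr N e"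
  by (simp add: nr_def L2_set_right_distrib)

lemma nr_minus: "nr N (\<lambda>j. e j - e' j) = nr N (\<lambda>j. e' j - e j)"
  by (simp add: nr_def norm_minus_commute)

lemma nr_le:
  assumes "0 < N" "\<And>j. j < N \<Longrightarrow> norm (e (int j)) \<le> b" "0 \<le> b"
  shows "nr N e \<le> sqrt T * b"
proof -
  have "L2_set (\<lambda>j. norm (e (int j))) {..<N} \<le> L2_set (\<lambda>j. b) {..<N}"
    by (rule L2_set_mono) (use assms in auto)
  also have "\<dots> = sqrt (real N) * b" using assms by (simp add: L2_set_constant)
  finally have "nr N e \<le> sqrt (hs N) * (sqrt (real N) * b)"
    unfolding nr_def by (rule mult_left_mono) (simp add: hs_nonneg)
  also have "\<dots> = sqrt T * b"
    using N_hs[OF assms(1)] by (simp add: mult.commute flip: real_sqrt_mult)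
  finally show ?thesis .
qed

lemma Per_div: "e \<in> Per N \<Longrightarrow> e (j + k * int N) = e j"
proof (induction k rule: int_induct[of _ 0])
  case (step1 i)
  then have "e (j + i * int N + int N) = e (j + i * int N)" by (auto simp: Per_def)
  then show ?case using step1 by (simp add: algebra_simps)
next
  case (step2 i)
  then have "e (j + (i - 1) * int N + int N) = e (j + (i - 1) * int N)" by (auto simp: Per_def)
  then show ?case using step2 by (simp add: algebra_simps)
qed simp

lemma Per_mod: "e \<in> Per N \<Longrightarrow> e j = e (j mod int N)"
  using Per_div[of e N "j mod int N" "j div int N"] by (simp add: mod_div_mult_eq)

lemma X_div: "Z \<in> X N \<Longrightarrow> Z (j + k * int N) = Z j + of_int k *\<^sub>R V"
proof (induction k rule: int_induct[of _ 0])
  case (step1 i)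
  then have "Z (j + i * int N + int N) = Z (j + i * int N) + V" by (auto simp: X_def)
  then show ?case using step1 by (simp add: algebra_simps)
next
  case (step2 i)
  then have "Z (j + (i - 1) * int N + int N) = Z (j + (i - 1) * int N) + V" by (auto simp: X_def)
  then show ?case using step2 by (simp add: algebra_simps)
qed simp

text \<open>The factor blows up as \<open>N\<close> grows, so this serves estimates at fixed
  \<open>N\<close>; uniform sup bounds come from \<open>sup_small\<close>.\<close>

lemma norm_le_nr:
  assumes "e \<in> Per N" "0 < N"
  shows "norm (e j) \<le> nr N e / sqrt (hs N)"
proof -
  define i where "i = nat (j mod int N)"
  have i: "i < N" "e j = e (int i)" using Per_mod[OF assms(1), of j] assms(2) by (auto simp: i_def nat_less_iff)
  have "norm (e j) \<le> L2_set (\<lambda>j. norm (e (int j))) {..<N}"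
    using member_le_L2_set[of "{..<N}" i "\<lambda>j. norm (e (int j))"] i by simp
  then show ?thesis using hs_pos[OF assms(2)] by (simp add: nr_def)
qed

section \<open>The difference operator and the gradient of the action\<close>

lemma dA_add: "dA (\<lambda>j. Z j + e j) j = dA Z j + dA e j"
  by (simp add: dA_def vec_eq_iff)

lemma dA_scale: "dA (\<lambda>j. t *\<^sub>R e j) j = t *\<^sub>R dA e j"
  by (simp add: dA_def vec_eq_iff algebra_simps)

lemma dA_Per: "Z \<in> X N \<Longrightarrow> dA Z \<in> Per N"
proof -
  assume "Z \<in> X N"
  then have *: "Z (j + int N) = Z j + V" for j by (auto simp: X_def)
  have "dA Z (j + int N) $ c = dA Z j $ c" for j c
    using *[of "j + 1"] *[of "j - 1"] *[of j] by (simp add: dA_def algebra_simps)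
  then show ?thesis by (simp add: Per_def vec_eq_iff)
qed

lemma norm_dA_le:
  assumes "\<And>j. norm (e j) \<le> b"
  shows "norm (dA e j) \<le> 2 * real CARD('d) * b"
proof -
  have "norm (dA e j) \<le> (\<Sum>c\<in>UNIV. \<bar>dA e j $ c\<bar>)" by (rule norm_le_l1_cart)
  also have "\<dots> \<le> (\<Sum>c\<in>(UNIV :: 'd set). 2 * b)"
  proof (rule sum_mono)
    fix c
    have "\<bar>e i $ c'\<bar> \<le> b" for i c' using assms[of i] component_le_norm_cart[of "e i" c'] by simp
    from this[of "j + 1" "cj c"] this[of "j - 1" "cj c"] this[of j "cj c"]
    show "\<bar>dA e j $ c\<bar> \<le> 2 * b" by (cases "c \<in> Mom"; simp add: dA_def; linarith)
  qed
  finally show ?thesis by simp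
qed

text \<open>Only the momenta of \<open>W\<close> enter, and these are periodic even for
  \<open>W\<close> in \<open>X N\<close>, because \<open>V\<close> has no momentum
  components.\<close>

lemma summation_by_parts:
  assumes W: "\<And>j c. c \<in> Mom \<Longrightarrow> W (j + int N) $ c = W j $ c" and e: "e \<in> Per N"
  shows "(\<Sum>j<N. \<Sum>c\<in>Mom. W (int j) $ c * dA e (int j) $ c) =
    (\<Sum>j<N. \<Sum>c\<in>-Mom. e (int j) $ c * dA W (int j) $ c)"
proof -
  have "(\<Sum>j<N. \<Sum>c\<in>-Mom. e (int j) $ c * dA W (int j) $ c) =
      (\<Sum>j<N. \<Sum>c\<in>Mom. e (int j) $ cj c * dA W (int j) $ cj c)"
    by (intro sum.cong refl sum.reindex_bij_witness[of _ cj cj]) (auto simp: cj)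
  moreover have "(\<Sum>j<N. W (int j) $ c * dA e (int j) $ c) =
      (\<Sum>j<N. e (int j) $ cj c * dA W (int j) $ cj c)" if c: "c \<in> Mom" for c
  proof -
    \<comment> \<open>Forward and backward differences are shifted by exactly one sample, which
      makes the difference of the two sums telescope.\<close>
    define p where "p j = W (int j - 1) $ c * e (int j) $ cj c" for j :: nat
    have ne: "cj c \<notin> Mom" using c cj by blast
    have "(\<Sum>j<N. p (Suc j) - p j) = p N - p 0" by (rule sum_lessThan_telescope)
    also have "\<dots> = 0" using W[OF c, of "-1"] e by (simp add: p_def Per_def)
      (metis add_0)
    finally have "(\<Sum>j<N. p (Suc j) - p j) = 0" .
    moreover have "W (int j) $ c * dA e (int j) $ c - e (int j) $ cj c * dA W (int j) $ cj c =
        p (Suc j) - p j" for j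
      using c ne by (simp add: dA_def p_def cj algebra_simps)
    ultimately have "(\<Sum>j<N. W (int j) $ c * dA e (int j) $ c - e (int j) $ cj c * dA W (int j) $ cj c) = 0"
      by simp
    then show ?thesis by (simp add: sum_subtractf)
  qed
  ultimately have eq: "(\<Sum>c\<in>Mom. \<Sum>j<N. W (int j) $ c * dA e (int j) $ c) =
      (\<Sum>c\<in>Mom. \<Sum>j<N. e (int j) $ cj c * dA W (int j) $ cj c)"
    and R: "(\<Sum>j<N. \<Sum>c\<in>-Mom. e (int j) $ c * dA W (int j) $ c) =
      (\<Sum>j<N. \<Sum>c\<in>Mom. e (int j) $ cj c * dA W (int j) $ cj c)"
    by (auto intro: sum.cong)
  show ?thesis
    unfolding R by (subst (1 2) sum.swap) (rule eq)
qed

lemma act_derivative: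
  assumes Z: "Z \<in> X N" and e: "e \<in> Per N" and N: "0 < N"
  shows "((\<lambda>t. act N (\<lambda>j. Z j + t *\<^sub>R e j)) has_real_derivative
    ip N (rho N (\<lambda>j. Z j + t *\<^sub>R e j)) e) (at t)"
proof -
  define W where "W = (\<lambda>j. Z j + t *\<^sub>R e j)"
  have dH: "((\<lambda>t. H (Z j + t *\<^sub>R e j)) has_real_derivative e j \<bullet> G (W j)) (at t)" for j
  proof -
    have "((\<lambda>t. Z j + t *\<^sub>R e j) has_derivative (\<lambda>t. t *\<^sub>R e j)) (at t)"
      by (auto intro!: derivative_eq_intros)
    from has_derivative_compose[OF this H] show ?thesis
      by (simp add: has_field_derivative_def W_def mult_commute_abs)
  qed
  have dP: "((\<lambda>t. (Z j + t *\<^sub>R e j) $ c * (dA Z j + t *\<^sub>R dA e j) $ c) has_real_derivative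
      e j $ c * dA W j $ c + W j $ c * dA e j $ c) (at t)" for j c
    unfolding vector_add_component vector_scaleR_component
    by (auto intro!: derivative_eq_intros simp: W_def dA_add dA_scale algebra_simps)
  have W: "W (j + int N) $ c = W j $ c" if "c \<in> Mom" for j c
    using Z e V_Mom[OF that] by (simp add: W_def X_def Per_def)
  have "((\<lambda>t. act N (\<lambda>j. Z j + t *\<^sub>R e j)) has_real_derivative
      (\<Sum>j<N. \<Sum>c\<in>Mom. e (int j) $ c * dA W (int j) $ c + W (int j) $ c * dA e (int j) $ c)
      - hs N * (\<Sum>j<N. e (int j) \<bullet> G (W (int j)))) (at t)"
    unfolding act_def dA_add dA_scale
    by (intro DERIV_diff DERIV_sum DERIV_cmult dP[unfolded dA_add dA_scale] dH)
  also have "(\<Sum>j<N. \<Sum>c\<in>Mom. e (int j) $ c * dA W (int j) $ c + W (int j) $ c * dA e (int j) $ c) =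
     (\<Sum>j<N. (\<Sum>c\<in>Mom. e (int j) $ c * dA W (int j) $ c) + (\<Sum>c\<in>-Mom. e (int j) $ c * dA W (int j) $ c))"
    using summation_by_parts[of W N e, OF W e] by (simp add: sum.distrib)
  also have "\<dots> = (\<Sum>j<N. e (int j) \<bullet> dA W (int j))"
  proof (rule sum.cong[OF refl])
    fix j
    have "(\<Sum>c\<in>Mom. e (int j) $ c * dA W (int j) $ c) + (\<Sum>c\<in>-Mom. e (int j) $ c * dA W (int j) $ c)
      = (\<Sum>c\<in>UNIV. e (int j) $ c * dA W (int j) $ c)"
      using sum.union_disjoint[of Mom "-Mom" "\<lambda>c. e (int j) $ c * dA W (int j) $ c"] by simp
    then show "(\<Sum>c\<in>Mom. e (int j) $ c * dA W (int j) $ c) + (\<Sum>c\<in>-Mom. e (int j) $ c * dA W (int j) $ c)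
      = e (int j) \<bullet> dA W (int j)" by (simp add: inner_vec_def)
  qed
  also have "(\<Sum>j<N. e (int j) \<bullet> dA W (int j)) - hs N * (\<Sum>j<N. e (int j) \<bullet> G (W (int j))) =
      ip N (rho N W) e"
    using hs_pos[OF N]
    by (simp add: ip_def rho_def sum_distrib_left inner_diff_right right_diff_distrib sum_subtractf inner_commute[of _ "e _"])
      (simp flip: mult.assoc)
  finally show ?thesis by (simp add: W_def)
qed

lemma X_add: "Z \<in> X N \<Longrightarrow> e \<in> Per N \<Longrightarrow> (\<lambda>j. Z j + t *\<^sub>R e j) \<in> X N"
  by (simp add: X_def Per_def)

lemma X_diff: "Z \<in> X N \<Longrightarrow> Z' \<in> X N \<Longrightarrow> (\<lambda>j. Z j - Z' j) \<in> Per N"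
  by (simp add: X_def Per_def)

text \<open>The modulus is uniform over the unbounded space of loops, since \<open>dA\<close> is
  linear and \<open>G\<close> uniformly continuous; this permits one maximal step length for the
  whole descent. It depends on \<open>N\<close> through the division by \<open>hs N\<close>.\<close>

lemma rho_unif:
  assumes N: "0 < N" and \<epsilon>: "0 < \<epsilon>"
  obtains \<tau> where "0 < \<tau>" "\<And>Z e. e \<in> Per N \<Longrightarrow> nr N e \<le> \<tau> \<Longrightarrow>
    nr N (\<lambda>j. rho N (\<lambda>j. Z j + e j) j - rho N Z j) \<le> \<epsilon>"
proof -
  define \<epsilon>1 where "\<epsilon>1 = \<epsilon> / (2 * sqrt T)"
  have \<epsilon>1: "0 < \<epsilon>1" using \<epsilon> T0 by (simp add: \<epsilon>1_def)
  obtain \<tau>1 where \<tau>1: "0 < \<tau>1" "\<And>x y. dist y x < \<tau>1 \<Longrightarrow> dist (G y) (G x) < \<epsilon>1"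
    using G[unfolded uniformly_continuous_on_def, rule_format, OF \<epsilon>1] by auto
  define D where "D = 2 * real CARD('d)"
  have D: "0 < D" by (simp add: D_def)
  define b where "b = min (\<tau>1 / 2) (\<epsilon>1 * hs N / D)"
  have b: "0 < b" using \<tau>1 \<epsilon>1 hs_pos[OF N] D by (simp add: b_def)
  show thesis
  proof (rule that[of "b * sqrt (hs N)"])
    show "0 < b * sqrt (hs N)" using b hs_pos[OF N] by simp
    fix Z e assume e: "e \<in> Per N" "nr N e \<le> b * sqrt (hs N)"
    have eb: "norm (e j) \<le> b" for j
      using norm_le_nr[OF e(1) N, of j] e(2) hs_pos[OF N]
      by (smt (verit) divide_le_eq real_sqrt_gt_zero)
    have "norm (rho N (\<lambda>j. Z j + e j) j - rho N Z j) \<le> 2 * \<epsilon>1" for j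
    proof -
      have "norm (dA e j) \<le> D * b" using norm_dA_le[of e b j] eb by (simp add: D_def)
      also have "\<dots> \<le> \<epsilon>1 * hs N" using D by (simp add: b_def min_def field_simps)
      finally have "norm (dA e j /\<^sub>R hs N) \<le> \<epsilon>1" using hs_pos[OF N] by (simp add: divide_simps mult.commute)
      moreover have "norm (G (Z j + e j) - G (Z j)) \<le> \<epsilon>1"
      proof -
        have "b \<le> \<tau>1 / 2" unfolding b_def by (rule min.cobounded1)
        then have "norm (e j) < \<tau>1" using eb[of j] \<tau>1(1) by linarith
        then show ?thesis using \<tau>1(2)[of "Z j + e j" "Z j"] by (simp add: dist_norm)
      qed
      moreover have "rho N (\<lambda>j. Z j + e j) j - rho N Z j = dA e j /\<^sub>R hs N - (G (Z j + e j) - G (Z j))"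
        by (simp add: rho_def dA_add algebra_simps)
      ultimately show ?thesis using norm_triangle_ineq4[of "dA e j /\<^sub>R hs N" "G (Z j + e j) - G (Z j)"] by simp
    qed
    then have "nr N (\<lambda>j. rho N (\<lambda>j. Z j + e j) j - rho N Z j) \<le> sqrt T * (2 * \<epsilon>1)"
      by (intro nr_le N) (use \<epsilon>1 in auto)
    also have "\<dots> = \<epsilon>" using T0 by (simp add: \<epsilon>1_def)
    finally show "nr N (\<lambda>j. rho N (\<lambda>j. Z j + e j) j - rho N Z j) \<le> \<epsilon>" .
  qed
qed

lemma ip_diff_left: "ip N (\<lambda>j. e j - e' j) e'' = ip N e e'' - ip N e' e''"
  by (simp add: ip_def inner_diff_left sum_subtractf right_diff_distrib)

lemma act_expand:
  assumes N: "0 < N" and \<epsilon>: "0 < \<epsilon>"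
  obtains \<tau> where "0 < \<tau>" "\<And>Z e. Z \<in> X N \<Longrightarrow> e \<in> Per N \<Longrightarrow> nr N e \<le> \<tau> \<Longrightarrow>
    act N (\<lambda>j. Z j + e j) \<le> act N Z + ip N (rho N Z) e + \<epsilon> * nr N e"
proof -
  obtain \<tau> where \<tau>: "0 < \<tau>" "\<And>Z e. e \<in> Per N \<Longrightarrow> nr N e \<le> \<tau> \<Longrightarrow>
    nr N (\<lambda>j. rho N (\<lambda>j. Z j + e j) j - rho N Z j) \<le> \<epsilon>" using rho_unif[OF assms] by metis
  show thesis
  proof (rule that[OF \<tau>(1)])
    fix Z e assume Z: "Z \<in> X N" "e \<in> Per N" "nr N e \<le> \<tau>"
    obtain t where t: "0 < t" "t < 1" "act N (\<lambda>j. Z j + 1 *\<^sub>R e j) - act N (\<lambda>j. Z j + 0 *\<^sub>R e j) =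
        (1 - 0) * ip N (rho N (\<lambda>j. Z j + t *\<^sub>R e j)) e"
      using MVT2[of 0 1 "\<lambda>t. act N (\<lambda>j. Z j + t *\<^sub>R e j)", OF _ act_derivative[OF Z(1,2) N]] by auto
    have te: "(\<lambda>j. t *\<^sub>R e j) \<in> Per N" using Z(2) by (simp add: Per_def)
    have "nr N (\<lambda>j. t *\<^sub>R e j) \<le> \<tau>"
      using Z(3) t nr_nonneg[of N e] mult_right_mono[of t 1 "nr N e"] by (simp add: nr_scale)
    then have "nr N (\<lambda>j. rho N (\<lambda>j. Z j + t *\<^sub>R e j) j - rho N Z j) \<le> \<epsilon>" using \<tau>(2)[OF te] by blast
    then have "ip N (\<lambda>j. rho N (\<lambda>j. Z j + t *\<^sub>R e j) j - rho N Z j) e \<le> \<epsilon> * nr N e"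
      using abs_ip_le[of N "\<lambda>j. rho N (\<lambda>j. Z j + t *\<^sub>R e j) j - rho N Z j" e] nr_nonneg[of N e]
      by (smt (verit) mult_right_mono)
    then show "act N (\<lambda>j. Z j + e j) \<le> act N Z + ip N (rho N Z) e + \<epsilon> * nr N e"
      using t(3) by (simp add: ip_diff_left)
  qed
qed

text \<open>The two factors are continuous cut-offs: no motion where the gradient is at most \<eta>
  or the action at most \<open>a\<close>, a full step \<tau> once the gradient reaches 2 \<eta> and
  the action \<open>a + 1\<close>. The topological argument needs the continuity.\<close>

definition step_len :: "real \<Rightarrow> real \<Rightarrow> real \<Rightarrow> nat \<Rightarrow> (int \<Rightarrow> real ^ 'd) \<Rightarrow> real" where
  "step_len \<tau> \<eta> a N Z = \<tau> * min 1 (max 0 (nr N (rho N Z) / \<eta> - 1)) * min 1 (max 0 (act N Z - a))"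

text \<open>The maximum avoids a division by zero. Wherever \<open>step_len\<close> is not zero it
  is the norm of the gradient, so the move has length exactly \<open>step_len\<close>.\<close>

definition step :: "real \<Rightarrow> real \<Rightarrow> real \<Rightarrow> nat \<Rightarrow> (int \<Rightarrow> real ^ 'd) \<Rightarrow> int \<Rightarrow> real ^ 'd" where
  "step \<tau> \<eta> a N Z j = Z j - (step_len \<tau> \<eta> a N Z / max \<eta> (nr N (rho N Z))) *\<^sub>R rho N Z j"

lemma rho_Per: "Z \<in> X N \<Longrightarrow> (\<And>z. G (z + V) = G z) \<Longrightarrow> rho N Z \<in> Per N"
proof -
  assume "Z \<in> X N" and per: "\<And>z. G (z + V) = G z"
  then have "rho N Z (j + int N) = rho N Z j" for j
    using dA_Per[OF \<open>Z \<in> X N\<close>] unfolding Per_def X_def rho_def mem_Collect_eq by metis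
  then show ?thesis by (simp add: Per_def)
qed

lemma step_len_bounds:
  assumes "0 < \<tau>" "0 < \<eta>"
  shows "0 \<le> step_len \<tau> \<eta> a N Z" "step_len \<tau> \<eta> a N Z \<le> \<tau>"
    "step_len \<tau> \<eta> a N Z \<noteq> 0 \<Longrightarrow> \<eta> < nr N (rho N Z)"
    "act N Z \<le> a \<Longrightarrow> step_len \<tau> \<eta> a N Z = 0"
    "2 * \<eta> \<le> nr N (rho N Z) \<Longrightarrow> a + 1 \<le> act N Z \<Longrightarrow> step_len \<tau> \<eta> a N Z = \<tau>"
proof -
  define u where "u = min 1 (max 0 (nr N (rho N Z) / \<eta> - 1))"
  define w where "w = min 1 (max 0 (act N Z - a))"
  have u: "0 \<le> u" "u \<le> 1" "0 \<le> w" "w \<le> 1" by (auto simp: u_def w_def)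
  have eq: "step_len \<tau> \<eta> a N Z = \<tau> * (u * w)" by (simp add: step_len_def u_def w_def)
  have "u * w \<le> 1" using u by (simp add: mult_le_one)
  then show "0 \<le> step_len \<tau> \<eta> a N Z" "step_len \<tau> \<eta> a N Z \<le> \<tau>"
    unfolding eq using u assms by (auto simp: mult_left_le)
  show "step_len \<tau> \<eta> a N Z \<noteq> 0 \<Longrightarrow> \<eta> < nr N (rho N Z)"
    unfolding eq using assms by (auto simp: u_def min_def max_def field_simps split: if_splits)
  show "act N Z \<le> a \<Longrightarrow> step_len \<tau> \<eta> a N Z = 0" unfolding eq by (simp add: w_def)
  assume "2 * \<eta> \<le> nr N (rho N Z)" "a + 1 \<le> act N Z"
  then have "1 \<le> nr N (rho N Z) / \<eta> - 1" using assms by (simp add: field_simps)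
  then have "u = 1" "w = 1" using \<open>a + 1 \<le> act N Z\<close> by (auto simp: u_def w_def)
  then show "step_len \<tau> \<eta> a N Z = \<tau>" unfolding eq by simp
qed

lemma step_X:
  assumes "Z \<in> X N" "\<And>z. G (z + V) = G z"
  shows "step \<tau> \<eta> a N Z \<in> X N"
proof -
  have "step \<tau> \<eta> a N Z = (\<lambda>j. Z j + (- (step_len \<tau> \<eta> a N Z / max \<eta> (nr N (rho N Z)))) *\<^sub>R rho N Z j)"
    by (simp add: step_def[abs_def])
  then show ?thesis using X_add[OF assms(1) rho_Per[OF assms]] by (metis (no_types))
qed

lemma nr_step:
  assumes "0 < \<tau>" "0 < \<eta>"
  shows "nr N (\<lambda>j. step \<tau> \<eta> a N Z j - Z j) = step_len \<tau> \<eta> a N Z"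
proof -
  define \<sigma> where "\<sigma> = step_len \<tau> \<eta> a N Z / max \<eta> (nr N (rho N Z))"
  have "nr N (\<lambda>j. step \<tau> \<eta> a N Z j - Z j) = nr N (\<lambda>j. (- \<sigma>) *\<^sub>R rho N Z j)"
    by (simp add: step_def \<sigma>_def)
  also have "\<dots> = \<bar>\<sigma>\<bar> * nr N (rho N Z)" by (simp only: nr_scale abs_minus_cancel)
  also have "\<dots> = step_len \<tau> \<eta> a N Z"
    using step_len_bounds[OF assms, where a = a and N = N and Z = Z] assms
    by (cases "step_len \<tau> \<eta> a N Z = 0") (auto simp: \<sigma>_def max_def)
  finally show ?thesis .
qed

text \<open>With gradient norm r and step length s the first-order gain is r s; the error \<eta> s /
  2 takes at most half of it, because a nonzero step requires r > \<eta>.\<close>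

lemma act_step:
  assumes \<tau>: "0 < \<tau>" "0 < \<eta>" "\<And>Z e. Z \<in> X N \<Longrightarrow> e \<in> Per N \<Longrightarrow> nr N e \<le> \<tau> \<Longrightarrow>
      act N (\<lambda>j. Z j + e j) \<le> act N Z + ip N (rho N Z) e + \<eta> / 2 * nr N e"
    and Z: "Z \<in> X N" and per: "\<And>z. G (z + V) = G z"
  shows "act N (step \<tau> \<eta> a N Z) \<le> act N Z - nr N (rho N Z) * step_len \<tau> \<eta> a N Z / 2"
proof (cases "step_len \<tau> \<eta> a N Z = 0")
  case True
  then show ?thesis by (simp add: step_def[abs_def])
next
  case False
  define r where "r = nr N (rho N Z)"
  define s where "s = step_len \<tau> \<eta> a N Z"
  have r: "\<eta> < r" using step_len_bounds(3)[OF \<tau>(1,2) False] by (simp add: r_def)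
  have s: "0 \<le> s" "s \<le> \<tau>" using step_len_bounds[OF \<tau>(1,2)] by (auto simp: s_def)
  define e where "e = (\<lambda>j. (- (s / r)) *\<^sub>R rho N Z j)"
  have st: "step \<tau> \<eta> a N Z = (\<lambda>j. Z j + e j)"
    using r by (auto simp: step_def e_def s_def r_def max_def)
  have e: "e \<in> Per N" using rho_Per[OF Z per] by (simp add: Per_def e_def)
  have ne: "nr N e = s" using nr_step[OF \<tau>(1,2), of N a Z] by (simp add: st s_def)
  have "ip N (rho N Z) e = - (s / r) * ip N (rho N Z) (rho N Z)"
    by (simp add: ip_def e_def sum_distrib_left algebra_simps)
  also have "\<dots> = - (s * r)" using r \<tau>(2) by (simp add: nr_square[symmetric] r_def[symmetric] power2_eq_square)
  finally have "act N (step \<tau> \<eta> a N Z) \<le> act N Z - s * r + \<eta> / 2 * s"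
    using \<tau>(3)[OF Z e] ne s by (simp add: st)
  moreover have "\<eta> * s \<le> r * s" using r s by (intro mult_right_mono) auto
  moreover have "s * r = r * s" by simp
  ultimately show ?thesis unfolding r_def[symmetric] s_def[symmetric] by linarith
qed

section \<open>Continuous dependence of the descent on its start\<close>

lemma continuous_on_coord:
  fixes f :: "'x::topological_space \<Rightarrow> int \<Rightarrow> real ^ 'd"
  assumes "continuous_on S f"
  shows "continuous_on S (\<lambda>s. f s j)"
  by (rule continuous_on_product_then_coordinatewise[OF assms])

lemma continuous_on_dA [continuous_intros]:
  fixes f :: "'x::topological_space \<Rightarrow> int \<Rightarrow> real ^ 'd"
  assumes "continuous_on S f"
  shows "continuous_on S (\<lambda>s. dA (f s) j)"
proof -
  have "continuous_on S (\<lambda>s. (if c \<in> Mom then f s (j + 1) $ cj c else f s (j - 1) $ cj c) - f s j $ cj c)" for c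
    by (cases "c \<in> Mom"; simp; intro continuous_on_diff continuous_on_component continuous_on_coord[OF assms])
  then show ?thesis unfolding dA_def by (intro continuous_on_vec_lambda)
qed

lemma continuous_on_G [continuous_intros]:
  "continuous_on S f \<Longrightarrow> continuous_on S (\<lambda>s. G (f s))"
  by (rule continuous_on_compose2[OF uniformly_continuous_imp_continuous[OF G]]) auto

lemma continuous_on_H [continuous_intros]:
  assumes "continuous_on S f"
  shows "continuous_on S (\<lambda>s. H (f s))"
proof -
  have "continuous_on UNIV H" using H has_derivative_continuous by (meson continuous_at_imp_continuous_on)
  from continuous_on_compose2[OF this assms] show ?thesis by auto
qed

lemma continuous_on_nr [continuous_intros]:
  fixes f :: "'x::topological_space \<Rightarrow> int \<Rightarrow> real ^ 'd"
  assumes "\<And>j. continuous_on S (\<lambda>s. f s j)"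
  shows "continuous_on S (\<lambda>s. nr N (f s))"
  unfolding nr_def L2_set_def by (intro continuous_on_mult continuous_on_const continuous_on_real_sqrt
      continuous_on_sum continuous_on_power continuous_on_norm) (rule assms)

lemma continuous_on_rho [continuous_intros]:
  fixes f :: "'x::topological_space \<Rightarrow> int \<Rightarrow> real ^ 'd"
  assumes "continuous_on S f"
  shows "continuous_on S (\<lambda>s. rho N (f s) j)"
  unfolding rho_def
  by (rule continuous_on_diff[OF continuous_on_scaleR[OF continuous_on_const continuous_on_dA[OF assms]]
        continuous_on_G[OF continuous_on_coord[OF assms]]])

lemma continuous_on_act [continuous_intros]:
  fixes f :: "'x::topological_space \<Rightarrow> int \<Rightarrow> real ^ 'd"
  assumes "continuous_on S f"
  shows "continuous_on S (\<lambda>s. act N (f s))"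
proof -
  have "continuous_on S (\<lambda>s. f s j $ c * dA (f s) j $ c)" for j c
    by (rule continuous_on_mult[OF continuous_on_component[OF continuous_on_coord[OF assms]]
          continuous_on_component[OF continuous_on_dA[OF assms]]])
  moreover have "continuous_on S (\<lambda>s. H (f s j))" for j
    by (rule continuous_on_H[OF continuous_on_coord[OF assms]])
  ultimately show ?thesis
    unfolding act_def
    by (intro continuous_on_diff[OF continuous_on_sum[OF continuous_on_sum]
          continuous_on_mult[OF continuous_on_const continuous_on_sum]])
qed

lemma continuous_on_step:
  fixes f :: "'x::topological_space \<Rightarrow> int \<Rightarrow> real ^ 'd"
  assumes "continuous_on S f" "0 < \<eta>"
  shows "continuous_on S (\<lambda>s. step \<tau> \<eta> a N (f s))"
proof -
  note rho = continuous_on_rho[OF assms(1), of N]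
  note nr = continuous_on_nr[OF rho, of N]
  note act = continuous_on_act[OF assms(1), of N]
  have "continuous_on S (\<lambda>s. step_len \<tau> \<eta> a N (f s))"
    unfolding step_len_def
    by (intro continuous_on_mult continuous_on_min continuous_on_max continuous_on_diff
        continuous_on_divide continuous_on_const nr act) (use assms(2) in simp)
  then have "continuous_on S (\<lambda>s. step_len \<tau> \<eta> a N (f s) / max \<eta> (nr N (rho N (f s))))"
    by (rule continuous_on_divide[OF _ continuous_on_max[OF continuous_on_const nr]]) (use assms(2) in auto)
  from continuous_on_diff[OF continuous_on_coord[OF assms(1)] continuous_on_scaleR[OF this rho]]
  show ?thesis unfolding step_def[abs_def] by (rule continuous_on_coordinatewise_then_product)
qed

lemma continuous_on_step_iter:
  fixes f :: "'x::topological_space \<Rightarrow> int \<Rightarrow> real ^ 'd"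
  assumes "continuous_on S f" "0 < \<eta>"
  shows "continuous_on S (\<lambda>s. (step \<tau> \<eta> a N ^^ i) (f s))"
proof (induction i)
  case (Suc i)
  then show ?case using continuous_on_step[OF Suc assms(2)] by simp
qed (use assms in simp)

end

section \<open>Coordinate projections and lattice translations\<close>

definition proj_on :: "'d set \<Rightarrow> real ^ 'd \<Rightarrow> real ^ 'd::finite" where
  "proj_on P z = (\<chi> c. if c \<in> P then z $ c else 0)"

lemma proj_on_nth [simp]: "proj_on P z $ c = (if c \<in> P then z $ c else 0)"
  by (simp add: proj_on_def)

lemma proj_on_add: "proj_on P (x + y) = proj_on P x + proj_on P y"
  by (simp add: vec_eq_iff)

lemma norm_square_vec: "(norm (z :: real ^ 'd))\<^sup>2 = (\<Sum>c\<in>UNIV. (z $ c)\<^sup>2)"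
  unfolding power2_norm_eq_inner inner_vec_def by (simp add: power2_eq_square)

lemma norm_proj_on_square: "(norm (proj_on P z))\<^sup>2 = (\<Sum>c\<in>P. (z $ c)\<^sup>2)"
proof -
  have "(norm (proj_on P z))\<^sup>2 = (\<Sum>c\<in>UNIV. if c \<in> P then (z $ c)\<^sup>2 else 0)"
    unfolding norm_square_vec by (intro sum.cong) auto
  then show ?thesis by (simp add: sum.If_cases)
qed

lemma continuous_on_proj_on [continuous_intros]:
  "continuous_on S f \<Longrightarrow> continuous_on S (\<lambda>x. proj_on P (f x))"
proof -
  assume f: "continuous_on S f"
  have "continuous_on S (\<lambda>x. if c \<in> P then f x $ c else 0)" for c
    by (cases "c \<in> P") (auto intro: continuous_on_component[OF f])
  then show ?thesis unfolding proj_on_def by (rule continuous_on_vec_lambda)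
qed

text \<open>The translations (0, m) under which \<open>H\<close> is periodic; \<open>V\<close>
  itself will be one of them.\<close>

definition Lat :: "'d set \<Rightarrow> (real ^ 'd::finite) set" where
  "Lat P = {m. (\<forall>c. m $ c \<in> \<int>) \<and> (\<forall>c\<in>P. m $ c = 0)}"

section \<open>The linking set\<close>

locale dsys_lin = dsys P Mom cj V T H G CG
  for P Mom :: "'d::finite set" and cj V T H G CG +
  fixes i0 :: 'd and K C0 C1 :: real
  assumes i0: "V $ i0 \<noteq> 0" and VL: "V \<in> Lat P"
    and per: "m \<in> Lat P \<Longrightarrow> H (z + m) = H z" "m \<in> Lat P \<Longrightarrow> G (z + m) = G z"
    and low0: "norm V / T * norm (proj_on P z) - C0 \<le> H z"
    and low1: "K * norm (proj_on P z) - C1 \<le> H z"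
    and up: "H z \<le> K * norm (proj_on P z) + C1"
    and K: "norm V < K * T"
begin

lemma V_cj: "c \<notin> P \<Longrightarrow> V $ cj c = 0"
  using V[of "cj c"] cj(1) by auto

lemma i0_Mom: "i0 \<notin> Mom"
  using V[OF i0] PM cj by auto

lemma K_pos: "0 < K"
  using K T0 norm_ge_zero[of V] by (smt (verit) zero_less_mult_iff)

text \<open>On the linking set the momenta are tied to the position increments \<open>d j\<close> by \<open>U j = c - d j\<close>. As the
  increments of one period add up to \<open>V\<close>, the kinetic part of the action is \<open>c \<bullet> V\<close> minus the sum of the
  squares of the \<open>d j\<close>, which is bounded above. The parameters are \<open>\<beta> j = U j - d j\<close>, taken relative to
  \<open>\<beta> 0\<close> for the periodic momenta, and the initial positions, with the coordinate \<open>i0\<close> normalized away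
  by the time shift.\<close>

definition bco :: "(nat \<times> 'd \<Rightarrow> real) \<Rightarrow> nat \<Rightarrow> 'd \<Rightarrow> real" where
  "bco s j c = (if c \<in> P then s (j, c) else if j = 0 then s (0, c) else s (0, c) + s (j, c))"

text \<open>From \<beta> = c - 2 d the increments are d = (c - \<beta>) / 2; this c is the one for
  which they add up to the component of \<open>V\<close>.\<close>

definition cco :: "nat \<Rightarrow> (nat \<times> 'd \<Rightarrow> real) \<Rightarrow> 'd \<Rightarrow> real" where
  "cco N s c = ((\<Sum>j<N. bco s j c) + 2 * V $ cj c) / real N"

definition dco :: "nat \<Rightarrow> (nat \<times> 'd \<Rightarrow> real) \<Rightarrow> nat \<Rightarrow> 'd \<Rightarrow> real" where
  "dco N s j c = (cco N s c - bco s j c) / 2"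

definition base :: "nat \<Rightarrow> (nat \<times> 'd \<Rightarrow> real) \<Rightarrow> nat \<Rightarrow> real ^ 'd" where
  "base N s r = (\<chi> c. if c \<in> Mom then cco N s c - dco N s r c
      else (if c = i0 then 0 else s (0, c)) + (\<Sum>i<r. dco N s i (cj c)))"

definition Phi :: "nat \<Rightarrow> (nat \<times> 'd \<Rightarrow> real) \<Rightarrow> int \<Rightarrow> real ^ 'd" where
  "Phi N s j = base N s (nat (j mod int N)) + of_int (j div int N) *\<^sub>R V"

definition beta :: "(int \<Rightarrow> real ^ 'd) \<Rightarrow> nat \<Rightarrow> 'd \<Rightarrow> real" where
  "beta Z j c = Z (int j) $ c - dA Z (int j) $ c"

definition tc :: "(int \<Rightarrow> real ^ 'd) \<Rightarrow> 'd \<Rightarrow> real" where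
  "tc Z c = (if c \<in> Mom then beta Z 0 c else Z 0 $ c)"

text \<open>Subtracting the multiple of \<open>V\<close> that kills the coordinate \<open>i0\<close>
  makes these coordinates invariant under translation by \<open>V\<close>, that is, under a time
  shift by one period.\<close>

definition kap :: "(int \<Rightarrow> real ^ 'd) \<Rightarrow> nat \<times> 'd \<Rightarrow> real" where
  "kap Z i = tc Z (snd i) - V $ snd i / V $ i0 * tc Z i0"

text \<open>Its common zeros over \<open>Idx N - Tor\<close> form the set that the linking set links
  with: there z_I equals the increments of the conjugate positions, and every other momentum differs
  from such increments by a constant.\<close>

definition phi :: "(int \<Rightarrow> real ^ 'd) \<Rightarrow> nat \<times> 'd \<Rightarrow> real" where
  "phi Z i = beta Z (fst i) (snd i) - (if snd i \<in> P then 0 else beta Z 0 (snd i))"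

definition Idx :: "nat \<Rightarrow> (nat \<times> 'd) set" where
  "Idx N = {(j, c). j < N \<and> (c \<in> Mom \<or> j = 0) \<and> c \<noteq> i0}"

text \<open>There are card (- P) - 1 of these directions, and each class to be avoided uses up
  one.\<close>

definition Tor :: "(nat \<times> 'd) set" where
  "Tor = {(j, c). j = 0 \<and> c \<notin> P \<and> c \<noteq> i0}"

lemma Phi_X:
  assumes "0 < N"
  shows "Phi N s \<in> X N"
  unfolding X_def mem_Collect_eq
proof
  fix j
  have "(j + int N) div int N = j div int N + 1" "(j + int N) mod int N = j mod int N"
    using assms by simp_all
  then show "Phi N s (j + int N) = Phi N s j + V"
    by (simp only: Phi_def of_int_add of_int_1 scaleR_add_left scaleR_one add.assoc)
qed

lemma Phi_nat: "j < N \<Longrightarrow> Phi N s (int j) = base N s j"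
  by (simp add: Phi_def)

lemma sum_dco: "0 < N \<Longrightarrow> (\<Sum>j<N. dco N s j c) = V $ cj c"
  by (simp add: dco_def cco_def sum_subtractf flip: sum_divide_distrib)

lemma dA_Phi:
  assumes N: "0 < N" and j: "j < N" and c: "c \<in> Mom"
  shows "dA (Phi N s) (int j) $ c = dco N s j c"
proof -
  have nc: "cj c \<notin> Mom" using c cj by blast
  show ?thesis
  proof (cases "Suc j < N")
    case True
    have "Phi N s (int j + 1) = base N s (Suc j)"
      using Phi_nat[OF True, of s] by (simp add: add.commute)
    then show ?thesis using c nc j by (simp add: dA_def Phi_nat base_def cj)
  next
    case False
    then have jN: "Suc j = N" using j by simp
    have "Phi N s (0 + int N) = Phi N s 0 + V" using Phi_X[OF N, of s] unfolding X_def by blast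
    moreover have j1: "int j + 1 = 0 + int N" using jN by simp
    ultimately have "Phi N s (int j + 1) = base N s 0 + V"
      using Phi_nat[OF N, of s] unfolding j1 by simp
    moreover have "(\<Sum>i<j. dco N s i c) + dco N s j c = V $ cj c"
      using sum_dco[OF N, of s c] jN by (metis sum.lessThan_Suc)
    ultimately show ?thesis using c nc j by (simp add: dA_def Phi_nat base_def cj)
  qed
qed

lemma beta_Phi: "0 < N \<Longrightarrow> j < N \<Longrightarrow> c \<in> Mom \<Longrightarrow> beta (Phi N s) j c = bco s j c"
  by (simp add: beta_def dA_Phi Phi_nat base_def) (simp add: dco_def field_simps)

lemma kap_Phi:
  assumes "0 < N" "i \<in> Tor"
  shows "kap (Phi N s) i = s i"
proof -
  obtain c where i: "i = (0, c)" "c \<notin> P" "c \<noteq> i0" using assms(2) by (auto simp: Tor_def)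
  have "tc (Phi N s) i0 = 0" using i0_Mom Phi_nat[OF assms(1), of s] by (simp add: tc_def base_def)
  moreover have "tc (Phi N s) c = s (0, c)"
    using i beta_Phi[OF assms(1) assms(1), of c s] Phi_nat[OF assms(1), of s]
    by (auto simp: tc_def bco_def base_def)
  ultimately show ?thesis by (simp add: kap_def i)
qed

lemma phi_Phi:
  assumes "0 < N" "i \<in> Idx N - Tor"
  shows "phi (Phi N s) i = s i"
proof -
  obtain j c where i: "i = (j, c)" "j < N" "c \<in> Mom" "c \<in> P \<or> 0 < j"
    using assms(2) PM i0_Mom by (auto simp: Tor_def Idx_def)
  then show ?thesis using beta_Phi[OF assms(1)] assms(1) by (auto simp: phi_def bco_def)
qed

section \<open>The action on the two linked sets\<close>

lemma sum_dA_X: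
  assumes "Z \<in> X N" "c \<in> Mom"
  shows "(\<Sum>j<N. dA Z (int j) $ c) = V $ cj c"
proof -
  have "(\<Sum>j<N. dA Z (int j) $ c) = (\<Sum>j<N. Z (int (Suc j)) $ cj c - Z (int j) $ cj c)"
    using assms(2) by (simp add: dA_def add.commute)
  also have "\<dots> = Z (0 + int N) $ cj c - Z 0 $ cj c"
    by (subst sum_lessThan_telescope) simp
  also have "Z (0 + int N) = Z 0 + V" using assms(1) unfolding X_def by blast
  finally have "(\<Sum>j<N. dA Z (int j) $ c) = (Z 0 + V) $ cj c - Z 0 $ cj c" .
  then show ?thesis by simp
qed

text \<open>The constant c of the linking set is the mean of the momentum plus a component of V / N,
  so its pairing with \<open>V\<close> becomes a mean of momenta paired with \<open>V\<close>. Only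
  momenta in \<open>P\<close> survive, since the conjugates of the others are not moved by
  \<open>V\<close>.\<close>

lemma act_Phi_le:
  assumes N: "0 < N"
  shows "act N (Phi N s) \<le> norm V / real N * (\<Sum>j<N. norm (proj_on P (Phi N s (int j)))) + (norm V)\<^sup>2
     - (\<Sum>j<N. \<Sum>c\<in>Mom. (dco N s j c)\<^sup>2) - hs N * (\<Sum>j<N. H (Phi N s (int j)))"
proof -
  define Z where "Z = Phi N s"
  define V' :: "real ^ 'd" where "V' = (\<chi> c. if c \<in> P then V $ cj c else 0)"
  have nV: "norm V' = norm V"
  proof -
    have "(norm V')\<^sup>2 = (\<Sum>c\<in>P. (V $ cj c)\<^sup>2)"
      using norm_proj_on_square[of P V'] by (simp add: V'_def proj_on_def cong: if_cong)
    also have "\<dots> = (\<Sum>c\<in>cj ` P. (V $ c)\<^sup>2)"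
      by (subst sum.reindex) (auto simp: inj_on_def cj dest: arg_cong[of _ _ cj])
    also have "\<dots> = (\<Sum>c\<in>UNIV. (V $ c)\<^sup>2)"
      by (rule sum.mono_neutral_left) (auto, metis V cj(1) image_eqI)
    also have "\<dots> = (norm V)\<^sup>2" by (simp add: norm_square_vec)
    finally show ?thesis by simp
  qed
  have V'nth: "V' $ c = V $ cj c" if "c \<in> Mom" for c
    using V[of "cj c"] cj that by (auto simp: V'_def)
  have Zc: "Z (int j) $ c = cco N s c - dco N s j c" "dA Z (int j) $ c = dco N s j c"
    if "j < N" "c \<in> Mom" for j c
    using that by (simp_all add: Z_def dA_Phi N Phi_nat base_def)
  have cc: "cco N s c * V $ cj c = (\<Sum>j<N. Z (int j) $ c * V $ cj c) / real N + (V $ cj c)\<^sup>2 / real N"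
    if "c \<in> Mom" for c
  proof -
    have "(\<Sum>j<N. Z (int j) $ c) = real N * cco N s c - V $ cj c"
      using sum_dco[OF N, of s c] that by (simp add: Zc sum_subtractf)
    then have "cco N s c = ((\<Sum>j<N. Z (int j) $ c) + V $ cj c) / real N" using N by simp
    then show ?thesis 
      by (simp add: power2_eq_square add_divide_distrib algebra_simps flip: sum_distrib_left)
  qed
  have 1: "(\<Sum>j<N. \<Sum>c\<in>Mom. Z (int j) $ c * dA Z (int j) $ c) =
      (\<Sum>j<N. \<Sum>c\<in>Mom. cco N s c * dco N s j c) - (\<Sum>j<N. \<Sum>c\<in>Mom. (dco N s j c)\<^sup>2)"
    by (simp add: Zc sum_subtractf[symmetric] algebra_simps power2_eq_square)
  have "(\<Sum>j<N. \<Sum>c\<in>Mom. cco N s c * dco N s j c) = (\<Sum>c\<in>Mom. cco N s c * V $ cj c)"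
    by (subst sum.swap) (simp add: sum_dco N flip: sum_distrib_left)
  also have "\<dots> = (\<Sum>c\<in>Mom. \<Sum>j<N. Z (int j) $ c * V $ cj c) / real N + (\<Sum>c\<in>Mom. (V $ cj c)\<^sup>2) / real N"
    by (simp add: cc sum.distrib sum_divide_distrib)
  finally have 2: "(\<Sum>j<N. \<Sum>c\<in>Mom. cco N s c * dco N s j c) =
    (\<Sum>c\<in>Mom. \<Sum>j<N. Z (int j) $ c * V $ cj c) / real N + (\<Sum>c\<in>Mom. (V $ cj c)\<^sup>2) / real N" .
  have "(\<Sum>c\<in>Mom. \<Sum>j<N. Z (int j) $ c * V $ cj c) \<le> (\<Sum>j<N. norm (proj_on P (Z (int j))) * norm V)"
  proof (subst sum.swap, rule sum_mono)
    fix j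
    have "(\<Sum>c\<in>Mom. Z (int j) $ c * V $ cj c) = (\<Sum>c\<in>Mom. proj_on P (Z (int j)) $ c * V' $ c)"
      by (intro sum.cong refl) (auto simp: V'_def V_cj)
    also have "\<dots> = proj_on P (Z (int j)) \<bullet> V'"
      unfolding inner_vec_def by (rule sum.mono_neutral_cong_left) (use PM in \<open>auto simp: V'_def\<close>)
    also have "\<dots> \<le> norm (proj_on P (Z (int j))) * norm V"
      using norm_cauchy_schwarz[of "proj_on P (Z (int j))" V'] by (simp add: nV)
    finally show "(\<Sum>c\<in>Mom. Z (int j) $ c * V $ cj c) \<le> norm (proj_on P (Z (int j))) * norm V" .
  qed
  then have "(\<Sum>c\<in>Mom. \<Sum>j<N. Z (int j) $ c * V $ cj c) / real N \<le>
      (\<Sum>j<N. norm (proj_on P (Z (int j))) * norm V) / real N"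
    by (rule divide_right_mono) simp
  also have "\<dots> = norm V / real N * (\<Sum>j<N. norm (proj_on P (Z (int j))))"
    by (simp flip: sum_distrib_right)
  finally have 3: "(\<Sum>c\<in>Mom. \<Sum>j<N. Z (int j) $ c * V $ cj c) / real N \<le>
      norm V / real N * (\<Sum>j<N. norm (proj_on P (Z (int j))))" .
  have 4: "(\<Sum>c\<in>Mom. (V $ cj c)\<^sup>2) / real N \<le> (norm V)\<^sup>2"
  proof -
    have "(\<Sum>c\<in>Mom. (V $ cj c)\<^sup>2) = (\<Sum>c\<in>Mom. (V' $ c)\<^sup>2)" by (simp add: V'nth)
    also have "\<dots> \<le> (\<Sum>c\<in>UNIV. (V' $ c)\<^sup>2)" by (rule sum_mono2) auto
    also have "\<dots> = (norm V)\<^sup>2" unfolding nV[symmetric] by (simp add: norm_square_vec)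
    finally have "(\<Sum>c\<in>Mom. (V $ cj c)\<^sup>2) / real N \<le> (norm V)\<^sup>2 / 1"
      using N by (intro frac_le) auto
    then show ?thesis by simp
  qed
  show ?thesis
    using 1 2 3 4 unfolding act_def Z_def[symmetric] by linarith
qed

text \<open>Summed over a period, the lower bound \<open>low0\<close> cancels the linear term of
  \<open>act_Phi_le\<close> exactly. The result is uniform in \<open>N\<close> and \<open>s\<close>
  and serves as the minimax level.\<close>

lemma act_Phi_bound: 
  assumes N: "0 < N"
  shows "act N (Phi N s) \<le> T * C0 + (norm V)\<^sup>2"
proof -
  have "(\<Sum>j<N. norm V / T * norm (proj_on P (Phi N s (int j))) - C0) \<le> (\<Sum>j<N. H (Phi N s (int j)))"
    by (rule sum_mono) (rule low0)
  then have "hs N * (norm V / T * (\<Sum>j<N. norm (proj_on P (Phi N s (int j)))) - real N * C0)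
     \<le> hs N * (\<Sum>j<N. H (Phi N s (int j)))"
    using hs_nonneg by (intro mult_left_mono) (auto simp: sum_subtractf sum_distrib_left)
  moreover have "hs N * (norm V / T * (\<Sum>j<N. norm (proj_on P (Phi N s (int j)))) - real N * C0) =
     norm V / real N * (\<Sum>j<N. norm (proj_on P (Phi N s (int j)))) - T * C0"
    using T0 N by (simp add: hs_def field_simps)
  moreover have "0 \<le> (\<Sum>j<N. \<Sum>c\<in>Mom. (dco N s j c)\<^sup>2)" by (intro sum_nonneg) auto
  ultimately show ?thesis using act_Phi_le[OF N, of s] by linarith
qed

text \<open>The parameter is either a momentum in \<open>P\<close> minus an increment, or twice a
  difference of two increments. If it is large, then so is such a momentum, penalized by the excess
  K T - |V| of the slope, or an increment, penalized by its square.\<close>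

lemma act_Phi_coercive:
  assumes N: "0 < N" and i: "i \<in> Idx N - Tor" and L: "1 \<le> \<bar>s i\<bar>"
  shows "act N (Phi N s) \<le> T * C1 + (norm V)\<^sup>2 - min ((K * T - norm V) / (2 * real N)) (1 / 16) * \<bar>s i\<bar>"
proof -
  define \<kappa> where "\<kappa> = K * T - norm V"
  have \<kappa>: "0 < \<kappa>" using K by (simp add: \<kappa>_def)
  define p where "p = (\<Sum>j<N. norm (proj_on P (Phi N s (int j))))"
  define D where "D = (\<Sum>j<N. \<Sum>c\<in>Mom. (dco N s j c)\<^sup>2)"
  have "(\<Sum>j<N. K * norm (proj_on P (Phi N s (int j))) - C1) \<le> (\<Sum>j<N. H (Phi N s (int j)))"
    by (rule sum_mono) (rule low1)
  then have "hs N * (K * p - real N * C1) \<le> hs N * (\<Sum>j<N. H (Phi N s (int j)))"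
    using hs_nonneg by (intro mult_left_mono) (auto simp: sum_subtractf sum_distrib_left p_def)
  moreover have "hs N * (K * p - real N * C1) = norm V / real N * p + \<kappa> / real N * p - T * C1"
    using T0 N by (simp add: hs_def \<kappa>_def field_simps)
  ultimately have *: "act N (Phi N s) \<le> T * C1 + (norm V)\<^sup>2 - \<kappa> / real N * p - D"
    using act_Phi_le[OF N, of s] by (simp add: p_def D_def)
  have D1: "(dco N s j c)\<^sup>2 \<le> D" if "j < N" "c \<in> Mom" for j c
  proof -
    have "(dco N s j c)\<^sup>2 \<le> (\<Sum>c\<in>Mom. (dco N s j c)\<^sup>2)" by (rule member_le_sum) (use that in auto)
    also have "\<dots> \<le> D" unfolding D_def by (rule member_le_sum) (use that in \<open>auto intro: sum_nonneg\<close>)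
    finally show ?thesis .
  qed
  have p1: "\<bar>Phi N s (int j) $ c\<bar> \<le> p" if "j < N" "c \<in> P" for j c
  proof -
    have "\<bar>Phi N s (int j) $ c\<bar> \<le> norm (proj_on P (Phi N s (int j)))"
      using component_le_norm_cart[of "proj_on P (Phi N s (int j))" c] that by simp
    also have "\<dots> \<le> p" unfolding p_def by (rule member_le_sum) (use that in auto)
    finally show ?thesis .
  qed
  have pos: "0 \<le> p" "0 \<le> D" by (auto simp: p_def D_def intro!: sum_nonneg)
  have sq: "1 / 16 * \<bar>s i\<bar> \<le> x\<^sup>2" if "\<bar>s i\<bar> / 4 \<le> \<bar>x\<bar>" for x
  proof -
    have "(\<bar>s i\<bar> / 4)\<^sup>2 \<le> \<bar>x\<bar>\<^sup>2" using that by (intro power_mono) auto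
    moreover have "\<bar>s i\<bar> * 1 \<le> \<bar>s i\<bar> * \<bar>s i\<bar>" using L by (intro mult_left_mono) auto
    ultimately show ?thesis by (simp add: power2_eq_square)
  qed
  obtain j c where i: "i = (j, c)" "j < N" "c \<in> Mom" "c \<in> P \<or> 0 < j"
    using i PM i0_Mom by (auto simp: Tor_def Idx_def)
  have disj: "\<bar>s i\<bar> / 2 \<le> p \<or> 1 / 16 * \<bar>s i\<bar> \<le> D"
  proof (cases "c \<in> P")
    case True
    have "s i = Phi N s (int j) $ c - dco N s j c"
      using beta_Phi[OF N i(2,3), of s] True dA_Phi[OF N i(2,3), of s] by (simp add: bco_def beta_def i)
    then consider "\<bar>s i\<bar> / 2 \<le> \<bar>Phi N s (int j) $ c\<bar>" | "\<bar>s i\<bar> / 4 \<le> \<bar>dco N s j c\<bar>" by linarith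
    then show ?thesis using p1[OF i(2) True] sq D1[OF i(2,3)] by cases force+
  next
    case False
    then have "s i = 2 * dco N s 0 c - 2 * dco N s j c" using i by (simp add: bco_def dco_def field_simps)
    then consider "\<bar>s i\<bar> / 4 \<le> \<bar>dco N s 0 c\<bar>" | "\<bar>s i\<bar> / 4 \<le> \<bar>dco N s j c\<bar>" by linarith
    then show ?thesis using sq D1[OF i(2,3)] D1[OF N i(3)] by cases force+
  qed
  define m where "m = min (\<kappa> / (2 * real N)) (1 / 16)"
  have "m * \<bar>s i\<bar> \<le> \<kappa> / real N * p + D"
    using disj
  proof
    assume "\<bar>s i\<bar> / 2 \<le> p"
    have "m * \<bar>s i\<bar> \<le> \<kappa> / (2 * real N) * \<bar>s i\<bar>" by (intro mult_right_mono) (auto simp: m_def)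
    also have "\<dots> = \<kappa> / real N * (\<bar>s i\<bar> / 2)" by simp
    also have "\<dots> \<le> \<kappa> / real N * p" using \<kappa> \<open>\<bar>s i\<bar> / 2 \<le> p\<close> by (intro mult_left_mono) auto
    finally show ?thesis using pos by simp
  next
    assume "1 / 16 * \<bar>s i\<bar> \<le> D"
    moreover have "m * \<bar>s i\<bar> \<le> 1 / 16 * \<bar>s i\<bar>" by (intro mult_right_mono) (auto simp: m_def)
    moreover have "0 \<le> \<kappa> / real N * p" using \<kappa> pos by simp
    ultimately show ?thesis by linarith
  qed
  then show ?thesis using * by (simp add: m_def \<kappa>_def)
qed

text \<open>On the dual set the kinetic part is the sum of the squared increments, because the
  constants y are paired with vanishing components of \<open>V\<close>. As z_I is itself an
  increment there, these squares absorb the linear growth \<open>up\<close> of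
  \<open>H\<close>.\<close>

lemma act_low:
  assumes N: "0 < N" and Z: "Z \<in> X N" and ph: "\<forall>i\<in>Idx N - Tor. phi Z i = 0"
  shows "- (T * C1) - real N * (hs N * K)\<^sup>2 / 4 \<le> act N Z"
proof -
  define y where "y c = (if c \<in> P then 0 else beta Z 0 c)" for c
  have Zy: "Z (int j) $ c = dA Z (int j) $ c + y c" if "j < N" "c \<in> Mom" for j c
  proof -
    have "phi Z (j, c) = 0 \<or> (c \<notin> P \<and> j = 0)"
      using ph that i0_Mom by (auto simp: Idx_def Tor_def)
    then show ?thesis by (auto simp: phi_def y_def beta_def split: if_splits)
  qed
  define D where "D j = (\<Sum>c\<in>Mom. (dA Z (int j) $ c)\<^sup>2)" for j
  have "(\<Sum>j<N. \<Sum>c\<in>Mom. Z (int j) $ c * dA Z (int j) $ c) =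
      (\<Sum>j<N. D j) + (\<Sum>j<N. \<Sum>c\<in>Mom. y c * dA Z (int j) $ c)"
    by (simp add: Zy D_def sum.distrib[symmetric] power2_eq_square algebra_simps)
  also have "(\<Sum>j<N. \<Sum>c\<in>Mom. y c * dA Z (int j) $ c) = (\<Sum>c\<in>Mom. y c * V $ cj c)"
    by (subst sum.swap) (simp add: sum_dA_X[OF Z] flip: sum_distrib_left)
  also have "\<dots> = 0"
    by (intro sum.neutral) (auto simp: y_def V_cj)
  finally have 1: "(\<Sum>j<N. \<Sum>c\<in>Mom. Z (int j) $ c * dA Z (int j) $ c) = (\<Sum>j<N. D j)" by simp
  have Hle: "hs N * H (Z (int j)) - D j \<le> (hs N * K)\<^sup>2 / 4 + hs N * C1" if j: "j < N" for j
  proof -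
    define x where "x = norm (proj_on P (Z (int j)))"
    have "x\<^sup>2 = (\<Sum>c\<in>P. (Z (int j) $ c)\<^sup>2)" unfolding x_def by (rule norm_proj_on_square)
    also have "\<dots> = (\<Sum>c\<in>P. (dA Z (int j) $ c)\<^sup>2)"
      using PM by (intro sum.cong) (auto simp: Zy j y_def subset_iff)
    also have "\<dots> \<le> D j" unfolding D_def by (rule sum_mono2) (use PM in auto)
    finally have "x\<^sup>2 \<le> D j" .
    moreover have "hs N * H (Z (int j)) \<le> hs N * (K * x + C1)"
      using up hs_nonneg by (auto simp: x_def intro!: mult_left_mono)
    moreover have "hs N * K * x - x\<^sup>2 \<le> (hs N * K)\<^sup>2 / 4"
      using zero_le_power2[of "hs N * K / 2 - x"] by (simp add: power2_eq_square algebra_simps)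
    ultimately show ?thesis by (simp add: algebra_simps)
  qed
  have "(\<Sum>j<N. hs N * H (Z (int j)) - D j) \<le> (\<Sum>j<N. (hs N * K)\<^sup>2 / 4 + hs N * C1)"
    by (rule sum_mono) (use Hle in auto)
  also have "\<dots> = real N * (hs N * K)\<^sup>2 / 4 + T * C1"
    using N_hs[OF N] by (simp add: distrib_left flip: mult.assoc)
  finally show ?thesis unfolding act_def 1 by (simp add: sum_subtractf sum_distrib_left)
qed

section \<open>Torus coordinates and classes of translates\<close>

lemma abs_tc_diff:
  assumes "0 < N" "Z \<in> X N" "Z' \<in> X N"
  shows "\<bar>tc Z c - tc Z' c\<bar> \<le> 3 / sqrt (hs N) * nr N (\<lambda>j. Z j - Z' j)"
proof -
  define b where "b = nr N (\<lambda>j. Z j - Z' j) / sqrt (hs N)"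
  have b: "\<bar>Z j $ c - Z' j $ c\<bar> \<le> b" for j c
    using norm_le_nr[OF X_diff[OF assms(2,3)] assms(1), of j] component_le_norm_cart[of "Z j - Z' j" c]
    by (simp add: b_def)
  have "\<bar>tc Z c - tc Z' c\<bar> \<le> 3 * b"
  proof (cases "c \<in> Mom")
    case True
    then show ?thesis using b[of 0 c] b[of 1 "cj c"] b[of 0 "cj c"] by (simp add: tc_def beta_def dA_def; linarith)
  next
    case False
    then show ?thesis using b[of 0 c] by (simp add: tc_def)
  qed
  then show ?thesis by (simp add: b_def)
qed

lemma abs_kap_diff:
  assumes "0 < N" "Z \<in> X N" "Z' \<in> X N"
  shows "\<bar>kap Z i - kap Z' i\<bar> \<le> (1 + norm V / \<bar>V $ i0\<bar>) * (3 / sqrt (hs N)) * nr N (\<lambda>j. Z j - Z' j)"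
proof -
  define b where "b = 3 / sqrt (hs N) * nr N (\<lambda>j. Z j - Z' j)"
  have t: "\<bar>tc Z c - tc Z' c\<bar> \<le> b" for c using abs_tc_diff[OF assms] by (simp add: b_def)
  have b0: "0 \<le> b" using t[of undefined] by linarith
  have "kap Z i - kap Z' i = (tc Z (snd i) - tc Z' (snd i)) - V $ snd i / V $ i0 * (tc Z i0 - tc Z' i0)"
    by (simp add: kap_def algebra_simps)
  then have "\<bar>kap Z i - kap Z' i\<bar> \<le> \<bar>tc Z (snd i) - tc Z' (snd i)\<bar> + \<bar>V $ snd i / V $ i0 * (tc Z i0 - tc Z' i0)\<bar>"
    by (metis abs_triangle_ineq4)
  also have "\<dots> \<le> b + norm V / \<bar>V $ i0\<bar> * b"
  proof (intro add_mono t)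
    have "\<bar>V $ snd i\<bar> / \<bar>V $ i0\<bar> \<le> norm V / \<bar>V $ i0\<bar>"
      by (intro divide_right_mono component_le_norm_cart) auto
    then show "\<bar>V $ snd i / V $ i0 * (tc Z i0 - tc Z' i0)\<bar> \<le> norm V / \<bar>V $ i0\<bar> * b"
      unfolding abs_mult abs_divide by (intro mult_mono t) auto
  qed
  finally show ?thesis by (simp add: b_def algebra_simps)
qed

text \<open>Translations by integer multiples of \<open>V\<close> are time shifts and must not
  produce new classes, so lattice vectors are taken modulo \<open>V\<close>.\<close>

definition red :: "real ^ 'd \<Rightarrow> real ^ 'd" where
  "red m = m - (m $ i0 / V $ i0) *\<^sub>R V"

lemma kap_translate:
  assumes "m \<in> Lat P" "snd i \<notin> P"
  shows "kap (\<lambda>j. Z j + m) i = kap Z i + red m $ snd i"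
  using i0 i0_Mom assms by (simp add: kap_def tc_def beta_def dA_def red_def Lat_def field_simps)

definition sample :: "nat \<Rightarrow> (real \<Rightarrow> real ^ 'd) \<Rightarrow> real \<Rightarrow> real ^ 'd \<Rightarrow> int \<Rightarrow> real ^ 'd" where
  "sample N z \<theta> m j = z (\<theta> + hs N * of_int j) + m"

text \<open>A class is a pair of the index of a solution and a reduced lattice vector; it comprises
  all time shifts of the translates with that reduction.\<close>

definition nearby :: "nat \<Rightarrow> (nat \<Rightarrow> real \<Rightarrow> real ^ 'd) \<Rightarrow> nat \<Rightarrow> real \<Rightarrow> (int \<Rightarrow> real ^ 'd) \<Rightarrow> nat \<times> (real ^ 'd) \<Rightarrow> bool" where
  "nearby N zs l \<rho> Z c \<longleftrightarrow> fst c < l \<and> (\<exists>m\<in>Lat P. \<exists>\<theta>. red m = snd c \<and>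
     nr N (\<lambda>j. Z j - sample N (zs (fst c)) \<theta> m j) \<le> \<rho>)"

lemma sample_X:
  assumes "\<And>t. z (t + T) = z t + V" "0 < N"
  shows "sample N z \<theta> m \<in> X N"
proof -
  have "\<theta> + hs N * of_int (j + int N) = (\<theta> + hs N * of_int j) + T" for j
    using N_hs[OF assms(2)] by (simp add: algebra_simps)
  then have "sample N z \<theta> m (j + int N) = sample N z \<theta> m j + V" for j
    unfolding sample_def using assms(1)[of "\<theta> + hs N * of_int j"] by (metis add.assoc add.commute)
  then show ?thesis by (simp add: X_def)
qed

lemma periodic_bounded:
  fixes u :: "real \<Rightarrow> real"
  assumes "continuous_on UNIV u" "\<And>t. u (t + T) = u t"
  shows "\<exists>B\<ge>0. \<forall>t. \<bar>u t\<bar> \<le> B"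
proof -
  have "compact (u ` {0..T})"
    by (rule compact_continuous_image[OF continuous_on_subset[OF assms(1)]]) auto
  then obtain B where B: "\<And>t. t \<in> {0..T} \<Longrightarrow> \<bar>u t\<bar> \<le> B"
    using compact_imp_bounded bounded_iff by (metis (no_types, lifting) image_eqI real_norm_def)
  have per: "u (t + of_int k * T) = u t" for t and k :: int
  proof (induction k rule: int_induct[of _ 0])
    case (step1 i) then show ?case using assms(2)[of "t + of_int i * T"] by (simp add: algebra_simps)
  next
    case (step2 i) then show ?case using assms(2)[of "t + of_int (i - 1) * T"] by (simp add: algebra_simps)
  qed simp
  have "\<bar>u t\<bar> \<le> B" for t
  proof -
    define k where "k = \<lfloor>t / T\<rfloor>"
    have "of_int k \<le> t / T" "t / T < of_int k + 1" by (auto simp: k_def)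
    then have "t - of_int k * T \<in> {0..T}" using T0 by (simp add: field_simps)
    moreover have "u t = u (t - of_int k * T)" using per[of "t - of_int k * T" k] by simp
    ultimately show ?thesis using B by metis
  qed
  moreover have "0 \<le> B" using calculation[of 0] by linarith
  ultimately show ?thesis by blast
qed

text \<open>As a function of \<theta> the coordinate is continuous, and it is periodic because the
  reduction of \<open>V\<close> vanishes.\<close>

lemma kap_sample_bounded:
  assumes z: "\<And>t. z (t + T) = z t + V" "continuous_on UNIV z" and i: "snd i \<notin> P"
  shows "\<exists>B\<ge>0. \<forall>\<theta>. \<bar>kap (sample N z \<theta> 0) i\<bar> \<le> B"
proof (rule periodic_bounded)
  have cz: "continuous_on UNIV (\<lambda>\<theta>. z (\<theta> + x) $ c)" for x c
    by (intro continuous_on_component continuous_on_compose2[OF z(2)] continuous_intros) auto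
  from cz[of 0] have cz0: "continuous_on UNIV (\<lambda>\<theta>. z \<theta> $ c)" for c by simp
  have "continuous_on UNIV (\<lambda>\<theta>. tc (sample N z \<theta> 0) c)" for c
    by (cases "c \<in> Mom") (simp_all add: tc_def beta_def dA_def sample_def cz cz0 continuous_on_diff)
  then show "continuous_on UNIV (\<lambda>\<theta>. kap (sample N z \<theta> 0) i)"
    unfolding kap_def by (intro continuous_on_diff continuous_on_mult continuous_on_const)
  fix \<theta>
  have "sample N z (\<theta> + T) 0 = (\<lambda>j. sample N z \<theta> 0 j + V)"
  proof
    fix j
    have eq: "\<theta> + T + hs N * of_int j = \<theta> + hs N * of_int j + T" by simp
    show "sample N z (\<theta> + T) 0 j = sample N z \<theta> 0 j + V"
      unfolding sample_def eq z(1) by simp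
  qed
  then have "kap (sample N z (\<theta> + T) 0) i = kap (sample N z \<theta> 0) i + red V $ snd i"
    using kap_translate[OF VL i, of "sample N z \<theta> 0"] by simp
  then show "kap (sample N z (\<theta> + T) 0) i = kap (sample N z \<theta> 0) i"
    using i0 by (simp add: red_def)
qed

lemma rho_PerV: "Z \<in> X N \<Longrightarrow> rho N Z \<in> Per N"
  using rho_Per per(2)[OF VL] by blast

text \<open>The index of a class selects one torus coordinate, and the label of the class is that
  coordinate of its reduced vector. The bound on \<open>l\<close> leaves enough torus coordinates
  for the selection to be injective.\<close>

theorem too_few_classes:
  fixes zs :: "nat \<Rightarrow> real \<Rightarrow> real ^ 'd" and A :: "nat \<Rightarrow> real"
  assumes N: "0 < N" and l: "l + 1 \<le> card (- P)"
    and zs: "\<And>j t. j < l \<Longrightarrow> zs j (t + T) = zs j t + V" "\<And>j. j < l \<Longrightarrow> continuous_on UNIV (zs j)"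
    and pos: "0 < \<eta>" "0 < \<eta>'" "0 < \<delta>" "8 * \<epsilon> < \<eta> * \<delta>"
    and \<beta>: "T * C0 + (norm V)\<^sup>2 \<le> \<beta>"
    and slow: "\<And>Z. Z \<in> X N \<Longrightarrow> nr N (rho N Z) \<le> 2 * \<eta>' \<Longrightarrow> act N Z \<le> \<beta> \<Longrightarrow>
      \<exists>c. nearby N zs l \<delta> Z c \<and> \<bar>act N Z - A (fst c)\<bar> \<le> \<epsilon>"
    and slow': "\<And>Z. Z \<in> X N \<Longrightarrow> nr N (rho N Z) < \<eta> \<Longrightarrow> act N Z \<le> \<beta> \<Longrightarrow> \<exists>c. nearby N zs l \<delta> Z c"
    and sep: "\<And>Z c c'. Z \<in> X N \<Longrightarrow> nearby N zs l (2 * \<delta>) Z c \<Longrightarrow> nearby N zs l (2 * \<delta>) Z c' \<Longrightarrow> c = c'"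
  shows False
proof -
  define m where "m = min ((K * T - norm V) / (2 * real N)) (1 / 16)"
  have m: "0 < m" using K N by (simp add: m_def)
  \<comment> \<open>One below the bound of \<open>act_low\<close>, since the dual set must lie at
    level \<open>a + 1\<close> or above.\<close>
  define a where "a = - (T * C1) - real N * (hs N * K)\<^sup>2 / 4 - 1"
  \<comment> \<open>At this size \<open>act_Phi_coercive\<close> pushes the action down to
    \<open>a\<close>.\<close>
  define Lm where "Lm = max 1 ((T * C1 + (norm V)\<^sup>2 - a) / m)"
  obtain \<tau>1 where \<tau>1: "0 < \<tau>1" "\<And>Z e. Z \<in> X N \<Longrightarrow> e \<in> Per N \<Longrightarrow> nr N e \<le> \<tau>1 \<Longrightarrow>
      act N (\<lambda>j. Z j + e j) \<le> act N Z + ip N (rho N Z) e + \<eta>' / 2 * nr N e"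
    using act_expand[OF N, of "\<eta>' / 2"] pos by auto
  define \<tau> where "\<tau> = min \<tau>1 (\<delta> / 2)"
  have \<tau>: "0 < \<tau>" "\<tau> \<le> \<tau>1" "\<tau> \<le> \<delta> / 2" using \<tau>1 pos by (auto simp: \<tau>_def)
  have exp: "act N (\<lambda>j. Z j + e j) \<le> act N Z + ip N (rho N Z) e + \<eta>' / 2 * nr N e"
    if "Z \<in> X N" "e \<in> Per N" "nr N e \<le> \<tau>" for Z e
    using \<tau>1(2)[OF that(1,2)] that(3) \<tau> by simp
  interpret D: descent "X N" "act N" "\<lambda>Z. nr N (rho N Z)" "step_len \<tau> \<eta>' a N" "step \<tau> \<eta>' a N"
    "\<lambda>Z Z'. nr N (\<lambda>j. Z j - Z' j)" "nearby N zs l" "\<lambda>c. A (fst c)" a \<beta> \<tau> \<eta> \<eta>' \<delta> \<epsilon>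
  proof
    show "step \<tau> \<eta>' a N x \<in> X N" if "x \<in> X N" for x
      using step_X[OF that] per(2)[OF VL] by blast
    show "nr N (\<lambda>j. x j - step \<tau> \<eta>' a N x j) \<le> step_len \<tau> \<eta>' a N x" for x
      using nr_step[OF \<tau>(1) pos(2), of N a x] nr_minus[of N x] by simp
    show "0 \<le> step_len \<tau> \<eta>' a N x" "step_len \<tau> \<eta>' a N x \<le> \<tau>" for x
      using step_len_bounds[OF \<tau>(1) pos(2)] by blast+
    show "0 \<le> nr N (rho N x)" for x by (rule nr_nonneg)
    show "act N (step \<tau> \<eta>' a N x) \<le> act N x - nr N (rho N x) * step_len \<tau> \<eta>' a N x / 2" if "x \<in> X N" for x
      by (rule act_step[OF \<tau>(1) pos(2) exp that per(2)[OF VL]])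
    show "step_len \<tau> \<eta>' a N x = \<tau>" if "2 * \<eta>' \<le> nr N (rho N x)" "a + 1 \<le> act N x" for x
      using step_len_bounds(5)[OF \<tau>(1) pos(2)] that by blast
    show "step \<tau> \<eta>' a N x = x" if "act N x \<le> a" for x
      using step_len_bounds(4)[OF \<tau>(1) pos(2) that] by (simp add: step_def[abs_def])
    show "nearby N zs l (\<rho> + \<sigma>) y c"
      if xy: "nearby N zs l \<rho> x c" "nr N (\<lambda>j. x j - y j) \<le> \<sigma>" for \<rho> x c y \<sigma>
    proof -
      obtain m \<theta> where m: "m \<in> Lat P" "red m = snd c" "fst c < l"
          "nr N (\<lambda>j. x j - sample N (zs (fst c)) \<theta> m j) \<le> \<rho>"
        using xy(1) unfolding nearby_def by blast
      have "nr N (\<lambda>j. y j - sample N (zs (fst c)) \<theta> m j) =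
          nr N (\<lambda>j. (x j - sample N (zs (fst c)) \<theta> m j) + (y j - x j))"
        by (simp add: algebra_simps)
      also have "\<dots> \<le> \<rho> + \<sigma>"
        using nr_triangle[of N "\<lambda>j. x j - sample N (zs (fst c)) \<theta> m j" "\<lambda>j. y j - x j"] m(4) xy(2)
          nr_minus[of N x y] by simp
      finally show ?thesis using m unfolding nearby_def by blast
    qed
    show "nearby N zs l \<rho>' x c" if "nearby N zs l \<rho> x c" "\<rho> \<le> \<rho>'" for \<rho> \<rho>' x c
      using that unfolding nearby_def by (meson order_trans)
  qed (use slow slow' sep pos \<tau> in blast)+
  obtain idx where idx: "inj_on idx {..<l}" "idx ` {..<l} \<subseteq> Tor"
  proof -
    have "Tor = Pair 0 ` (- P - {i0})" by (auto simp: Tor_def)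
    then have "card Tor = card (- P - {i0})" by (simp add: card_image inj_on_def)
    also have "\<dots> = card (- P) - 1" using PM i0_Mom by (subst card_Diff_singleton) auto
    finally have "card {..<l} \<le> card Tor" using l by simp
    moreover have "finite Tor"
      by (rule finite_subset[of _ "{0} \<times> UNIV"]) (auto simp: Tor_def)
    ultimately show thesis using that by (meson card_le_inj finite_lessThan)
  qed
  have idxP: "snd (idx j) \<notin> P" if "j < l" for j using idx(2) that by (force simp: Tor_def)
  have "\<exists>B\<ge>0. \<forall>j<l. \<forall>\<theta>. \<bar>kap (sample N (zs j) \<theta> 0) (idx j)\<bar> \<le> B"
  proof -
    have "\<forall>j<l. \<exists>B\<ge>0. \<forall>\<theta>. \<bar>kap (sample N (zs j) \<theta> 0) (idx j)\<bar> \<le> B"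
      using kap_sample_bounded[OF zs idxP] by blast
    then obtain B where B: "\<And>j. j < l \<Longrightarrow> 0 \<le> B j"
      "\<And>j \<theta>. j < l \<Longrightarrow> \<bar>kap (sample N (zs j) \<theta> 0) (idx j)\<bar> \<le> B j" by metis
    have "B j \<le> (\<Sum>j<l. B j)" if "j < l" for j by (rule member_le_sum) (use that B in auto)
    then have "\<bar>kap (sample N (zs j) \<theta> 0) (idx j)\<bar> \<le> (\<Sum>j<l. B j)" if "j < l" for j \<theta>
      using B(2) that by (meson order_trans)
    moreover have "0 \<le> (\<Sum>j<l. B j)" using B(1) by (auto intro: sum_nonneg)
    ultimately show ?thesis by blast
  qed
  then obtain B where B: "0 \<le> B" "\<And>j \<theta>. j < l \<Longrightarrow> \<bar>kap (sample N (zs j) \<theta> 0) (idx j)\<bar> \<le> B" by blast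
  define Ck where "Ck = (1 + norm V / \<bar>V $ i0\<bar>) * (3 / sqrt (hs N))"
  have Ck: "0 \<le> Ck" using hs_nonneg by (simp add: Ck_def)
  \<comment> \<open>A coordinate of a reduced vector is an integer divided by \<open>V $ i0\<close>,
    hence never one half of 1 / V_i0.\<close>
  have lab: "red m $ c \<noteq> 1 / (2 * V $ i0)" if "m \<in> Lat P" for m c
  proof
    assume "red m $ c = 1 / (2 * V $ i0)"
    then have "red m $ c * V $ i0 = 1 / (2 * V $ i0) * V $ i0" by simp
    then have "m $ c * V $ i0 - m $ i0 * V $ c = 1 / 2"
      using i0 by (simp add: red_def left_diff_distrib)
    moreover have "m $ c * V $ i0 - m $ i0 * V $ c \<in> \<int>"
      using that VL by (auto simp: Lat_def)
    ultimately have "(1 / 2 :: real) \<in> \<int>" by (simp only:)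
    then obtain q :: int where "1 / 2 = real_of_int q" by (rule Ints_cases)
    then have "real_of_int (2 * q) = real_of_int 1" by simp
    then have "2 * q = 1" by (simp only: of_int_eq_iff)
    then show False by presburger
  qed
  show False
  proof (rule D.critical_classes[of "Idx N" Tor idx l fst kap "\<lambda>c. snd c $ snd (idx (fst c))" "B + Ck * \<delta>" Ck
        "1 / (2 * V $ i0)" "Phi N" phi Lm])
    show "finite (Idx N)" by (rule finite_subset[of _ "{..<N} \<times> UNIV"]) (auto simp: Idx_def)
    show "Tor \<subseteq> Idx N" using N by (auto simp: Tor_def Idx_def)
    show "inj_on idx {..<l}" "idx ` {..<l} \<subseteq> Tor" by fact+
    show "fst c < l" if "nearby N zs l \<delta> x c" for x c using that by (simp add: nearby_def)
    show "A (fst c) = A (fst c')" if "fst c = fst c'" for c c' :: "nat \<times> (real ^ 'd)" using that by simp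
    show "\<bar>kap x (idx (fst c)) - snd c $ snd (idx (fst c))\<bar> \<le> B + Ck * \<delta>"
      if x: "x \<in> X N" "nearby N zs l \<delta> x c" for x c
    proof -
      obtain m \<theta> where m: "m \<in> Lat P" "red m = snd c" "fst c < l"
          "nr N (\<lambda>j. x j - sample N (zs (fst c)) \<theta> m j) \<le> \<delta>"
        using x(2) unfolding nearby_def by blast
      have "sample N (zs (fst c)) \<theta> m = (\<lambda>j. sample N (zs (fst c)) \<theta> 0 j + m)"
        by (auto simp: sample_def)
      then have "kap (sample N (zs (fst c)) \<theta> m) (idx (fst c)) =
          kap (sample N (zs (fst c)) \<theta> 0) (idx (fst c)) + snd c $ snd (idx (fst c))"
        using kap_translate[OF m(1) idxP[OF m(3)]] m(2) by simp
      moreover have "\<bar>kap x (idx (fst c)) - kap (sample N (zs (fst c)) \<theta> m) (idx (fst c))\<bar> \<le> Ck * \<delta>"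
        using abs_kap_diff[OF N x(1) sample_X[where z = "zs (fst c)", OF zs(1)[OF m(3)] N]] mult_left_mono[OF m(4) Ck]
        unfolding Ck_def by (meson order_trans)
      ultimately show ?thesis using B(2)[OF m(3), of \<theta>] by linarith
    qed
    show "\<bar>kap x i - kap y i\<bar> \<le> Ck * nr N (\<lambda>j. x j - y j)" if "x \<in> X N" "y \<in> X N" for x y i
      unfolding Ck_def by (rule abs_kap_diff[OF N that])
    show "0 \<le> B + Ck * \<delta>" "0 \<le> Ck" using B Ck pos by auto
    show "snd c $ snd (idx (fst c)) \<noteq> 1 / (2 * V $ i0)" if "nearby N zs l \<delta> x c" for x c
      using that lab unfolding nearby_def by metis
    show "Phi N s \<in> X N" for s by (rule Phi_X[OF N])
    show "act N (Phi N s) \<le> \<beta>" for s using act_Phi_bound[OF N, of s] \<beta> by linarith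
    show "kap (Phi N s) i = s i" if "i \<in> Tor" for s i by (rule kap_Phi[OF N that])
    show "phi (Phi N s) i = s i" if "i \<in> Idx N - Tor" for s i by (rule phi_Phi[OF N that])
    show "0 < Lm" by (simp add: Lm_def)
    show "act N (Phi N s) \<le> a" if "i \<in> Idx N - Tor" "\<bar>s i\<bar> = Lm" for s i
    proof -
      have "act N (Phi N s) \<le> T * C1 + (norm V)\<^sup>2 - m * Lm"
        using act_Phi_coercive[OF N that(1), of s] that(2) by (simp add: m_def Lm_def)
      moreover have "(T * C1 + (norm V)\<^sup>2 - a) / m \<le> Lm" by (simp add: Lm_def)
      then have "T * C1 + (norm V)\<^sup>2 - a \<le> m * Lm" using m by (simp add: divide_le_eq mult.commute)
      ultimately show ?thesis by linarith
    qed
    show "a + 1 \<le> act N x" if "x \<in> X N" "\<forall>i\<in>Idx N - Tor. phi x i = 0" for x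
      using act_low[OF N that] by (simp add: a_def)
    have cPhi: "continuous_on UNIV (Phi N)"
    proof (rule continuous_on_coordinatewise_then_product)
      fix j
      have b: "continuous_on UNIV (\<lambda>s. bco s i c)" for i c
        by (cases "c \<in> P"; cases "i = 0"; simp add: bco_def; intro continuous_on_add continuous_on_apply)
      have c: "continuous_on UNIV (\<lambda>s. cco N s c)" for c
        unfolding cco_def by (intro continuous_on_divide continuous_on_add continuous_on_sum b continuous_on_const)
          (use N in auto)
      have d: "continuous_on UNIV (\<lambda>s. dco N s i c)" for i c
        unfolding dco_def by (intro continuous_on_divide continuous_on_diff b c continuous_on_const) auto
      have "continuous_on UNIV (\<lambda>s. if c \<in> Mom then cco N s c - dco N s r c
        else (if c = i0 then 0 else s (0, c)) + (\<Sum>i<r. dco N s i (cj c)))" for r c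
        by (cases "c \<in> Mom"; cases "c = i0"; simp;
            intro continuous_on_diff continuous_on_add c d continuous_on_sum continuous_on_apply)
      then have "continuous_on UNIV (\<lambda>s. base N s r)" for r
        unfolding base_def by (rule continuous_on_vec_lambda)
      then show "continuous_on UNIV (\<lambda>s. Phi N s j)"
        unfolding Phi_def by (rule continuous_on_add[OF _ continuous_on_const])
    qed
    note cit = continuous_on_step_iter[OF cPhi pos(2), where \<tau> = \<tau> and a = a and N = N]
    show "continuous_on UNIV (\<lambda>s. nr N (rho N ((step \<tau> \<eta>' a N ^^ i) (Phi N s))))" for i
      by (rule continuous_on_nr[OF continuous_on_rho[OF cit]])
    have cb: "continuous_on UNIV (\<lambda>s. beta ((step \<tau> \<eta>' a N ^^ i) (Phi N s)) j c)" for i j c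
      unfolding beta_def
      by (rule continuous_on_diff[OF continuous_on_component[OF continuous_on_coord[OF cit]]
            continuous_on_component[OF continuous_on_dA[OF cit]]])
    show "continuous_on UNIV (\<lambda>s. phi ((step \<tau> \<eta>' a N ^^ i) (Phi N s)) j)" for i j
      unfolding phi_def by (cases "snd j \<in> P"; simp add: cb continuous_on_diff)
    show "((\<lambda>s'. nr N (\<lambda>j. (step \<tau> \<eta>' a N ^^ i) (Phi N s) j - (step \<tau> \<eta>' a N ^^ i) (Phi N s') j)) \<longlongrightarrow> 0) (at s)" for i s
    proof -
      have "continuous_on UNIV (\<lambda>s'. nr N (\<lambda>j. (step \<tau> \<eta>' a N ^^ i) (Phi N s) j - (step \<tau> \<eta>' a N ^^ i) (Phi N s') j))"
        by (rule continuous_on_nr[OF continuous_on_diff[OF continuous_on_const continuous_on_coord[OF cit]]])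
      then have "((\<lambda>s'. nr N (\<lambda>j. (step \<tau> \<eta>' a N ^^ i) (Phi N s) j - (step \<tau> \<eta>' a N ^^ i) (Phi N s') j)) \<longlongrightarrow>
        nr N (\<lambda>j. (step \<tau> \<eta>' a N ^^ i) (Phi N s) j - (step \<tau> \<eta>' a N ^^ i) (Phi N s) j)) (at s)"
        unfolding continuous_on_def by blast
      then show ?thesis by (simp add: nr_def L2_set_def)
    qed
  qed
qed

end

lemma norm_proj_on_le: "norm (proj_on P z) \<le> norm z"
proof -
  have "(norm (proj_on P z))\<^sup>2 \<le> (norm z)\<^sup>2"
    unfolding norm_proj_on_square unfolding norm_square_vec by (rule sum_mono2) auto
  then show ?thesis by (simp add: power2_le_iff_abs_le)
qed

lemma sum_lessThan_split:
  fixes f :: "nat \<Rightarrow> 'b::comm_monoid_add"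
  shows "(\<Sum>i<a + b. f i) = (\<Sum>i<a. f i) + (\<Sum>i<b. f (a + i))"
  by (induction b) (auto simp: add.assoc)

section \<open>Compactness of almost critical sequences\<close>

text \<open>Far out the truncated gradient is K times the direction of z_I; this shows that bounded
  displacements hardly change it there.\<close>

lemma norm_sgn_diff_le:
  fixes p q :: "'a::real_inner"
  assumes "p \<noteq> 0" "q \<noteq> 0"
  shows "norm (sgn p - sgn q) \<le> 2 / norm q * norm (p - q)"
proof -
  have pos: "0 < norm p" "0 < norm q" using assms by auto
  have "sgn p - sgn q = (1 / norm p - 1 / norm q) *\<^sub>R p + (1 / norm q) *\<^sub>R (p - q)"
    by (simp add: sgn_div_norm scaleR_left_diff_distrib scaleR_right_diff_distrib inverse_eq_divide)
  also have "norm \<dots> \<le> \<bar>1 / norm p - 1 / norm q\<bar> * norm p + norm (p - q) / norm q"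
    by (rule order_trans[OF norm_triangle_ineq]) simp
  also have "\<bar>1 / norm p - 1 / norm q\<bar> * norm p = \<bar>norm q - norm p\<bar> / norm q"
  proof -
    have "1 / norm p - 1 / norm q = (norm q - norm p) / (norm p * norm q)" using pos by (simp add: field_simps)
    then show ?thesis using pos by (simp add: abs_mult abs_divide)
  qed
  also have "\<bar>norm q - norm p\<bar> / norm q \<le> norm (p - q) / norm q"
    using norm_triangle_ineq3[of q p] pos by (intro divide_right_mono) (auto simp: norm_minus_commute)
  finally show ?thesis by (simp add: field_simps)
qed

locale dsys_cpt = dsys_lin P Mom cj V T H G CG i0 K C0 C1
  for P Mom :: "'d::finite set" and cj V T H G CG i0 K C0 C1 +
  fixes R1 :: real
  assumes R1: "0 < R1"
    and G_far: "R1 \<le> norm (proj_on P z) \<Longrightarrow> G z = (K / norm (proj_on P z)) *\<^sub>R proj_on P z"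
begin

section \<open>Increments of sampled loops\<close>

definition Jm :: "real ^ 'd \<Rightarrow> real ^ 'd" where
  "Jm v = (\<chi> c. if c \<in> Mom then - v $ cj c else v $ cj c)"

text \<open>By Cauchy-Schwarz this bounds the discrete L1 norm of the gradient over one period, the
  quantity that controls increments.\<close>

definition res :: "nat \<Rightarrow> (int \<Rightarrow> real ^ 'd) \<Rightarrow> real" where
  "res N Z = sqrt T * nr N (rho N Z)"

lemma Jm_nth: "Jm v $ c = (if c \<in> Mom then - v $ cj c else v $ cj c)"
  by (simp add: Jm_def)

lemma norm_Jm: "norm (Jm v) = norm v"
proof -
  have "(norm (Jm v))\<^sup>2 = (\<Sum>c\<in>UNIV. (v $ cj c)\<^sup>2)"
    unfolding norm_square_vec by (intro sum.cong) (auto simp: Jm_nth)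
  also have "\<dots> = (\<Sum>c\<in>UNIV. (v $ c)\<^sup>2)"
    by (rule sum.reindex_bij_witness[of _ cj cj]) (auto simp: cj)
  finally show ?thesis by (simp add: norm_square_vec[symmetric])
qed

lemma res_nonneg: "0 \<le> res N Z"
  using T0 by (simp add: res_def nr_nonneg)

lemma sum_period_shift:
  fixes u :: "int \<Rightarrow> real"
  assumes "\<And>j. u (j + int N) = u j"
  shows "(\<Sum>i<N. u (j + int i)) = (\<Sum>i<N. u (int i))"
proof -
  have step: "(\<Sum>i<N. u (j + 1 + int i)) = (\<Sum>i<N. u (j + int i))" for j
  proof -
    have "(\<Sum>i<N. u (j + 1 + int i)) - (\<Sum>i<N. u (j + int i)) = (\<Sum>i<N. u (j + int (Suc i)) - u (j + int i))"
      by (simp add: sum_subtractf algebra_simps)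
    also have "\<dots> = u (j + int N) - u (j + int 0)" by (rule sum_lessThan_telescope)
    finally show ?thesis using assms by simp
  qed
  show ?thesis
  proof (induction j rule: int_induct[of _ 0])
    case (step2 i) then show ?case using step[of "i - 1"] by simp
  qed (use step in auto)
qed

lemma window_sum:
  assumes N: "0 < N" and Z: "Z \<in> X N" and n: "n \<le> q * N"
  shows "hs N * (\<Sum>i<n. norm (rho N Z (j + int i))) \<le> real q * res N Z"
proof -
  define u where "u j = norm (rho N Z j)" for j
  have u: "u (j + int N) = u j" for j using rho_PerV[OF Z] by (simp add: Per_def u_def)
  have one: "hs N * (\<Sum>i<N. u (j + int i)) \<le> res N Z" for j
  proof -
    have "(\<Sum>i<N. \<bar>u (int i)\<bar> * \<bar>1\<bar>) \<le> L2_set (\<lambda>i. u (int i)) {..<N} * L2_set (\<lambda>i. 1) {..<N}"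
      by (rule L2_set_mult_ineq)
    also have "L2_set (\<lambda>i. 1) {..<N} = sqrt (real N)" by (simp add: L2_set_constant)
    finally have "hs N * (\<Sum>i<N. u (int i)) \<le> hs N * (L2_set (\<lambda>i. u (int i)) {..<N} * sqrt (real N))"
      using hs_nonneg by (intro mult_left_mono) (auto simp: u_def)
    also have "\<dots> = (sqrt (hs N) * sqrt (real N)) * (sqrt (hs N) * L2_set (\<lambda>i. u (int i)) {..<N})"
      using real_sqrt_mult_self[of "hs N"] hs_nonneg[of N] by (simp add: algebra_simps)
    also have "sqrt (hs N) * sqrt (real N) = sqrt T"
      using N_hs[OF N] by (simp add: mult.commute flip: real_sqrt_mult)
    finally show ?thesis using sum_period_shift[of u N j, OF u] by (simp add: res_def nr_def u_def)
  qed
  have "hs N * (\<Sum>i<q * N. u (j + int i)) \<le> real q * res N Z"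
  proof (induction q)
    case (Suc q)
    have "(\<Sum>i<Suc q * N. u (j + int i)) = (\<Sum>i<q * N. u (j + int i)) + (\<Sum>i<N. u (j + int (q * N) + int i))"
      using sum_lessThan_split[of "\<lambda>i. u (j + int i)" "q * N" N] by (simp add: algebra_simps)
    then show ?case using Suc one[of "j + int (q * N)"] by (simp add: algebra_simps)
  qed simp
  moreover have "(\<Sum>i<n. u (j + int i)) \<le> (\<Sum>i<q * N. u (j + int i))"
    by (rule sum_mono2) (use n in \<open>auto simp: u_def\<close>)
  ultimately show ?thesis
    using mult_left_mono[OF _ hs_nonneg[of N]] unfolding u_def by (meson order_trans)
qed

lemma increment_coord:
  assumes N: "0 < N" and Z: "Z \<in> X N" and n: "n \<le> q * N"
    and g: "\<And>i. i \<le> n \<Longrightarrow> norm (G (Z (j + int i)) - g) \<le> \<epsilon>"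
  shows "\<bar>Z (j + int n) $ c - Z j $ c - real n * hs N * Jm g $ c\<bar> \<le> real q * res N Z + real n * hs N * \<epsilon>"
proof -
  define s where "s = (if c \<in> Mom then -1 else 1 :: real)"
  \<comment> \<open>A momentum obeys a backward difference, so its step from i to i + 1 reads the
    equation at i + 1; this is why the assumption on \<open>g\<close> includes i = n.\<close>
  define o1 where "o1 = (if c \<in> Mom then 1 else 0 :: nat)"
  have dA: "dA Z k = hs N *\<^sub>R (rho N Z k + G (Z k))" for k
    using hs_pos[OF N] by (simp add: rho_def)
  have st: "Z (j + int (Suc i)) $ c - Z (j + int i) $ c =
      s * hs N * ((rho N Z (j + int o1 + int i) + G (Z (j + int (o1 + i)))) $ cj c)" for i
  proof (cases "c \<in> Mom")
    case True
    then have "Z (j + int i) $ c - Z (j + int (Suc i)) $ c = dA Z (j + int (Suc i)) $ cj c"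
      using cj by (simp add: dA_def)
    then show ?thesis using True unfolding dA by (simp add: s_def o1_def algebra_simps)
  next
    case False
    then have "Z (j + int (Suc i)) $ c - Z (j + int i) $ c = dA Z (j + int i) $ cj c"
      using cj by (simp add: dA_def algebra_simps)
    then show ?thesis using False unfolding dA by (simp add: s_def o1_def)
  qed
  have Jg: "Jm g $ c = s * g $ cj c" by (simp add: Jm_nth s_def)
  have "Z (j + int n) $ c - Z j $ c = (\<Sum>i<n. Z (j + int (Suc i)) $ c - Z (j + int i) $ c)"
    by (subst sum_lessThan_telescope) simp
  then have "Z (j + int n) $ c - Z j $ c - real n * hs N * Jm g $ c =
      (\<Sum>i<n. s * hs N * (rho N Z (j + int o1 + int i) $ cj c) + s * hs N * ((G (Z (j + int (o1 + i))) - g) $ cj c))"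
    unfolding st Jg by (simp add: sum.distrib sum_subtractf algebra_simps sum_distrib_left)
  also have "\<bar>\<dots>\<bar> \<le> (\<Sum>i<n. hs N * norm (rho N Z (j + int o1 + int i)) + hs N * \<epsilon>)"
  proof (rule order_trans[OF sum_abs sum_mono])
    fix i assume "i \<in> {..<n}"
    then have "norm (G (Z (j + int (o1 + i))) - g) \<le> \<epsilon>" by (intro g) (auto simp: o1_def)
    then have "\<bar>(G (Z (j + int (o1 + i))) - g) $ cj c\<bar> \<le> \<epsilon>"
      by (rule order_trans[OF component_le_norm_cart])
    moreover have "\<bar>rho N Z (j + int o1 + int i) $ cj c\<bar> \<le> norm (rho N Z (j + int o1 + int i))"
      by (rule component_le_norm_cart)
    moreover have "\<bar>s\<bar> = 1" by (simp add: s_def)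
    ultimately have "\<bar>s * hs N * (rho N Z (j + int o1 + int i) $ cj c)\<bar> \<le> hs N * norm (rho N Z (j + int o1 + int i))"
      "\<bar>s * hs N * ((G (Z (j + int (o1 + i))) - g) $ cj c)\<bar> \<le> hs N * \<epsilon>"
      using hs_nonneg[of N] by (simp_all add: abs_mult mult_left_mono)
    then show "\<bar>s * hs N * (rho N Z (j + int o1 + int i) $ cj c) + s * hs N * ((G (Z (j + int (o1 + i))) - g) $ cj c)\<bar>
      \<le> hs N * norm (rho N Z (j + int o1 + int i)) + hs N * \<epsilon>" by linarith
  qed
  also have "\<dots> = hs N * (\<Sum>i<n. norm (rho N Z (j + int o1 + int i))) + real n * hs N * \<epsilon>"
    by (simp add: sum.distrib sum_distrib_left)
  finally show ?thesis using window_sum[OF N Z n, of "j + int o1"] by linarith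
qed

lemma increment:
  assumes "0 < N" "Z \<in> X N" "n \<le> q * N" "\<And>i. i \<le> n \<Longrightarrow> norm (G (Z (j + int i)) - g) \<le> \<epsilon>"
  shows "norm (Z (j + int n) - Z j - (real n * hs N) *\<^sub>R Jm g) \<le>
    real CARD('d) * (real q * res N Z + real n * hs N * \<epsilon>)"
proof -
  have "norm (Z (j + int n) - Z j - (real n * hs N) *\<^sub>R Jm g) \<le>
      (\<Sum>c\<in>UNIV. \<bar>(Z (j + int n) - Z j - (real n * hs N) *\<^sub>R Jm g) $ c\<bar>)" by (rule norm_le_l1_cart)
  also have "\<dots> \<le> (\<Sum>c\<in>(UNIV::'d set). real q * res N Z + real n * hs N * \<epsilon>)"
    by (rule sum_mono) (use increment_coord[OF assms] in simp)
  finally show ?thesis by simp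
qed

lemma increment_le:
  assumes "0 < N" "Z \<in> X N" "n \<le> q * N"
  shows "norm (Z (j + int n) - Z j) \<le> real CARD('d) * (real q * res N Z + real n * hs N * CG)"
proof -
  have "Jm 0 = 0" by (simp add: vec_eq_iff Jm_nth)
  then show ?thesis using increment[OF assms, of j 0 CG] CG by simp
qed

lemma G_far_diff:
  assumes "R1 \<le> norm (proj_on P x)" "R1 \<le> norm (proj_on P y)"
  shows "norm (G x - G y) \<le> 2 * K / norm (proj_on P y) * norm (x - y)"
proof -
  define p q where "p = proj_on P x" and "q = proj_on P y"
  have pos: "0 < norm p" "0 < norm q" using assms R1 by (auto simp: p_def q_def)
  have "p - q = proj_on P (x - y)" by (simp add: p_def q_def vec_eq_iff)
  moreover have "norm (proj_on P (x - y)) \<le> norm (x - y)" by (rule norm_proj_on_le)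
  ultimately have pq: "norm (p - q) \<le> norm (x - y)" by simp
  have "G x - G y = K *\<^sub>R (sgn p - sgn q)"
    using G_far assms by (simp add: p_def q_def scaleR_diff_right sgn_div_norm divide_inverse)
  then have "norm (G x - G y) = K * norm (sgn p - sgn q)" using K_pos by simp
  also have "\<dots> \<le> K * (2 / norm q * norm (p - q))"
    using pos K_pos by (intro mult_left_mono norm_sgn_diff_le) auto
  also have "\<dots> \<le> K * (2 / norm q * norm (x - y))"
    using pq pos K_pos by (intro mult_left_mono) auto
  finally show ?thesis by (simp add: q_def mult_ac)
qed

text \<open>Over one period a loop with small residual moves by a bounded amount, so far out
  \<open>G\<close> is almost a constant vector of norm K. The displacement over the period would
  then have norm close to K T, but it is \<open>V\<close>, and |V| < K T.\<close>

lemma momentum_bound: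
  obtains \<eta> B where "0 < \<eta>" "\<And>N Z. 0 < N \<Longrightarrow> Z \<in> X N \<Longrightarrow> res N Z \<le> \<eta> \<Longrightarrow> norm (proj_on P (Z 0)) \<le> B"
proof -
  define D where "D = real CARD('d)"
  have D: "1 \<le> D" by (simp add: D_def Suc_leI)
  define \<kappa> where "\<kappa> = K * T - norm V"
  have \<kappa>: "0 < \<kappa>" using K by (simp add: \<kappa>_def)
  define S where "S = D * (1 + T * CG)"
  have CG0: "0 \<le> CG" using CG[of 0] norm_ge_zero order_trans by blast
  have S: "0 \<le> S" using D T0 CG0 by (simp add: S_def)
  \<comment> \<open>With \<eta> and \<epsilon> so chosen, the residual and the variation of
    \<open>G\<close> each account for at most a quarter of the gap K T - |V|.\<close>
  define \<eta> where "\<eta> = min 1 (\<kappa> / (4 * D))"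
  define \<epsilon> where "\<epsilon> = \<kappa> / (4 * D * T)"
  have \<epsilon>: "0 < \<epsilon>" using \<kappa> D T0 by (simp add: \<epsilon>_def)
  define B where "B = R1 + S + 2 * K * S / \<epsilon>"
  show thesis
  proof (rule that[of \<eta> B])
    show "0 < \<eta>" using \<kappa> D by (simp add: \<eta>_def)
    fix N Z assume N: "0 < N" and Z: "Z \<in> X N" and r: "res N Z \<le> \<eta>"
    show "norm (proj_on P (Z 0)) \<le> B"
    proof (rule ccontr)
      assume "\<not> norm (proj_on P (Z 0)) \<le> B"
      then have big: "R1 + S + 2 * K * S / \<epsilon> < norm (proj_on P (Z 0))" by (simp add: B_def)
      have pos: "0 \<le> 2 * K * S / \<epsilon>" using K_pos S \<epsilon> by simp
      have osc: "norm (Z (0 + int i) - Z 0) \<le> S" if "i \<le> N" for i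
      proof -
        have "real i * hs N \<le> real N * hs N" using that hs_nonneg by (intro mult_right_mono) auto
        then have "real i * hs N * CG \<le> T * CG" using N_hs[OF N] CG0 by (intro mult_right_mono) auto
        moreover have "res N Z \<le> 1" using r by (simp add: \<eta>_def)
        ultimately have "D * (real 1 * res N Z + real i * hs N * CG) \<le> S"
          unfolding S_def using D by (intro mult_left_mono) auto
        then show ?thesis using increment_le[OF N Z, of i 1 0] that by (simp add: D_def)
      qed
      have near: "norm (G (Z (0 + int i)) - G (Z 0)) \<le> \<epsilon>" if "i \<le> N" for i
      proof -
        have "norm (proj_on P (Z 0)) \<le> norm (proj_on P (Z (0 + int i))) + norm (proj_on P (Z 0 - Z (0 + int i)))"
          by (metis add_diff_cancel_left' diff_add_cancel norm_triangle_ineq proj_on_add)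
        moreover have "norm (proj_on P (Z 0 - Z (0 + int i))) \<le> norm (Z 0 - Z (0 + int i))"
          by (rule norm_proj_on_le)
        ultimately have "R1 \<le> norm (proj_on P (Z (0 + int i)))"
          using osc[OF that] big pos by (smt (verit) norm_minus_commute)
        moreover have R0: "R1 \<le> norm (proj_on P (Z 0))" using big pos S by linarith
        ultimately have "norm (G (Z (0 + int i)) - G (Z 0)) \<le>
            2 * K / norm (proj_on P (Z 0)) * norm (Z (0 + int i) - Z 0)" by (rule G_far_diff)
        also have "\<dots> \<le> 2 * K / norm (proj_on P (Z 0)) * S"
          using osc[OF that] K_pos by (intro mult_left_mono) auto
        also have "\<dots> \<le> \<epsilon>"
        proof -
          have "2 * K * S / \<epsilon> \<le> norm (proj_on P (Z 0))" using big R1 S by linarith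
          then have "2 * K * S \<le> \<epsilon> * norm (proj_on P (Z 0))" using \<epsilon> by (simp add: divide_le_eq mult.commute)
          moreover have "0 < norm (proj_on P (Z 0))" using R0 R1 by linarith
          ultimately show ?thesis by (simp only: times_divide_eq_left pos_divide_le_eq)
        qed
        finally show ?thesis .
      qed
      have "Z (0 + int N) = Z 0 + V" using Z unfolding X_def by blast
      then have ZN: "Z (0 + int N) - Z 0 = V" by simp
      have "norm (V - T *\<^sub>R Jm (G (Z 0))) \<le> D * (res N Z + T * \<epsilon>)"
        using increment[OF N Z, of N 1 0 "G (Z 0)" \<epsilon>] near N_hs[OF N] ZN by (simp add: D_def)
      also have "\<dots> \<le> D * (\<kappa> / (4 * D) + T * \<epsilon>)" using r D by (intro mult_left_mono) (auto simp: \<eta>_def)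
      also have "\<dots> = \<kappa> / 2" using D T0 by (simp add: \<epsilon>_def field_simps)
      finally have "norm (T *\<^sub>R Jm (G (Z 0))) \<le> norm V + \<kappa> / 2"
        using norm_triangle_ineq2[of "T *\<^sub>R Jm (G (Z 0))" V]
          norm_minus_commute[of V "T *\<^sub>R Jm (G (Z 0))"] by linarith
      moreover have "norm (G (Z 0)) = K"
      proof -
        have "R1 \<le> norm (proj_on P (Z 0))" "0 < norm (proj_on P (Z 0))" using big pos S R1 by linarith+
        then show ?thesis using G_far[of "Z 0"] K_pos by simp
      qed
      ultimately have "K * T \<le> norm V + \<kappa> / 2" using T0 by (simp add: norm_Jm mult.commute)
      then show False using \<kappa> unfolding \<kappa>_def by argo
    qed
  qed
qed

end

section \<open>Limits of almost critical sequences\<close>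

lemma Lat_uminus: "m \<in> Lat P \<Longrightarrow> - m \<in> Lat P"
  by (simp add: Lat_def)

lemma Lat_add: "m \<in> Lat P \<Longrightarrow> m' \<in> Lat P \<Longrightarrow> m + m' \<in> Lat P"
  by (simp add: Lat_def)

lemma Lat_scale_int: "m \<in> Lat P \<Longrightarrow> of_int q *\<^sub>R m \<in> Lat P"
  by (simp add: Lat_def)

text \<open>Loops will be interpolated by step functions on the grid; \<open>n\<close> counts the
  grid steps between two times, up to one mesh width.\<close>

lemma floor_window:
  fixes h s t :: real
  assumes "0 < h" "s \<le> t"
  defines "n \<equiv> nat (\<lfloor>t / h\<rfloor> - \<lfloor>s / h\<rfloor>)"
  shows "\<lfloor>t / h\<rfloor> = \<lfloor>s / h\<rfloor> + int n" "real n * h \<le> t - s + h" "t - s - h \<le> real n * h"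
proof -
  have le: "\<lfloor>s / h\<rfloor> \<le> \<lfloor>t / h\<rfloor>" using assms by (intro floor_mono divide_right_mono) auto
  then show eq: "\<lfloor>t / h\<rfloor> = \<lfloor>s / h\<rfloor> + int n" by (simp add: n_def)
  have rn: "real n = of_int \<lfloor>t / h\<rfloor> - of_int \<lfloor>s / h\<rfloor>" using le by (simp add: n_def)
  have "of_int \<lfloor>t / h\<rfloor> \<le> t / h" "s / h < of_int \<lfloor>s / h\<rfloor> + 1" "of_int \<lfloor>s / h\<rfloor> \<le> s / h"
    "t / h < of_int \<lfloor>t / h\<rfloor> + 1" by linarith+
  then have "real n \<le> t / h - s / h + 1" "t / h - s / h - 1 \<le> real n" using rn by linarith+
  then have "real n * h \<le> (t / h - s / h + 1) * h" "(t / h - s / h - 1) * h \<le> real n * h"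
    using assms(1) by (intro mult_right_mono; simp)+
  then show "real n * h \<le> t - s + h" "t - s - h \<le> real n * h"
    using assms(1) by (simp_all add: algebra_simps)
qed

context dsys_cpt
begin

lemma rho_translate: "m \<in> Lat P \<Longrightarrow> rho N (\<lambda>j. Z j + m) = rho N Z"
  by (simp add: rho_def fun_eq_iff per dA_def)

lemma CG_nonneg: "0 \<le> CG"
  using CG[of 0] norm_ge_zero order_trans by blast

text \<open>The estimate ranges over all pairs of times near \<open>r\<close>, the form in which
  increments of the approximations pass to the limit.\<close>

lemma has_vector_derivativeI_increment:
  fixes z :: "real \<Rightarrow> real ^ 'd"
  assumes "\<And>\<epsilon>. 0 < \<epsilon> \<Longrightarrow> \<exists>\<delta>>0. \<forall>s s'. r - \<delta> < s \<longrightarrow> s \<le> s' \<longrightarrow> s' < r + \<delta> \<longrightarrow>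
      norm (z s' - z s - (s' - s) *\<^sub>R g) \<le> \<epsilon> * (s' - s)"
  shows "(z has_vector_derivative g) (at r)"
  unfolding has_vector_derivative_def has_derivative_at_alt
proof (intro conjI allI impI)
  show "bounded_linear (\<lambda>x. x *\<^sub>R g)" by (rule bounded_linear_scaleR_left)
  fix \<epsilon> :: real assume "0 < \<epsilon>"
  then obtain \<delta> where \<delta>: "0 < \<delta>" "\<And>s s'. r - \<delta> < s \<Longrightarrow> s \<le> s' \<Longrightarrow> s' < r + \<delta> \<Longrightarrow>
      norm (z s' - z s - (s' - s) *\<^sub>R g) \<le> \<epsilon> * (s' - s)" using assms by blast
  have "norm (z y - z r - (y - r) *\<^sub>R g) \<le> \<epsilon> * norm (y - r)" if "norm (y - r) < \<delta>" for y
  proof (cases "r \<le> y")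
    case True
    then show ?thesis using \<delta>(2)[of r y] \<delta>(1) that by auto
  next
    case False
    then have "norm (z r - z y - (r - y) *\<^sub>R g) \<le> \<epsilon> * (r - y)" using \<delta>(2)[of y r] \<delta>(1) that by auto
    moreover have "z y - z r - (y - r) *\<^sub>R g = - (z r - z y - (r - y) *\<^sub>R g)"
      by (simp add: algebra_simps)
    ultimately show ?thesis using False by (simp only: norm_minus_cancel real_norm_def) simp
  qed
  then show "\<exists>d>0. \<forall>y. norm (y - r) < d \<longrightarrow> norm (z y - z r - (y - r) *\<^sub>R g) \<le> \<epsilon> * norm (y - r)"
    using \<delta>(1) by blast
qed

text \<open>An Arzela-Ascoli argument for step functions, which are Lipschitz only up to the
  residual and the mesh width. Lattice translations bound the periodic coordinates of the starting
  points and \<open>momentum_bound\<close> the others; the limit inherits Hamilton's equations from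
  \<open>increment\<close>.\<close>

theorem compactness:
  assumes Ns: "\<And>i. 0 < Ns i" "filterlim Ns at_top sequentially" and ZX: "\<And>i. Z i \<in> X (Ns i)"
    and r0: "(\<lambda>i. res (Ns i) (Z i)) \<longlonglongrightarrow> 0"
  obtains k :: "nat \<Rightarrow> nat" and z m where "strict_mono k" "\<And>t. z (t + T) = z t + V"
    "\<And>t. (z has_vector_derivative Jm (G (z t))) (at t)" "\<And>n. m n \<in> Lat P"
    "\<And>\<epsilon>. 0 < \<epsilon> \<Longrightarrow> \<forall>\<^sub>F n in sequentially. \<forall>j. norm (Z (k n) j + m n - z (hs (Ns (k n)) * of_int j)) \<le> \<epsilon>"
proof -
  define D where "D = real CARD('d)"
  have D: "1 \<le> D" by (simp add: D_def Suc_leI)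
  obtain \<eta> B where \<eta>: "0 < \<eta>" and B: "\<And>N Z. 0 < N \<Longrightarrow> Z \<in> X N \<Longrightarrow> res N Z \<le> \<eta> \<Longrightarrow> norm (proj_on P (Z 0)) \<le> B"
    using momentum_bound by blast
  have "\<forall>\<^sub>F i in sequentially. res (Ns i) (Z i) < min \<eta> 1"
    by (rule order_tendstoD(2)[OF r0]) (use \<eta> in simp)
  then obtain a where a: "\<And>i. a \<le> i \<Longrightarrow> res (Ns i) (Z i) < min \<eta> 1"
    unfolding eventually_sequentially by blast
  \<comment> \<open>The first \<open>a\<close> members, whose residual may be too large for
    \<open>momentum_bound\<close>, are dropped.\<close>
  define M where "M i = Ns (i + a)" for i
  define \<mu> :: "nat \<Rightarrow> real ^ 'd" where "\<mu> i = (\<chi> c. if c \<in> P then 0 else - of_int \<lfloor>Z (i + a) 0 $ c\<rfloor>)" for i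
  define W where "W i j = Z (i + a) j + \<mu> i" for i j
  define h where "h i = hs (M i)" for i
  define e where "e i = res (M i) (W i)" for i
  define Y where "Y i t = W i \<lfloor>t / h i\<rfloor>" for i t
  have \<mu>: "\<mu> i \<in> Lat P" for i by (simp add: \<mu>_def Lat_def)
  have M: "0 < M i" for i using Ns by (simp add: M_def)
  have h: "0 < h i" "h i \<le> T" "real (M i) * h i = T" for i
  proof -
    show h1: "0 < h i" "real (M i) * h i = T" using hs_pos N_hs M by (auto simp: h_def)
    have "1 * h i \<le> real (M i) * h i" using M[of i] h1 by (intro mult_right_mono) auto
    then show "h i \<le> T" using h1 by simp
  qed
  have WX: "W i \<in> X (M i)" for i using ZX[of "i + a"] by (simp add: W_def X_def M_def)
  have e_eq: "e i = res (Ns (i + a)) (Z (i + a))" for i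
    using rho_translate[OF \<mu>, of _ "Z (i + a)" i] by (simp add: e_def res_def M_def W_def[abs_def])
  have e: "0 \<le> e i" "e i \<le> 1" "e i \<le> \<eta>" for i
    using a[of "i + a"] res_nonneg by (auto simp: e_eq)
  have e0: "e \<longlonglongrightarrow> 0" unfolding e_eq[abs_def] using LIMSEQ_ignore_initial_segment[OF r0, of a] by simp
  have h0: "h \<longlonglongrightarrow> 0"
  proof -
    have "(\<lambda>i. T / real (Ns i)) \<longlonglongrightarrow> 0"
      by (rule real_tendsto_divide_at_top[OF tendsto_const filterlim_compose[OF filterlim_real_sequentially Ns(2)]])
    from LIMSEQ_ignore_initial_segment[OF this, of a] show ?thesis by (simp add: h_def[abs_def] hs_def M_def)
  qed
  have W0: "norm (W i 0) \<le> B + D" for i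
  proof -
    have "norm (W i 0) \<le> norm (proj_on P (W i 0)) + norm (proj_on (- P) (W i 0))"
      by (rule order_trans[OF eq_refl norm_triangle_ineq]) (simp add: vec_eq_iff arg_cong[of _ _ norm])
    moreover have "norm (proj_on P (W i 0)) \<le> B" using B[OF M WX] e(3) by (simp add: e_def)
    moreover have "norm (proj_on (- P) (W i 0)) \<le> D"
    proof -
      have "norm (proj_on (- P) (W i 0)) \<le> (\<Sum>c\<in>UNIV. \<bar>proj_on (- P) (W i 0) $ c\<bar>)" by (rule norm_le_l1_cart)
      also have "\<dots> \<le> (\<Sum>c\<in>(UNIV::'d set). 1)"
      proof (rule sum_mono)
        fix c
        have "\<bar>x + - of_int \<lfloor>x\<rfloor>\<bar> \<le> 1" for x :: real by linarith
        then show "\<bar>proj_on (- P) (W i 0) $ c\<bar> \<le> 1" by (simp add: W_def \<mu>_def)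
      qed
      finally show ?thesis by (simp add: D_def)
    qed
    ultimately show ?thesis by linarith
  qed
  \<comment> \<open>The grid window between two times can be one mesh width longer than their
    distance, hence the extra \<open>h i\<close>.\<close>
  have Ylip0: "norm (Y i t - Y i s) \<le> D * (real q * e i + (t - s + h i) * CG)"
    if "s \<le> t" "t - s + h i \<le> real q * T" for i s t q
  proof -
    define n where "n = nat (\<lfloor>t / h i\<rfloor> - \<lfloor>s / h i\<rfloor>)"
    note fw = floor_window[OF h(1) that(1), of i, folded n_def]
    have "real (q * M i) * h i = real q * T" using h(3)[of i] by (simp add: mult.assoc)
    then have "real n * h i \<le> real (q * M i) * h i" using fw(2) that(2) by linarith
    then have nq: "n \<le> q * M i" using h(1)[of i] by (simp only: mult_le_cancel_right_pos of_nat_le_iff)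
    have "norm (Y i t - Y i s) \<le> D * (real q * e i + real n * h i * CG)"
      unfolding Y_def fw(1) using increment_le[OF M WX nq, of "\<lfloor>s / h i\<rfloor>"]
      by (simp add: D_def e_def h_def)
    also have "\<dots> \<le> D * (real q * e i + (t - s + h i) * CG)"
      using fw(2) D CG_nonneg by (intro mult_left_mono add_left_mono mult_right_mono) auto
    finally show ?thesis .
  qed
  have Ylip: "norm (Y i t - Y i s) \<le> D * (real q * e i + (\<bar>t - s\<bar> + h i) * CG)"
    if "\<bar>t - s\<bar> + h i \<le> real q * T" for i s t q
    using Ylip0[of s t i q] Ylip0[of t s i q] that by (cases "s \<le> t") (auto simp: norm_minus_commute)
  have Y0: "Y i 0 = W i 0" for i by (simp add: Y_def)
  define M0 where "M0 = B + D + D * (2 + 2 * T * CG)"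
  have YM: "norm (Y i t) \<le> M0" if "t \<in> {0..T}" for i t
  proof -
    have "\<bar>t - 0\<bar> + h i \<le> real 2 * T" using that h(2)[of i] by auto
    then have "norm (Y i t - Y i 0) \<le> D * (real 2 * e i + (\<bar>t - 0\<bar> + h i) * CG)" by (rule Ylip)
    also have "\<dots> \<le> D * (2 + 2 * T * CG)"
      using D e(2)[of i] mult_right_mono[OF \<open>\<bar>t - 0\<bar> + h i \<le> real 2 * T\<close> CG_nonneg]
      by (intro mult_left_mono add_mono) auto
    finally show ?thesis
      using norm_triangle_sub[of "Y i t" "Y i 0"] W0[of i] by (simp add: M0_def Y0)
  qed
  have "countable (\<rat> \<inter> {0..T} :: real set)" using countable_rat by blast
  then obtain k where k: "strict_mono k" "\<And>x. x \<in> \<rat> \<inter> {0..T} \<Longrightarrow> \<exists>l. (\<lambda>n. Y (k n) x) \<longlonglongrightarrow> l"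
    using function_convergent_subsequence[of "\<rat> \<inter> {0..T}" Y M0] YM by auto
  then obtain Lm where Lm: "\<And>x. x \<in> \<rat> \<inter> {0..T} \<Longrightarrow> (\<lambda>n. Y (k n) x) \<longlonglongrightarrow> Lm x" by metis
  have ek: "(\<lambda>n. e (k n)) \<longlonglongrightarrow> 0" and hk: "(\<lambda>n. h (k n)) \<longlonglongrightarrow> 0"
    using LIMSEQ_subseq_LIMSEQ[OF e0 k(1)] LIMSEQ_subseq_LIMSEQ[OF h0 k(1)] by (auto simp: o_def)
  have "uniformly_Cauchy_on {0..T} (\<lambda>n. Y (k n))"
    unfolding uniformly_Cauchy_on_def
  proof (intro allI impI)
    fix \<epsilon> :: real assume \<epsilon>: "0 < \<epsilon>"
    \<comment> \<open>The grid of mesh 1 / m makes the Lipschitz part at most \<epsilon> / 8, and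
      its mesh is at most a period.\<close>
    obtain m :: nat where m: "8 * (D * CG + 1) / \<epsilon> + 1 / T < real m" using reals_Archimedean2 by blast
    have p1: "0 \<le> 8 * (D * CG + 1) / \<epsilon>" "0 < 1 / T" using D CG_nonneg \<epsilon> T0 by simp_all
    then have m0: "0 < real m" using m by linarith
    have "8 * (D * CG + 1) / \<epsilon> < real m" "1 / T < real m" using m p1 by linarith+
    then have m1: "8 * (D * CG + 1) < \<epsilon> * real m" "1 < T * real m" using \<epsilon> T0 by (simp_all add: divide_less_eq mult.commute)
    have m2: "1 / real m \<le> T" using m1(2) m0 by (simp add: divide_le_eq mult.commute)
    have m3: "D * CG * (1 / real m) \<le> \<epsilon> / 8" using m1(1) m0 D CG_nonneg by (simp add: field_simps)
    define Gr where "Gr = (\<lambda>l. real l / real m) ` {..nat \<lfloor>T * real m\<rfloor>}"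
    have Gr: "Gr \<subseteq> \<rat> \<inter> {0..T}"
    proof
      fix x assume "x \<in> Gr"
      then obtain l where l: "x = real l / real m" "l \<le> nat \<lfloor>T * real m\<rfloor>" by (auto simp: Gr_def)
      have "real l \<le> real (nat \<lfloor>T * real m\<rfloor>)" using l(2) by simp
      also have "\<dots> \<le> T * real m" using T0 by (intro of_nat_floor) simp
      finally have "real l \<le> T * real m" .
      then show "x \<in> \<rat> \<inter> {0..T}" using l m0 by (simp add: divide_le_eq Rats_divide)
    qed
    have "\<forall>\<^sub>F n in sequentially. \<forall>s\<in>Gr. dist (Y (k n) s) (Lm s) < \<epsilon> / 8"
    proof (rule eventually_ball_finite)
      show "finite Gr" by (simp add: Gr_def)
      show "\<forall>s\<in>Gr. \<forall>\<^sub>F n in sequentially. dist (Y (k n) s) (Lm s) < \<epsilon> / 8"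
        using tendstoD[OF Lm] Gr \<epsilon> by (meson divide_pos_pos subsetD zero_less_numeral)
    qed
    moreover have "\<forall>\<^sub>F n in sequentially. 2 * D * e (k n) + D * CG * h (k n) < \<epsilon> / 8"
    proof -
      have "(\<lambda>n. 2 * D * e (k n) + D * CG * h (k n)) \<longlonglongrightarrow> 2 * D * 0 + D * CG * 0"
        by (intro tendsto_intros ek hk)
      from order_tendstoD(2)[OF this, of "\<epsilon> / 8"] show ?thesis using \<epsilon> by simp
    qed
    ultimately have "\<forall>\<^sub>F n in sequentially. \<forall>s\<in>Gr. dist (Y (k n) s) (Lm s) < \<epsilon> / 8 \<and>
        2 * D * e (k n) + D * CG * h (k n) < \<epsilon> / 8"
      by eventually_elim auto
    then obtain n0 where n0: "\<And>n s. n0 \<le> n \<Longrightarrow> s \<in> Gr \<Longrightarrow> dist (Y (k n) s) (Lm s) < \<epsilon> / 8 \<and>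
        2 * D * e (k n) + D * CG * h (k n) < \<epsilon> / 8"
      unfolding eventually_sequentially by blast
    have "\<exists>s. \<forall>n\<ge>n0. dist (Y (k n) t) s < \<epsilon> / 2" if t: "t \<in> {0..T}" for t
    proof -
      define l where "l = nat \<lfloor>t * real m\<rfloor>"
      define s where "s = real l / real m"
      have rl: "real l = of_int \<lfloor>t * real m\<rfloor>" using t by (simp add: l_def)
      have "\<lfloor>t * real m\<rfloor> \<le> \<lfloor>T * real m\<rfloor>" using t by (intro floor_mono mult_right_mono) auto
      then have "l \<le> nat \<lfloor>T * real m\<rfloor>" by (simp add: l_def nat_mono)
      then have s: "s \<in> Gr" by (auto simp: Gr_def s_def)
      have "real l \<le> t * real m" "t * real m < real l + 1" unfolding rl by linarith+
      then have "s \<le> t" "t \<le> (real l + 1) / real m"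
        unfolding s_def using m0 by (simp_all add: pos_divide_le_eq pos_le_divide_eq)
      then have ts: "\<bar>t - s\<bar> \<le> 1 / real m" by (simp add: s_def add_divide_distrib)
      have "dist (Y (k n) t) (Lm s) < \<epsilon> / 2" if n: "n0 \<le> n" for n
      proof -
        have "\<bar>t - s\<bar> + h (k n) \<le> real 2 * T" using ts m2 h(2)[of "k n"] by simp
        then have "norm (Y (k n) t - Y (k n) s) \<le> D * (real 2 * e (k n) + (\<bar>t - s\<bar> + h (k n)) * CG)"
          by (rule Ylip)
        also have "\<dots> = (2 * D * e (k n) + D * CG * h (k n)) + D * CG * \<bar>t - s\<bar>"
          by (simp add: algebra_simps)
        also have "\<dots> \<le> \<epsilon> / 8 + D * CG * (1 / real m)"
          using n0[OF n s] ts D CG_nonneg by (intro add_mono mult_left_mono) auto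
        finally have "norm (Y (k n) t - Y (k n) s) \<le> \<epsilon> / 4" using m3 by linarith
        then show ?thesis using n0[OF n s] dist_triangle[of "Y (k n) t" "Lm s" "Y (k n) s"] \<epsilon>
          by (simp add: dist_norm)
      qed
      then show ?thesis by blast
    qed
    then show "\<exists>M. \<forall>x\<in>{0..T}. \<forall>m\<ge>M. \<forall>n\<ge>M. dist (Y (k m) x) (Y (k n) x) < \<epsilon>"
      by (intro exI[of _ n0]) (meson dist_triangle_half_l dist_commute)
  qed
  then obtain zl where zl: "uniform_limit {0..T} (\<lambda>n. Y (k n)) zl sequentially"
    using Cauchy_uniformly_convergent unfolding uniformly_convergent_on_def by blast
  \<comment> \<open>The limit on one period is extended by translations with multiples of
    \<open>V\<close>, in accordance with \<open>Yshift\<close>.\<close>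
  define z where "z t = zl (t - of_int \<lfloor>t / T\<rfloor> * T) + of_int \<lfloor>t / T\<rfloor> *\<^sub>R V" for t
  have Yshift: "Y i (t + of_int q * T) = Y i t + of_int q *\<^sub>R V" for i t q
  proof -
    have "(t + of_int q * T) / h i = t / h i + of_int (q * int (M i))"
      using h(1,3)[of i] by (simp add: field_simps)
    then have "\<lfloor>(t + of_int q * T) / h i\<rfloor> = \<lfloor>t / h i\<rfloor> + q * int (M i)"
      by (simp only: floor_add_int[symmetric] add.commute)
    then show ?thesis using X_div[OF WX, of i "\<lfloor>t / h i\<rfloor>" q] by (simp add: Y_def)
  qed
  have unif: "\<forall>\<^sub>F n in sequentially. \<forall>t. norm (Y (k n) t - z t) < \<epsilon>" if "0 < \<epsilon>" for \<epsilon>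
    using uniform_limitD[OF zl that]
  proof eventually_elim
    case (elim n)
    show ?case
    proof
      fix t
      define q where "q = \<lfloor>t / T\<rfloor>"
      have "of_int q \<le> t / T" "t / T < of_int q + 1" by (auto simp: q_def)
      then have "t - of_int q * T \<in> {0..T}" using T0 by (simp add: field_simps)
      then show "norm (Y (k n) t - z t) < \<epsilon>"
        using elim Yshift[of "k n" "t - of_int q * T" q] by (auto simp: z_def q_def[symmetric] dist_norm)
    qed
  qed
  have pw: "(\<lambda>n. Y (k n) t) \<longlonglongrightarrow> z t" for t
  proof (rule tendstoI)
    fix \<epsilon> :: real assume "0 < \<epsilon>"
    from unif[OF this] show "\<forall>\<^sub>F n in sequentially. dist (Y (k n) t) (z t) < \<epsilon>"
      by eventually_elim (simp add: dist_norm)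
  qed
  have zper: "z (t + T) = z t + V" for t
  proof (rule LIMSEQ_unique[OF pw])
    show "(\<lambda>n. Y (k n) (t + T)) \<longlonglongrightarrow> z t + V"
      using tendsto_add[OF pw[of t] tendsto_const[of V]] Yshift[of _ t 1] by simp
  qed
  have zlip: "norm (z t - z s) \<le> D * CG * \<bar>t - s\<bar>" for s t
  proof -
    obtain q :: nat where q: "\<bar>t - s\<bar> / T + 1 < real q" using reals_Archimedean2 by blast
    then have "(\<bar>t - s\<bar> / T + 1) * T \<le> real q * T" using T0 by (intro mult_right_mono) auto
    then have qT: "\<bar>t - s\<bar> + T \<le> real q * T" using T0 by (simp add: distrib_right)
    have "norm (z t - z s) \<le> D * (real q * 0 + (\<bar>t - s\<bar> + 0) * CG)"
    proof (rule LIMSEQ_le)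
      show "(\<lambda>n. norm (Y (k n) t - Y (k n) s)) \<longlonglongrightarrow> norm (z t - z s)" by (intro tendsto_intros pw)
      show "(\<lambda>n. D * (real q * e (k n) + (\<bar>t - s\<bar> + h (k n)) * CG)) \<longlonglongrightarrow> D * (real q * 0 + (\<bar>t - s\<bar> + 0) * CG)"
        by (intro tendsto_intros ek hk)
      show "\<exists>N. \<forall>n\<ge>N. norm (Y (k n) t - Y (k n) s) \<le> D * (real q * e (k n) + (\<bar>t - s\<bar> + h (k n)) * CG)"
        using Ylip qT h(2) by (meson add_left_mono order_trans)
    qed
    then show ?thesis by (simp add: algebra_simps)
  qed
  have der: "(z has_vector_derivative Jm (G (z r))) (at r)" for r
  proof (rule has_vector_derivativeI_increment)
    fix \<epsilon>' :: real assume "0 < \<epsilon>'"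
    define \<epsilon> where "\<epsilon> = \<epsilon>' / D"
    have \<epsilon>: "0 < \<epsilon>" using \<open>0 < \<epsilon>'\<close> D by (simp add: \<epsilon>_def)
    obtain \<delta>G where \<delta>G: "0 < \<delta>G" "\<And>x. dist x (z r) < \<delta>G \<Longrightarrow> dist (G x) (G (z r)) < \<epsilon>"
      using G[unfolded uniformly_continuous_on_def, rule_format, OF \<epsilon>] by auto
    \<comment> \<open>Within time \<delta> the limit moves by at most \<delta>G / 4; the mesh width
      and the distance to the limit take up to another quarter each.\<close>
    define \<delta> where "\<delta> = min (T / 2) (\<delta>G / (4 * (D * CG + 1)))"
    have DC: "0 \<le> D * CG" using D CG_nonneg by simp
    have \<delta>: "0 < \<delta>" "2 * \<delta> \<le> T" using T0 \<delta>G(1) DC by (auto simp: \<delta>_def)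
    have d3: "D * CG * \<delta> \<le> \<delta>G / 4"
    proof -
      have "D * CG * \<delta> \<le> (D * CG + 1) * (\<delta>G / (4 * (D * CG + 1)))"
        using DC \<delta>(1) by (intro mult_mono) (auto simp: \<delta>_def)
      also have "\<dots> = \<delta>G / 4" using DC by (simp add: field_simps)
      finally show ?thesis .
    qed
    have "norm (z s' - z s - (s' - s) *\<^sub>R Jm (G (z r))) \<le> \<epsilon>' * (s' - s)"
      if s: "r - \<delta> < s" "s \<le> s'" "s' < r + \<delta>" for s s'
    proof -
      define n where "n i = nat (\<lfloor>s' / h i\<rfloor> - \<lfloor>s / h i\<rfloor>)" for i
      note fw = floor_window[OF h(1) s(2), folded n_def]
      have nh: "(\<lambda>i. real (n (k i)) * h (k i)) \<longlonglongrightarrow> s' - s"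
      proof (rule tendsto_sandwich)
        show "\<forall>\<^sub>F i in sequentially. s' - s - h (k i) \<le> real (n (k i)) * h (k i)" using fw(3) by simp
        show "\<forall>\<^sub>F i in sequentially. real (n (k i)) * h (k i) \<le> s' - s + h (k i)" using fw(2) by simp
        show "(\<lambda>i. s' - s - h (k i)) \<longlonglongrightarrow> s' - s" using tendsto_diff[OF tendsto_const hk, of "s' - s"] by simp
        show "(\<lambda>i. s' - s + h (k i)) \<longlonglongrightarrow> s' - s" using tendsto_add[OF tendsto_const hk, of "s' - s"] by simp
      qed
      have "\<forall>\<^sub>F i in sequentially. D * CG * h (k i) < \<delta>G / 4"
      proof -
        have "(\<lambda>i. D * CG * h (k i)) \<longlonglongrightarrow> D * CG * 0" by (intro tendsto_intros hk)
        from order_tendstoD(2)[OF this, of "\<delta>G / 4"] show ?thesis using \<delta>G by simp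
      qed
      moreover have "\<forall>\<^sub>F i in sequentially. \<forall>t. norm (Y (k i) t - z t) < \<delta>G / 4"
        by (rule unif) (use \<delta>G in simp)
      ultimately have ev: "\<forall>\<^sub>F i in sequentially. norm (Y (k i) s' - Y (k i) s - (real (n (k i)) * h (k i)) *\<^sub>R Jm (G (z r)))
          \<le> D * (real 2 * e (k i) + real (n (k i)) * h (k i) * \<epsilon>)"
      proof eventually_elim
        case (elim i)
        define j where "j = \<lfloor>s / h (k i)\<rfloor>"
        have "real (n (k i)) * h (k i) \<le> real (2 * M (k i)) * h (k i)"
        proof -
          have "real (2 * M (k i)) * h (k i) = 2 * T" using h(3)[of "k i"] by (simp add: mult.assoc)
          then show ?thesis using fw(2)[of "k i"] s \<delta>(2) h(2)[of "k i"] by linarith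
        qed
        then have nq: "n (k i) \<le> 2 * M (k i)" using h(1)[of "k i"] by (simp only: mult_le_cancel_right_pos of_nat_le_iff)
        have "norm (G (W (k i) (j + int l)) - G (z r)) \<le> \<epsilon>" if l: "l \<le> n (k i)" for l
        proof -
          define t where "t = h (k i) * of_int (j + int l)"
          have Yt: "Y (k i) t = W (k i) (j + int l)" using h(1)[of "k i"] by (simp add: Y_def t_def)
          have "s / h (k i) < of_int j + 1" unfolding j_def by linarith
          then have "s < (of_int j + 1) * h (k i)" using h(1)[of "k i"] by (simp add: divide_less_eq)
          moreover have "0 \<le> h (k i) * real l" using h(1)[of "k i"] by simp
          ultimately have t1: "s - h (k i) < t" by (simp add: t_def algebra_simps)
          have "of_int (j + int l) \<le> (of_int \<lfloor>s' / h (k i)\<rfloor> :: real)" using fw(1)[of "k i"] l by (simp add: j_def)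
          also have "\<dots> \<le> s' / h (k i)" by simp
          finally have t2: "t \<le> s'" using h(1)[of "k i"] by (simp add: t_def le_divide_eq mult.commute)
          have tr: "\<bar>t - r\<bar> \<le> \<delta> + h (k i)" using t1 t2 s h(1)[of "k i"] \<delta> by auto
          have "norm (z t - z r) \<le> D * CG * (\<delta> + h (k i))"
            by (rule order_trans[OF zlip mult_left_mono[OF tr DC]])
          then have "norm (z t - z r) \<le> D * CG * \<delta> + D * CG * h (k i)" by (simp add: algebra_simps)
          moreover have "norm (Y (k i) t - z t) < \<delta>G / 4" using elim(2) by blast
          ultimately have "norm (Y (k i) t - z r) < \<delta>G"
            using d3 elim(1) \<delta>G(1) norm_triangle_ineq[of "Y (k i) t - z t" "z t - z r"] by simp
          then show ?thesis using \<delta>G(2)[of "Y (k i) t"] Yt by (simp add: dist_norm)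
        qed
        from increment[OF M WX nq this] show ?case
          unfolding Y_def fw(1)[of "k i"] j_def[symmetric] by (simp add: D_def e_def h_def)
      qed
      have "norm (z s' - z s - (s' - s) *\<^sub>R Jm (G (z r))) \<le> D * (real 2 * 0 + (s' - s) * \<epsilon>)"
      proof (rule tendsto_le[OF sequentially_bot _ _ ev])
        show "(\<lambda>i. D * (real 2 * e (k i) + real (n (k i)) * h (k i) * \<epsilon>)) \<longlonglongrightarrow> D * (real 2 * 0 + (s' - s) * \<epsilon>)"
          by (intro tendsto_intros ek nh)
        show "(\<lambda>i. norm (Y (k i) s' - Y (k i) s - (real (n (k i)) * h (k i)) *\<^sub>R Jm (G (z r))))
            \<longlonglongrightarrow> norm (z s' - z s - (s' - s) *\<^sub>R Jm (G (z r)))"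
          by (intro tendsto_intros pw nh)
      qed
      then show ?thesis using D by (simp add: \<epsilon>_def mult.commute)
    qed
    then show "\<exists>\<delta>>0. \<forall>s s'. r - \<delta> < s \<longrightarrow> s \<le> s' \<longrightarrow> s' < r + \<delta> \<longrightarrow>
        norm (z s' - z s - (s' - s) *\<^sub>R Jm (G (z r))) \<le> \<epsilon>' * (s' - s)" using \<delta>(1) by blast
  qed
  show thesis
  proof (rule that[of "\<lambda>n. k n + a" z "\<lambda>n. \<mu> (k n)"])
    show "strict_mono (\<lambda>n. k n + a)" using k(1) by (simp add: strict_mono_def)
    fix \<epsilon> :: real assume "0 < \<epsilon>"
    from unif[OF this] show "\<forall>\<^sub>F n in sequentially. \<forall>j. norm (Z (k n + a) j + \<mu> (k n) - z (hs (Ns (k n + a)) * of_int j)) \<le> \<epsilon>"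
    proof eventually_elim
      case (elim n)
      show ?case
      proof
        fix j
        have "Y (k n) (h (k n) * of_int j) = W (k n) j" using h(1)[of "k n"] by (simp add: Y_def)
        then show "norm (Z (k n + a) j + \<mu> (k n) - z (hs (Ns (k n + a)) * of_int j)) \<le> \<epsilon>"
          using elim[rule_format, of "h (k n) * of_int j"] by (simp add: W_def h_def M_def)
      qed
    qed
  qed (use zper der \<mu> in auto)
qed

section \<open>Solutions of the limit equation and their action\<close>

definition sol :: "(real \<Rightarrow> real ^ 'd) \<Rightarrow> bool" where
  "sol z \<longleftrightarrow> (\<forall>t. z (t + T) = z t + V) \<and> (\<forall>t. (z has_vector_derivative Jm (G (z t))) (at t))"

text \<open>Along a solution the momentum rows of \<open>G\<close> are the velocities of the
  conjugate positions, so this is the integrand p q' - H of the action.\<close>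

definition lag :: "real ^ 'd \<Rightarrow> real" where
  "lag x = (\<Sum>c\<in>Mom. x $ c * G x $ c) - H x"

definition Act :: "(real \<Rightarrow> real ^ 'd) \<Rightarrow> real" where
  "Act z = integral {0..T} (\<lambda>t. lag (z t))"

lemma continuous_on_lag: "continuous_on UNIV lag"
proof -
  have G: "continuous_on UNIV (\<lambda>x. G x)" by (rule continuous_on_G[OF continuous_on_id])
  have H: "continuous_on UNIV (\<lambda>x. H x)" by (rule continuous_on_H[OF continuous_on_id])
  show ?thesis unfolding lag_def
    by (intro continuous_on_diff continuous_on_sum continuous_on_mult H continuous_on_component G continuous_on_id)
qed

lemma sol_continuous: "sol z \<Longrightarrow> continuous_on UNIV z"
  unfolding sol_def by (meson continuous_at_imp_continuous_on has_vector_derivative_continuous)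

lemma sol_lipschitz:
  assumes "sol z"
  shows "norm (z t - z s) \<le> CG * \<bar>t - s\<bar>"
proof -
  have "norm (z t - z s) \<le> CG * norm (t - s)"
  proof (rule differentiable_bound[of UNIV z "\<lambda>t h. h *\<^sub>R Jm (G (z t))"])
    show "(z has_derivative (\<lambda>h. h *\<^sub>R Jm (G (z x)))) (at x within UNIV)" for x
      using assms unfolding sol_def has_vector_derivative_def by simp
    show "onorm (\<lambda>h. h *\<^sub>R Jm (G (z x))) \<le> CG" for x
      by (rule onorm_le) (simp add: norm_Jm, metis CG abs_ge_zero mult.commute mult_right_mono)
  qed auto
  then show ?thesis by simp
qed

lemma lag_add_V: "lag (x + V) = lag x"
  using V_Mom by (simp add: lag_def per[OF VL])

text \<open>The integrand is periodic although the solution is not, so every period gives the same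
  integral. Keeping an antiderivative allows mean value arguments on subintervals.\<close>

lemma action_antiderivative:
  assumes "sol z"
  obtains F where "\<And>t. (F has_real_derivative lag (z t)) (at t)" "\<And>\<theta>. F (\<theta> + T) - F \<theta> = Act z"
proof -
  have c: "continuous_on UNIV (\<lambda>t. lag (z t))"
    using continuous_on_compose2[OF continuous_on_lag sol_continuous[OF assms]] by auto
  have "\<exists>F. \<forall>x. -\<infinity> < ereal x \<longrightarrow> ereal x < \<infinity> \<longrightarrow> (F has_vector_derivative lag (z x)) (at x)"
    by (rule einterval_antiderivative) (use c in \<open>auto simp: continuous_on_eq_continuous_at\<close>)
  then obtain F where F: "\<And>x. (F has_vector_derivative lag (z x)) (at x)" by auto
  then have F': "(F has_real_derivative lag (z t)) (at t)" for t
    by (simp add: has_real_derivative_iff_has_vector_derivative)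
  have "((\<lambda>\<theta>. F (\<theta> + T) - F \<theta>) has_real_derivative 0) (at \<theta>)" for \<theta>
  proof -
    have "((\<lambda>\<theta>. F (\<theta> + T)) has_real_derivative lag (z (\<theta> + T)) * 1) (at \<theta>)"
      by (rule DERIV_chain2[OF F']) (auto intro!: derivative_eq_intros)
    from DERIV_diff[OF this F'[of \<theta>]] show ?thesis
      using assms by (simp add: sol_def lag_add_V)
  qed
  then have "F (\<theta> + T) - F \<theta> = F (0 + T) - F 0" for \<theta>
    using DERIV_isconst_all[of "\<lambda>\<theta>. F (\<theta> + T) - F \<theta>"] by blast
  moreover have "Act z = F T - F 0"
    unfolding Act_def
    using T0 by (intro integral_unique fundamental_theorem_of_calculus has_vector_derivative_at_within[OF F]) auto
  ultimately have "F (\<theta> + T) - F \<theta> = Act z" for \<theta> by (simp only: add_0_left)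
  then show thesis using that F' by blast
qed

text \<open>The second term is paired with the gradient and disappears along almost critical bounded
  sequences, leaving a Riemann sum of the continuous action.\<close>

lemma act_eq:
  assumes "0 < N"
  shows "act N Z = hs N * (\<Sum>j<N. lag (Z (int j))) + hs N * (\<Sum>j<N. \<Sum>c\<in>Mom. Z (int j) $ c * rho N Z (int j) $ c)"
proof -
  have "dA Z j = hs N *\<^sub>R (rho N Z j + G (Z j))" for j
    using hs_pos[OF assms] by (simp add: rho_def)
  then show ?thesis
    by (simp add: act_def lag_def sum_subtractf sum.distrib sum_distrib_left algebra_simps)
qed

text \<open>The increments paired with m add up to components of \<open>V\<close>: m vanishes on
  \<open>P\<close>, and the conjugates of all other coordinates are not moved by \<open>V\<close>.
  Here the position of the nonzero entries of v makes the action periodic.\<close>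

lemma act_translate:
  assumes "m \<in> Lat P" "Z \<in> X N" 
  shows "act N (\<lambda>j. Z j + m) = act N Z"
proof -
  have "(\<Sum>j<N. \<Sum>c\<in>Mom. m $ c * dA Z (int j) $ c) = (\<Sum>c\<in>Mom. m $ c * V $ cj c)"
    by (subst sum.swap) (simp add: sum_dA_X[OF assms(2)] flip: sum_distrib_left)
  also have "\<dots> = 0"
  proof (rule sum.neutral, rule ballI)
    fix c assume "c \<in> Mom"
    show "m $ c * V $ cj c = 0" using V_cj[of c] assms(1) by (cases "c \<in> P") (auto simp: Lat_def)
  qed
  moreover have "dA (\<lambda>j. Z j + m) j = dA Z j" for j by (simp add: dA_def vec_eq_iff)
  ultimately show ?thesis
    by (simp add: act_def per[OF assms(1)] distrib_right sum.distrib)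
qed

text \<open>The terms of the Riemann sum are compared with increments of an antiderivative by the
  mean value theorem; the gradient term is bounded through \<open>window_sum\<close>.\<close>

lemma act_limit:
  assumes z: "sol z" and Ns: "\<And>i. 0 < Ns i" "filterlim Ns at_top sequentially" and W: "\<And>i. W i \<in> X (Ns i)"
    and r: "(\<lambda>i. res (Ns i) (W i)) \<longlonglongrightarrow> 0"
    and close: "\<And>\<epsilon>. 0 < \<epsilon> \<Longrightarrow> \<forall>\<^sub>F i in sequentially. \<forall>j. norm (W i j - z (\<theta> + hs (Ns i) * of_int j)) \<le> \<epsilon>"
  shows "(\<lambda>i. act (Ns i) (W i)) \<longlonglongrightarrow> Act z"
proof -
  obtain F where F: "\<And>t. (F has_real_derivative lag (z t)) (at t)" "\<And>\<theta>. F (\<theta> + T) - F \<theta> = Act z"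
    using action_antiderivative[OF z] by blast
  note cz = sol_continuous[OF z]
  have "compact (z ` {\<theta>..\<theta> + T})"
    by (rule compact_continuous_image[OF continuous_on_subset[OF cz]]) auto
  then obtain B where B: "\<And>t. t \<in> {\<theta>..\<theta> + T} \<Longrightarrow> norm (z t) \<le> B"
    using compact_imp_bounded bounded_iff by (metis (no_types, lifting) image_eqI)
  have B0: "0 \<le> B" using order_trans[OF norm_ge_zero B[of \<theta>]] T0 by simp
  have uc: "uniformly_continuous_on (cball 0 (B + 1)) lag"
    by (rule compact_uniformly_continuous[OF continuous_on_subset[OF continuous_on_lag]]) auto
  have uc2: "uniformly_continuous_on {\<theta>..\<theta> + T} (\<lambda>t. lag (z t))"
    by (rule compact_uniformly_continuous[OF continuous_on_compose2[OF continuous_on_lag continuous_on_subset[OF cz]]]) auto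
  have h0: "(\<lambda>i. hs (Ns i)) \<longlonglongrightarrow> 0"
    unfolding hs_def
    by (rule real_tendsto_divide_at_top[OF tendsto_const filterlim_compose[OF filterlim_real_sequentially Ns(2)]])
  define D where "D = real CARD('d)"
  have grid: "\<theta> + hs (Ns i) * real j \<in> {\<theta>..\<theta> + T}" if "j \<le> Ns i" for i j
  proof -
    have "hs (Ns i) * real j \<le> hs (Ns i) * real (Ns i)" using that hs_nonneg by (intro mult_left_mono) auto
    then show ?thesis using N_hs[OF Ns(1)[of i]] hs_nonneg[of "Ns i"] by (simp add: mult.commute)
  qed
  have main: "\<forall>\<^sub>F i in sequentially. \<bar>act (Ns i) (W i) - Act z\<bar> \<le> 2 * T * \<epsilon> + D * (B + 1) * res (Ns i) (W i)"
    if \<epsilon>: "0 < \<epsilon>" for \<epsilon>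
  proof -
    obtain d1 where d1: "0 < d1" "\<And>x y. x \<in> cball 0 (B + 1) \<Longrightarrow> y \<in> cball 0 (B + 1) \<Longrightarrow> dist y x < d1 \<Longrightarrow> dist (lag y) (lag x) < \<epsilon>"
      using uc[unfolded uniformly_continuous_on_def, rule_format, OF \<epsilon>] by auto
    obtain d2 where d2: "0 < d2" "\<And>s t. s \<in> {\<theta>..\<theta> + T} \<Longrightarrow> t \<in> {\<theta>..\<theta> + T} \<Longrightarrow> dist t s < d2 \<Longrightarrow> dist (lag (z t)) (lag (z s)) < \<epsilon>"
      using uc2[unfolded uniformly_continuous_on_def, rule_format, OF \<epsilon>] by auto
    have "\<forall>\<^sub>F i in sequentially. hs (Ns i) < d2" by (rule order_tendstoD(2)[OF h0 d2(1)])
    moreover have "\<forall>\<^sub>F i in sequentially. \<forall>j. norm (W i j - z (\<theta> + hs (Ns i) * of_int j)) \<le> min 1 (d1 / 2)"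
      by (rule close) (use d1 in simp)
    ultimately show ?thesis
    proof eventually_elim
      case (elim i)
      define N where "N = Ns i"
      define h where "h = hs N"
      have N: "0 < N" using Ns by (simp add: N_def)
      have h: "0 < h" using hs_pos[OF N] by (simp add: h_def)
      have Wd: "norm (W i (int j) - z (\<theta> + h * real j)) \<le> 1" "norm (W i (int j) - z (\<theta> + h * real j)) < d1" for j
        using elim(2)[rule_format, of "int j"] d1(1) by (auto simp: h_def N_def)
      have gr: "\<theta> + h * real j \<in> {\<theta>..\<theta> + T}" if "j \<le> N" for j using grid[of j i] that by (simp add: h_def N_def)
      have WB: "norm (W i (int j)) \<le> B + 1" if "j < N" for j
        using Wd(1)[of j] B[OF gr[of j]] that norm_triangle_sub[of "W i (int j)" "z (\<theta> + h * real j)"] by linarith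
      have trm: "\<bar>h * lag (W i (int j)) - (F (\<theta> + h * real (Suc j)) - F (\<theta> + h * real j))\<bar> \<le> h * (2 * \<epsilon>)" if j: "j < N" for j
      proof -
        define t where "t = \<theta> + h * real j"
        have tS: "\<theta> + h * real (Suc j) = t + h" by (simp add: t_def algebra_simps)
        obtain \<xi> where \<xi>: "t < \<xi>" "\<xi> < t + h" "F (t + h) - F t = (t + h - t) * lag (z \<xi>)"
          using MVT2[of t "t + h" F "\<lambda>t. lag (z t)"] F(1) h by auto
        have "t \<in> {\<theta>..\<theta> + T}" "t + h \<in> {\<theta>..\<theta> + T}" using gr[of j] gr[of "Suc j"] j tS by (auto simp: t_def)
        then have "dist (lag (z \<xi>)) (lag (z t)) < \<epsilon>"
          by (intro d2(2)) (use \<xi> elim(1) in \<open>auto simp: dist_real_def h_def N_def\<close>)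
        moreover have "dist (lag (W i (int j))) (lag (z t)) < \<epsilon>"
          by (rule d1(2)) (use WB[OF j] B[OF \<open>t \<in> {\<theta>..\<theta> + T}\<close>] Wd(2)[of j] in \<open>auto simp: dist_norm t_def\<close>)
        ultimately have "\<bar>lag (W i (int j)) - lag (z \<xi>)\<bar> \<le> 2 * \<epsilon>" by (simp add: dist_real_def)
        then have "h * \<bar>lag (W i (int j)) - lag (z \<xi>)\<bar> \<le> h * (2 * \<epsilon>)" using h by (intro mult_left_mono) auto
        moreover have "h * lag (W i (int j)) - (F (\<theta> + h * real (Suc j)) - F (\<theta> + h * real j)) = h * (lag (W i (int j)) - lag (z \<xi>))"
          unfolding tS t_def[symmetric] using \<xi>(3) by (simp add: algebra_simps)
        ultimately show ?thesis using h by (simp add: abs_mult)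
      qed
      have "(\<Sum>j<N. F (\<theta> + h * real (Suc j)) - F (\<theta> + h * real j)) = F (\<theta> + h * real N) - F (\<theta> + h * real 0)"
        by (rule sum_lessThan_telescope)
      also have "\<dots> = Act z" using F(2)[of \<theta>] N_hs[OF N] by (simp add: h_def mult.commute)
      finally have tel: "(\<Sum>j<N. F (\<theta> + h * real (Suc j)) - F (\<theta> + h * real j)) = Act z" .
      have "\<bar>h * (\<Sum>j<N. lag (W i (int j))) - Act z\<bar> =
         \<bar>\<Sum>j<N. h * lag (W i (int j)) - (F (\<theta> + h * real (Suc j)) - F (\<theta> + h * real j))\<bar>"
        unfolding tel[symmetric] by (simp add: sum_subtractf sum_distrib_left)
      also have "\<dots> \<le> (\<Sum>j<N. h * (2 * \<epsilon>))" by (rule order_trans[OF sum_abs sum_mono]) (use trm in auto)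
      also have "\<dots> = 2 * T * \<epsilon>" using N_hs[OF N] by (simp add: h_def)
      finally have 1: "\<bar>h * (\<Sum>j<N. lag (W i (int j))) - Act z\<bar> \<le> 2 * T * \<epsilon>" .
      have "\<bar>\<Sum>j<N. \<Sum>c\<in>Mom. W i (int j) $ c * rho N (W i) (int j) $ c\<bar> \<le> (\<Sum>j<N. D * (B + 1) * norm (rho N (W i) (0 + int j)))"
      proof (rule order_trans[OF sum_abs sum_mono])
        fix j assume j: "j \<in> {..<N}"
        have "\<bar>\<Sum>c\<in>Mom. W i (int j) $ c * rho N (W i) (int j) $ c\<bar> \<le> (\<Sum>c\<in>Mom. (B + 1) * norm (rho N (W i) (int j)))"
        proof (rule order_trans[OF sum_abs sum_mono])
          fix c
          have "\<bar>W i (int j) $ c\<bar> \<le> B + 1" using WB[of j] j component_le_norm_cart[of "W i (int j)" c] by simp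
          then show "\<bar>W i (int j) $ c * rho N (W i) (int j) $ c\<bar> \<le> (B + 1) * norm (rho N (W i) (int j))"
            unfolding abs_mult using B0 by (intro mult_mono component_le_norm_cart) auto
        qed
        also have "\<dots> \<le> (\<Sum>c\<in>(UNIV::'d set). (B + 1) * norm (rho N (W i) (int j)))"
          by (rule sum_mono2) (use B0 in auto)
        finally show "\<bar>\<Sum>c\<in>Mom. W i (int j) $ c * rho N (W i) (int j) $ c\<bar> \<le> D * (B + 1) * norm (rho N (W i) (0 + int j))"
          by (simp add: D_def)
      qed
      then have "h * \<bar>\<Sum>j<N. \<Sum>c\<in>Mom. W i (int j) $ c * rho N (W i) (int j) $ c\<bar>
          \<le> D * (B + 1) * (h * (\<Sum>j<N. norm (rho N (W i) (0 + int j))))"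
        using mult_left_mono[OF _ less_imp_le[OF h]] by (fastforce simp: sum_distrib_left mult_ac)
      also have "\<dots> \<le> D * (B + 1) * res N (W i)"
        using window_sum[OF N, of "W i" N 1 0] W[of i] B0 by (intro mult_left_mono) (auto simp: h_def N_def D_def)
      finally have 2: "\<bar>h * (\<Sum>j<N. \<Sum>c\<in>Mom. W i (int j) $ c * rho N (W i) (int j) $ c)\<bar> \<le> D * (B + 1) * res N (W i)"
        using h by (simp add: abs_mult)
      show ?case using 1 2 act_eq[OF N, of "W i"] unfolding N_def[symmetric] h_def[symmetric] by linarith
    qed
  qed
  show ?thesis
  proof (rule LIMSEQ_I)
    fix e :: real assume e: "0 < e"
    have "0 < e / (8 * T)" using e T0 by simp
    from main[OF this] have m: "\<forall>\<^sub>F i in sequentially. \<bar>act (Ns i) (W i) - Act z\<bar> \<le> e / 4 + D * (B + 1) * res (Ns i) (W i)"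
      using T0 by simp
    have "(\<lambda>i. D * (B + 1) * res (Ns i) (W i)) \<longlonglongrightarrow> D * (B + 1) * 0" by (intro tendsto_intros r)
    from order_tendstoD(2)[OF this, of "e / 4"] have "\<forall>\<^sub>F i in sequentially. D * (B + 1) * res (Ns i) (W i) < e / 4"
      using e by simp
    with m have "\<forall>\<^sub>F i in sequentially. norm (act (Ns i) (W i) - Act z) < e"
      by eventually_elim (use e in auto)
    then show "\<exists>no. \<forall>n\<ge>no. norm (act (Ns n) (W n) - Act z) < e" by (simp add: eventually_sequentially)
  qed
qed

section \<open>Separation of distinct classes\<close>

lemma nr_lower:
  assumes N: "0 < N" and e: "e \<in> Per N" and lip: "\<And>j. norm (e (j + 1) - e j) \<le> b"
    and e0: "2 * \<rho> \<le> norm (e j0)" and n: "n \<le> N" "real n * b \<le> \<rho>" and \<rho>: "0 \<le> \<rho>"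
  shows "real n * hs N * \<rho>\<^sup>2 \<le> (nr N e)\<^sup>2"
proof -
  have b0: "0 \<le> b" using lip[of 0] norm_ge_zero order_trans by blast
  have far: "norm (e (j0 + int i) - e j0) \<le> real i * b" for i
  proof (induction i)
    case (Suc i)
    have "norm (e (j0 + int i + 1) - e j0) \<le> norm (e (j0 + int i + 1) - e (j0 + int i)) + norm (e (j0 + int i) - e j0)"
      by (metis diff_add_cancel norm_triangle_ineq add_diff_eq)
    then show ?case using Suc lip[of "j0 + int i"] by (simp add: algebra_simps)
  qed simp
  have big: "\<rho> \<le> norm (e (j0 + int i))" if "i < n" for i
  proof -
    have "real i * b \<le> real n * b" using that b0 by (intro mult_right_mono) auto
    then have "norm (e (j0 + int i) - e j0) \<le> \<rho>" using far[of i] n(2) by linarith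
    then show ?thesis using e0 norm_triangle_ineq2[of "e j0" "e (j0 + int i)"] by (simp add: norm_minus_commute)
  qed
  have "real n * \<rho>\<^sup>2 = (\<Sum>i<n. \<rho>\<^sup>2)" by simp
  also have "\<dots> \<le> (\<Sum>i<n. (norm (e (j0 + int i)))\<^sup>2)"
    by (rule sum_mono) (use big \<rho> in \<open>auto intro: power_mono\<close>)
  also have "\<dots> \<le> (\<Sum>i<N. (norm (e (j0 + int i)))\<^sup>2)" by (rule sum_mono2) (use n in auto)
  also have "\<dots> = (\<Sum>i<N. (norm (e (int i)))\<^sup>2)"
    by (rule sum_period_shift) (use e in \<open>simp add: Per_def\<close>)
  finally have "hs N * (real n * \<rho>\<^sup>2) \<le> hs N * (\<Sum>i<N. (norm (e (int i)))\<^sup>2)"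
    using hs_nonneg by (intro mult_left_mono) auto
  also have "\<dots> = (nr N e)\<^sup>2" by (simp add: nr_square ip_def power2_norm_eq_inner)
  finally show ?thesis by (simp add: mult_ac)
qed

text \<open>A loop with increments of order \<open>hs N\<close> that once reaches \<rho> stays above
  \<rho> / 2 on a time window of length at least w. As w does not depend on \<open>N\<close>, this
  bounds its L2 norm from below uniformly.\<close>

lemma sup_small:
  assumes L: "0 < L" and \<rho>: "0 < \<rho>"
  obtains \<delta> N0 where "0 < \<delta>" "\<And>N e j. N0 \<le> N \<Longrightarrow> 0 < N \<Longrightarrow> e \<in> Per N \<Longrightarrow>
    (\<And>j. norm (e (j + 1) - e j) \<le> L * hs N) \<Longrightarrow> nr N e \<le> \<delta> \<Longrightarrow> norm (e j) < \<rho>"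
proof -
  define w where "w = min T (\<rho> / (4 * L))"
  have w: "0 < w" using T0 L \<rho> by (simp add: w_def)
  obtain N0 :: nat where N0: "T / (\<rho> / (4 * L)) < real N0" using reals_Archimedean2 by blast
  show thesis
  proof (rule that[of "sqrt w * \<rho> / 4" N0])
    show "0 < sqrt w * \<rho> / 4" using w \<rho> by simp
    fix N e j assume N: "N0 \<le> N" "0 < N" and e: "e \<in> Per N" "\<And>j. norm (e (j + 1) - e j) \<le> L * hs N"
      and nr: "nr N e \<le> sqrt w * \<rho> / 4"
    show "norm (e j) < \<rho>"
    proof (rule ccontr)
      assume "\<not> norm (e j) < \<rho>"
      then have ej: "2 * (\<rho> / 2) \<le> norm (e j)" by simp
      have h: "0 < hs N" by (rule hs_pos[OF N(2)])
      have "T / (\<rho> / (4 * L)) < real N" using N0 N by simp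
      then have hsmall: "hs N < \<rho> / (4 * L)"
        using N(2) \<rho> L T0 by (simp add: hs_def field_simps)
      define n where "n = min N (nat \<lfloor>\<rho> / (2 * L * hs N)\<rfloor>)"
      have "real n \<le> real (nat \<lfloor>\<rho> / (2 * L * hs N)\<rfloor>)" by (simp add: n_def)
      also have "\<dots> \<le> \<rho> / (2 * L * hs N)" using \<rho> L h by (intro of_nat_floor) simp
      finally have nb: "real n * (L * hs N) \<le> \<rho> / 2" using L h by (simp add: le_divide_eq mult_ac)
      have wn: "w \<le> real n * hs N"
      proof (cases "N \<le> nat \<lfloor>\<rho> / (2 * L * hs N)\<rfloor>")
        case True
        then show ?thesis using N_hs[OF N(2)] by (simp add: n_def w_def)
      next
        case False
        then have n: "n = nat \<lfloor>\<rho> / (2 * L * hs N)\<rfloor>" by (simp add: n_def)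
        have "\<rho> / (2 * L * hs N) - 1 \<le> real n" unfolding n by linarith
        then have "(\<rho> / (2 * L * hs N) - 1) * hs N \<le> real n * hs N" using h by (intro mult_right_mono) auto
        moreover have "(\<rho> / (2 * L * hs N) - 1) * hs N = \<rho> / (2 * L) - hs N" using h L by (simp add: field_simps)
        moreover have "\<rho> / (2 * L) = 2 * (\<rho> / (4 * L))" by simp
        moreover have "w \<le> \<rho> / (4 * L)" by (simp add: w_def)
        ultimately show ?thesis using hsmall by linarith
      qed
      have "w * (\<rho> / 2)\<^sup>2 \<le> real n * hs N * (\<rho> / 2)\<^sup>2" using wn by (intro mult_right_mono) auto
      also have "\<dots> \<le> (nr N e)\<^sup>2"
        by (rule nr_lower[OF N(2) e(1) e(2) ej _ nb]) (use \<rho> in \<open>auto simp: n_def\<close>)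
      also have "\<dots> \<le> (sqrt w * \<rho> / 4)\<^sup>2" using nr nr_nonneg by (intro power_mono) auto
      also have "\<dots> = w * (\<rho> / 2)\<^sup>2 / 4" using w by (simp add: power_mult_distrib power_divide)
      finally show False using w \<rho> by simp
    qed
  qed
qed

text \<open>Iteration gives z(q \<Delta>) = z(0) - q m, whereas z(t) - (t / T) V is bounded; hence m
  is a real multiple of \<open>V\<close>. This keeps different translates of one solution
  apart.\<close>

lemma red_zero_of_translation:
  assumes z: "sol z" and eq: "\<And>t. z (t + \<Delta>) + m = z t"
  shows "red m = 0"
proof -
  define u where "u t = z t - (t / T) *\<^sub>R V" for t
  have cz: "continuous_on UNIV (\<lambda>t. z t $ c)" for c
    by (rule continuous_on_component[OF sol_continuous[OF z]])
  have q: "z (real q * \<Delta>) = z 0 - real q *\<^sub>R m" for q :: nat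
  proof (induction q)
    case (Suc q)
    have "z (real q * \<Delta> + \<Delta>) = z (real q * \<Delta>) - m" using eq[of "real q * \<Delta>"] by (simp add: eq_diff_eq)
    moreover have "real (Suc q) * \<Delta> = real q * \<Delta> + \<Delta>" by (simp add: algebra_simps)
    ultimately show ?case using Suc by (simp only:) (simp add: scaleR_left_distrib)
  qed simp
  have "(m + (\<Delta> / T) *\<^sub>R V) $ c = 0" for c
  proof -
    have "\<exists>B\<ge>0. \<forall>t. \<bar>u t $ c\<bar> \<le> B"
    proof (rule periodic_bounded)
      show "continuous_on UNIV (\<lambda>t. u t $ c)"
        unfolding u_def vector_minus_component vector_scaleR_component
        by (intro continuous_on_diff cz continuous_intros) (use T0 in simp)
      show "u (t + T) $ c = u t $ c" for t
      proof -
        have "z (t + T) = z t + V" using z by (simp add: sol_def)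
        then show ?thesis using T0 by (simp add: u_def add_divide_distrib scaleR_left_distrib)
      qed
    qed
    then obtain B where B: "\<And>t. \<bar>u t $ c\<bar> \<le> B" by blast
    define x where "x = (m + (\<Delta> / T) *\<^sub>R V) $ c"
    have eqx: "real q * x = z 0 $ c - u (real q * \<Delta>) $ c" for q :: nat
    proof -
      have "z (real q * \<Delta>) $ c = z 0 $ c - real q * m $ c" by (simp add: q)
      then show ?thesis by (simp add: x_def u_def algebra_simps)
    qed
    have le: "real q * \<bar>x\<bar> \<le> \<bar>z 0 $ c\<bar> + B" for q :: nat
    proof -
      have "real q * \<bar>x\<bar> = \<bar>real q * x\<bar>" by (simp add: abs_mult)
      also have "\<dots> = \<bar>z 0 $ c - u (real q * \<Delta>) $ c\<bar>" using eqx[of q] by (simp only:)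
      finally show ?thesis using B[of "real q * \<Delta>"] by linarith
    qed
    show ?thesis
    proof (rule ccontr)
      assume "(m + (\<Delta> / T) *\<^sub>R V) $ c \<noteq> 0"
      then have "0 < \<bar>x\<bar>" by (simp add: x_def)
      then obtain q :: nat where "\<bar>z 0 $ c\<bar> + B < real q * \<bar>x\<bar>" using reals_Archimedean3 by blast
      then show False using le[of q] by linarith
    qed
  qed
  then have "m = (- (\<Delta> / T)) *\<^sub>R V" by (simp add: vec_eq_iff eq_neg_iff_add_eq_0)
  then show ?thesis using i0 by (simp add: red_def)
qed

lemma red_add: "red (m + m') = red m + red m'" and red_scale: "red (q *\<^sub>R m) = q *\<^sub>R red m"
  and red_V: "red V = 0" and red_diff: "red (m - m') = red m - red m'"
  using i0 by (simp_all add: red_def add_divide_distrib diff_divide_distrib algebra_simps)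

lemma sol_shift_int:
  assumes "sol z"
  shows "z (t + of_int q * T) = z t + of_int q *\<^sub>R V"
proof (induction q rule: int_induct[of _ 0])
  case (step1 i)
  have "z (t + of_int i * T + T) = z (t + of_int i * T) + V" using assms by (simp add: sol_def)
  then show ?case using step1 by (simp add: algebra_simps)
next
  case (step2 i)
  have "z (t + of_int (i - 1) * T + T) = z (t + of_int (i - 1) * T) + V" using assms by (simp add: sol_def)
  then show ?case using step2 by (simp add: algebra_simps)
qed simp

lemma sol_bounded:
  assumes "sol z"
  shows "\<exists>B\<ge>0. \<forall>t\<in>{0..T}. norm (z t) \<le> B"
proof -
  have "compact (z ` {0..T})"
    by (rule compact_continuous_image[OF continuous_on_subset[OF sol_continuous[OF assms]]]) auto
  then obtain B where "\<And>t. t \<in> {0..T} \<Longrightarrow> norm (z t) \<le> B"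
    using compact_imp_bounded bounded_iff by (metis (no_types, lifting) image_eqI)
  then show ?thesis by (intro exI[of _ "max B 0"]) (auto simp: le_max_iff_disj)
qed

text \<open>Sequences of lattice vectors that converge are eventually constant, so the integer translation
  survives in the limit.\<close>

lemma orbits_close:
  assumes z: "sol z" and z': "sol z'"
    and seq: "\<And>i. m i \<in> Lat P" "\<And>i. \<theta> i \<in> {0..T}" "\<And>i. \<theta>' i \<in> {0..T}" "\<And>i. Suc i \<le> Ns i"
    and close: "\<And>i j. norm (z (\<theta> i + hs (Ns i) * of_int j) + m i - z' (\<theta>' i + hs (Ns i) * of_int j)) < 1 / real (Suc i)"
  shows "\<exists>i \<Delta>. \<forall>t. z (t + \<Delta>) + m i = z' t"
proof -
  obtain B1 where B1: "\<And>t. t \<in> {0..T} \<Longrightarrow> norm (z t) \<le> B1" using sol_bounded[OF z] by blast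
  obtain B' where B': "\<And>t. t \<in> {0..T} \<Longrightarrow> norm (z' t) \<le> B'" using sol_bounded[OF z'] by blast
  define B where "B = B1"
  note B = B1[folded B_def] B'
  have mB: "m i \<in> cball 0 (1 + B + B')" for i
  proof -
    have "norm (z (\<theta> i) + m i - z' (\<theta>' i)) < 1 / real (Suc i)" using close[of i 0] by simp
    also have "\<dots> \<le> 1" by simp
    finally have "norm (m i) \<le> 1 + norm (z (\<theta> i)) + norm (z' (\<theta>' i))"
      using norm_triangle_ineq4[of "z (\<theta> i) + m i - z' (\<theta>' i) + z' (\<theta>' i)" "z (\<theta> i)"]
        norm_triangle_ineq[of "z (\<theta> i) + m i - z' (\<theta>' i)" "z' (\<theta>' i)"] by simp
    then show ?thesis using B(1)[OF seq(2)[of i]] B(2)[OF seq(3)[of i]] by simp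
  qed
  have cpt: "compact ({0..T} \<times> {0..T} \<times> cball 0 (1 + B + B') :: (real \<times> real \<times> (real ^ 'd)) set)"
    by (intro compact_Times) auto
  obtain l k where l: "strict_mono k" "((\<lambda>i. (\<theta> i, \<theta>' i, m i)) \<circ> k) \<longlonglongrightarrow> l"
    using cpt[unfolded compact_def, rule_format, of "\<lambda>i. (\<theta> i, \<theta>' i, m i)"] seq(2,3) mB by blast
  obtain a a' \<mu> where la: "l = (a, a', \<mu>)" by (cases l) auto
  have lims: "(\<lambda>i. \<theta> (k i)) \<longlonglongrightarrow> a" "(\<lambda>i. \<theta>' (k i)) \<longlonglongrightarrow> a'" "(\<lambda>i. m (k i)) \<longlonglongrightarrow> \<mu>"
    using tendsto_fst[OF l(2)] tendsto_fst[OF tendsto_snd[OF l(2)]] tendsto_snd[OF tendsto_snd[OF l(2)]]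
    by (auto simp: la o_def)
  have "\<forall>\<^sub>F i in sequentially. dist (m (k i)) \<mu> < 1 / 2" by (rule tendstoD[OF lims(3)]) simp
  then obtain n where n: "\<And>i. n \<le> i \<Longrightarrow> dist (m (k i)) \<mu> < 1 / 2" unfolding eventually_sequentially by blast
  have const: "m (k i) = m (k n)" if "n \<le> i" for i
  proof -
    have "dist (m (k i)) (m (k n)) < 1" using n[OF that] n[of n] dist_triangle_half_r[of \<mu> "m (k i)" 1 "m (k n)"]
      by (simp add: dist_commute)
    then have "\<bar>m (k i) $ c - m (k n) $ c\<bar> < 1" for c
      using component_le_norm_cart[of "m (k i) - m (k n)" c] by (simp add: dist_norm)
    moreover have "m (k i) $ c \<in> \<int>" "m (k n) $ c \<in> \<int>" for c using seq(1) by (auto simp: Lat_def)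
    ultimately have "m (k i) $ c = m (k n) $ c" for c
      by (metis Ints_diff Ints_nonzero_abs_less1 eq_iff_diff_eq_0)
    then show ?thesis by (simp add: vec_eq_iff)
  qed
  have \<mu>: "\<mu> = m (k n)"
  proof (rule LIMSEQ_unique[OF lims(3)])
    show "(\<lambda>i. m (k i)) \<longlonglongrightarrow> m (k n)"
      by (rule tendsto_eventually, unfold eventually_sequentially) (use const in blast)
  qed
  have Ninf: "filterlim (\<lambda>i. Ns (k i)) at_top sequentially"
  proof (rule filterlim_at_top_mono[OF filterlim_subseq[OF l(1)]])
    show "\<forall>\<^sub>F i in sequentially. k i \<le> Ns (k i)" 
      using seq(4) by (intro always_eventually allI) (rule Suc_leD)
  qed
  have h0: "(\<lambda>i. hs (Ns (k i))) \<longlonglongrightarrow> 0"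
    unfolding hs_def
    by (rule real_tendsto_divide_at_top[OF tendsto_const filterlim_compose[OF filterlim_real_sequentially Ninf]])
  have hp: "0 < hs (Ns (k i))" for i using seq(4)[of "k i"] by (intro hs_pos) simp
  have lim: "z (a + t) + \<mu> = z' (a' + t)" for t
  proof -
    \<comment> \<open>Closeness is known at sample times only, so t is approached by the grid points
      below it.\<close>
    define s where "s i = hs (Ns (k i)) * of_int \<lfloor>t / hs (Ns (k i))\<rfloor>" for i
    have s: "s \<longlonglongrightarrow> t"
    proof (rule tendsto_sandwich)
      have b: "t - hs (Ns (k i)) \<le> s i \<and> s i \<le> t" for i
      proof -
        have "of_int \<lfloor>t / hs (Ns (k i))\<rfloor> \<le> t / hs (Ns (k i))" "t / hs (Ns (k i)) \<le> of_int \<lfloor>t / hs (Ns (k i))\<rfloor> + 1"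
          by linarith+
        then have "of_int \<lfloor>t / hs (Ns (k i))\<rfloor> * hs (Ns (k i)) \<le> t" "t \<le> (of_int \<lfloor>t / hs (Ns (k i))\<rfloor> + 1) * hs (Ns (k i))"
          using hp[of i] by (simp_all only: pos_le_divide_eq pos_divide_le_eq)
        then show ?thesis by (simp add: s_def algebra_simps)
      qed
      show "\<forall>\<^sub>F i in sequentially. t - hs (Ns (k i)) \<le> s i" "\<forall>\<^sub>F i in sequentially. s i \<le> t" using b by auto
      show "(\<lambda>i. t - hs (Ns (k i))) \<longlonglongrightarrow> t" using tendsto_diff[OF tendsto_const h0, of t] by simp
    qed simp
    have c: "isCont z x" "isCont z' x" for x
      using sol_continuous z z' by (auto simp: continuous_on_eq_continuous_at)
    have "(\<lambda>i. z (\<theta> (k i) + s i) + m (k i) - z' (\<theta>' (k i) + s i)) \<longlonglongrightarrow> z (a + t) + \<mu> - z' (a' + t)"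
      by (intro tendsto_intros isCont_tendsto_compose[OF c(1)] isCont_tendsto_compose[OF c(2)] lims s)
    moreover have "(\<lambda>i. z (\<theta> (k i) + s i) + m (k i) - z' (\<theta>' (k i) + s i)) \<longlonglongrightarrow> 0"
    proof (rule Lim_null_comparison[OF always_eventually])
      show "\<forall>i. norm (z (\<theta> (k i) + s i) + m (k i) - z' (\<theta>' (k i) + s i)) \<le> 1 / real (Suc (k i))"
        using close by (intro allI less_imp_le) (simp only: s_def)
      show "(\<lambda>i. 1 / real (Suc (k i))) \<longlonglongrightarrow> 0"
        using LIMSEQ_subseq_LIMSEQ[OF LIMSEQ_inverse_real_of_nat l(1)] by (simp add: o_def inverse_eq_divide)
    qed
    ultimately have "z (a + t) + \<mu> - z' (a' + t) = 0" by (rule LIMSEQ_unique)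
    then show ?thesis by simp
  qed
  have "z (t + (a - a')) + m (k n) = z' t" for t
    using lim[of "t - a'"] by (simp add: \<mu> algebra_simps)
  then show ?thesis by blast
qed

lemma V_scale_Lat: "of_int q *\<^sub>R V \<in> Lat P"
  by (rule Lat_scale_int[OF VL])

lemma mod_T:
  obtains q :: int where "\<theta> - of_int q * T \<in> {0..T}"
proof -
  have "of_int \<lfloor>\<theta> / T\<rfloor> \<le> \<theta> / T" "\<theta> / T < of_int \<lfloor>\<theta> / T\<rfloor> + 1" by linarith+
  then have "of_int \<lfloor>\<theta> / T\<rfloor> * T \<le> \<theta>" "\<theta> < (of_int \<lfloor>\<theta> / T\<rfloor> + 1) * T"
    using T0 by (simp_all only: pos_le_divide_eq pos_divide_less_eq)
  then show thesis using that[of "\<lfloor>\<theta> / T\<rfloor>"] by (simp add: algebra_simps)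
qed

text \<open>Differences of solutions are Lipschitz, so samples that are L2-close are uniformly close
  by \<open>sup_small\<close>; if this happens at every scale, \<open>orbits_close\<close> makes one
  orbit a translate of the other. The final clause separates the translates of a single
  solution.\<close>

lemma separation_pair:
  assumes z: "sol z" and z': "sol z'"
  shows "\<exists>\<delta>>0. \<exists>N0. \<forall>N\<ge>N0. \<forall>m\<in>Lat P. \<forall>m'\<in>Lat P. \<forall>\<theta> \<theta>'. 0 < N \<longrightarrow>
    nr N (\<lambda>i. sample N z \<theta> m i - sample N z' \<theta>' m' i) \<le> \<delta> \<longrightarrow>
    (\<exists>\<mu>\<in>Lat P. \<exists>\<Delta>. \<forall>t. z (t + \<Delta>) + \<mu> = z' t) \<and> (z = z' \<longrightarrow> red m = red m')"
proof -
  define Q where "Q m \<longleftrightarrow> (\<exists>\<mu>\<in>Lat P. \<exists>\<Delta>. \<forall>t. z (t + \<Delta>) + \<mu> = z' t) \<and> (z = z' \<longrightarrow> red m = 0)" for m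
  have "\<exists>n. \<forall>N\<ge>Suc n. \<forall>m\<in>Lat P. \<forall>\<theta>\<in>{0..T}. \<forall>\<theta>'\<in>{0..T}.
    (\<forall>j. norm (z (\<theta> + hs N * of_int j) + m - z' (\<theta>' + hs N * of_int j)) < 1 / real (Suc n)) \<longrightarrow> Q m"
  proof (rule ccontr)
    assume "\<nexists>n. \<forall>N\<ge>Suc n. \<forall>m\<in>Lat P. \<forall>\<theta>\<in>{0..T}. \<forall>\<theta>'\<in>{0..T}.
      (\<forall>j. norm (z (\<theta> + hs N * of_int j) + m - z' (\<theta>' + hs N * of_int j)) < 1 / real (Suc n)) \<longrightarrow> Q m"
    then have "\<forall>n. \<exists>N m \<theta> \<theta>'. Suc n \<le> N \<and> m \<in> Lat P \<and> \<theta> \<in> {0..T} \<and> \<theta>' \<in> {0..T} \<and>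
      (\<forall>j. norm (z (\<theta> + hs N * of_int j) + m - z' (\<theta>' + hs N * of_int j)) < 1 / real (Suc n)) \<and> \<not> Q m" by blast
    then obtain Ns m \<theta> \<theta>' where *: "\<And>n. Suc n \<le> Ns n" "\<And>n. m n \<in> Lat P" "\<And>n. \<theta> n \<in> {0..T}" "\<And>n. \<theta>' n \<in> {0..T}"
      "\<And>n j. norm (z (\<theta> n + hs (Ns n) * of_int j) + m n - z' (\<theta>' n + hs (Ns n) * of_int j)) < 1 / real (Suc n)"
      "\<And>n. \<not> Q (m n)" by metis
    obtain i \<Delta> where i: "\<And>t. z (t + \<Delta>) + m i = z' t"
      using orbits_close[OF z z' *(2,3,4,1,5)] by blast
    have "Q (m i)" unfolding Q_def
    proof (intro conjI impI)
      show "\<exists>\<mu>\<in>Lat P. \<exists>\<Delta>. \<forall>t. z (t + \<Delta>) + \<mu> = z' t" using i *(2) by blast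
      show "red (m i) = 0" if "z = z'"
        by (rule red_zero_of_translation[OF z]) (use i that in blast)
    qed
    then show False using *(6) by blast
  qed
  then obtain n where n: "\<And>N m \<theta> \<theta>'. Suc n \<le> N \<Longrightarrow> m \<in> Lat P \<Longrightarrow> \<theta> \<in> {0..T} \<Longrightarrow> \<theta>' \<in> {0..T} \<Longrightarrow>
    (\<And>j. norm (z (\<theta> + hs N * of_int j) + m - z' (\<theta>' + hs N * of_int j)) < 1 / real (Suc n)) \<Longrightarrow> Q m" by blast
  define L where "L = 2 * CG + 1"
  have L: "0 < L" using CG_nonneg by (simp add: L_def)
  obtain \<delta> N0 where \<delta>: "0 < \<delta>" "\<And>N e j. N0 \<le> N \<Longrightarrow> 0 < N \<Longrightarrow> e \<in> Per N \<Longrightarrow>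
    (\<And>j. norm (e (j + 1) - e j) \<le> L * hs N) \<Longrightarrow> nr N e \<le> \<delta> \<Longrightarrow> norm (e j) < 1 / real (Suc n)"
    using sup_small[OF L, of "1 / real (Suc n)"] by (metis of_nat_0_less_iff zero_less_Suc zero_less_divide_1_iff)
  have "(\<exists>\<mu>\<in>Lat P. \<exists>\<Delta>. \<forall>t. z (t + \<Delta>) + \<mu> = z' t) \<and> (z = z' \<longrightarrow> red m = red m')"
    if N: "N0 + Suc n \<le> N" and m: "m \<in> Lat P" "m' \<in> Lat P"
      and nr: "nr N (\<lambda>i. sample N z \<theta> m i - sample N z' \<theta>' m' i) \<le> \<delta>" for N m m' \<theta> \<theta>'
  proof -
    have N0: "0 < N" "N0 \<le> N" "Suc n \<le> N" using N by auto
    define e where "e = (\<lambda>i. sample N z \<theta> m i - sample N z' \<theta>' m' i)"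
    have eP: "e \<in> Per N" unfolding e_def
      using z z' by (intro X_diff sample_X N0(1)) (auto simp: sol_def)
    have lip: "norm (e (j + 1) - e j) \<le> L * hs N" for j
    proof -
      have eq: "e (j + 1) - e j = (z (\<theta> + hs N * of_int (j + 1)) - z (\<theta> + hs N * of_int j))
          - (z' (\<theta>' + hs N * of_int (j + 1)) - z' (\<theta>' + hs N * of_int j))"
        by (simp add: e_def sample_def)
      have s: "\<theta> + hs N * of_int (j + 1) - (\<theta> + hs N * of_int j) = hs N" for \<theta> by (simp add: algebra_simps)
      have "norm (e (j + 1) - e j) \<le> CG * \<bar>hs N\<bar> + CG * \<bar>hs N\<bar>"
        unfolding eq using sol_lipschitz[OF z, of "\<theta> + hs N * of_int (j + 1)" "\<theta> + hs N * of_int j"]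
          sol_lipschitz[OF z', of "\<theta>' + hs N * of_int (j + 1)" "\<theta>' + hs N * of_int j"]
        unfolding s by (intro order_trans[OF norm_triangle_ineq4 add_mono])
      also have "\<dots> \<le> L * hs N" using hs_nonneg[of N] by (simp add: L_def algebra_simps)
      finally show ?thesis .
    qed
    have small: "norm (e j) < 1 / real (Suc n)" for j
      by (rule \<delta>(2)[OF N0(2,1) eP lip nr[folded e_def]])
    obtain q q' :: int where q: "\<theta> - of_int q * T \<in> {0..T}" "\<theta>' - of_int q' * T \<in> {0..T}"
      using mod_T by metis
    \<comment> \<open>Time shifts are reduced to one period at the price of multiples of
      \<open>V\<close>, which \<open>red\<close> ignores.\<close>
    define \<mu> where "\<mu> = m - m' + (of_int q *\<^sub>R V - of_int q' *\<^sub>R V)"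
    have \<mu>: "\<mu> \<in> Lat P"
      unfolding \<mu>_def diff_conv_add_uminus by (intro Lat_add Lat_uminus V_scale_Lat m)
    have "Q \<mu>"
    proof (rule n[OF N0(3) \<mu> q])
      fix j
      have "z (\<theta> + hs N * of_int j) = z (\<theta> - of_int q * T + hs N * of_int j) + of_int q *\<^sub>R V"
        using sol_shift_int[OF z, of "\<theta> - of_int q * T + hs N * of_int j" q] by (simp add: algebra_simps)
      moreover have "z' (\<theta>' + hs N * of_int j) = z' (\<theta>' - of_int q' * T + hs N * of_int j) + of_int q' *\<^sub>R V"
        using sol_shift_int[OF z', of "\<theta>' - of_int q' * T + hs N * of_int j" q'] by (simp add: algebra_simps)
      ultimately have "e j = z (\<theta> - of_int q * T + hs N * of_int j) + \<mu> - z' (\<theta>' - of_int q' * T + hs N * of_int j)"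
        by (simp add: e_def sample_def \<mu>_def)
      then show "norm (z (\<theta> - of_int q * T + hs N * of_int j) + \<mu> - z' (\<theta>' - of_int q' * T + hs N * of_int j)) < 1 / real (Suc n)"
        using small[of j] by simp
    qed
    then show ?thesis by (simp add: Q_def \<mu>_def red_add red_diff red_scale red_V)
  qed
  then show ?thesis using \<delta>(1) by blast
qed

lemma separation:
  assumes zs: "\<forall>j<l. sol (zs j)"
    and distinct: "\<forall>i<l. \<forall>j<l. \<forall>m\<in>Lat P. \<forall>\<Delta>. (\<forall>t. zs i (t + \<Delta>) + m = zs j t) \<longrightarrow> i = j"
  obtains \<delta> N0 where "0 < \<delta>" "\<And>N Z c c'. N0 \<le> N \<Longrightarrow> 0 < N \<Longrightarrow> Z \<in> X N \<Longrightarrow>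
    nearby N zs l (2 * \<delta>) Z c \<Longrightarrow> nearby N zs l (2 * \<delta>) Z c' \<Longrightarrow> c = c'"
proof -
  define S where "S i j \<delta> N0 \<longleftrightarrow> (\<forall>N\<ge>N0. \<forall>m\<in>Lat P. \<forall>m'\<in>Lat P. \<forall>\<theta> \<theta>'. 0 < N \<longrightarrow>
    nr N (\<lambda>r. sample N (zs i) \<theta> m r - sample N (zs j) \<theta>' m' r) \<le> \<delta> \<longrightarrow>
    (\<exists>\<mu>\<in>Lat P. \<exists>\<Delta>. \<forall>t. zs i (t + \<Delta>) + \<mu> = zs j t) \<and> (zs i = zs j \<longrightarrow> red m = red m'))"
    for i j \<delta> and N0 :: nat
  have "\<exists>\<delta> N0. 0 < \<delta> \<and> S i j \<delta> N0" if "i < l" "j < l" for i j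
    using separation_pair[of "zs i" "zs j"] zs that unfolding S_def by blast
  then obtain d n where dn: "\<And>i j. i < l \<Longrightarrow> j < l \<Longrightarrow> 0 < d i j \<and> S i j (d i j) (n i j)" by metis
  define D where "D = insert 1 ((\<lambda>(i, j). d i j) ` ({..<l} \<times> {..<l}))"
  define N0 where "N0 = (\<Sum>(i, j)\<in>{..<l} \<times> {..<l}. n i j)"
  have D: "finite D" "D \<noteq> {}" "\<And>x. x \<in> D \<Longrightarrow> 0 < x" using dn by (auto simp: D_def)
  have Dij: "Min D \<le> d i j" if "i < l" "j < l" for i j
    by (rule Min_le[OF D(1)]) (use that in \<open>auto simp: D_def\<close>)
  have Nij: "n i j \<le> N0" if "i < l" "j < l" for i j
    unfolding N0_def using member_le_sum[of "(i, j)" "{..<l} \<times> {..<l}" "\<lambda>(i, j). n i j"] that by auto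
  have M: "0 < Min D" using D by simp
  show thesis
  \<comment> \<open>Two distances of twice this radius add up to \<open>Min D\<close>.\<close>
  proof (rule that[of "Min D / 4" N0])
    show "0 < Min D / 4" using M by simp
    fix N Z c c' assume N: "N0 \<le> N" "0 < N" and Z: "Z \<in> X N"
      and near: "nearby N zs l (2 * (Min D / 4)) Z c" "nearby N zs l (2 * (Min D / 4)) Z c'"
    obtain m \<theta> where m: "fst c < l" "m \<in> Lat P" "red m = snd c" "nr N (\<lambda>r. Z r - sample N (zs (fst c)) \<theta> m r) \<le> Min D / 2"
      using near(1) unfolding nearby_def by auto
    obtain m' \<theta>' where m': "fst c' < l" "m' \<in> Lat P" "red m' = snd c'" "nr N (\<lambda>r. Z r - sample N (zs (fst c')) \<theta>' m' r) \<le> Min D / 2"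
      using near(2) unfolding nearby_def by auto
    have "nr N (\<lambda>r. sample N (zs (fst c)) \<theta> m r - sample N (zs (fst c')) \<theta>' m' r) =
      nr N (\<lambda>r. (sample N (zs (fst c)) \<theta> m r - Z r) + (Z r - sample N (zs (fst c')) \<theta>' m' r))" by simp
    also have "\<dots> \<le> nr N (\<lambda>r. sample N (zs (fst c)) \<theta> m r - Z r) + nr N (\<lambda>r. Z r - sample N (zs (fst c')) \<theta>' m' r)"
      by (rule nr_triangle)
    also have "\<dots> \<le> Min D" using m(4) m'(4) nr_minus[of N Z "sample N (zs (fst c)) \<theta> m"] by simp
    also have "\<dots> \<le> d (fst c) (fst c')" by (rule Dij[OF m(1) m'(1)])
    finally have nr: "nr N (\<lambda>r. sample N (zs (fst c)) \<theta> m r - sample N (zs (fst c')) \<theta>' m' r) \<le> d (fst c) (fst c')" .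
    have "n (fst c) (fst c') \<le> N" using Nij[OF m(1) m'(1)] N by simp
    then have concl: "(\<exists>\<mu>\<in>Lat P. \<exists>\<Delta>. \<forall>t. zs (fst c) (t + \<Delta>) + \<mu> = zs (fst c') t) \<and> (zs (fst c) = zs (fst c') \<longrightarrow> red m = red m')"
      using dn[OF m(1) m'(1)] nr m(2) m'(2) N(2) unfolding S_def by blast
    then have "fst c = fst c'" using distinct m(1) m'(1) by blast
    moreover have "snd c = snd c'" using concl calculation m(3) m'(3) by metis
    ultimately show "c = c'" by (rule prod_eqI)
  qed
qed

text \<open>A Palais-Smale condition uniform in \<open>N\<close>: along a sequence of
  counterexamples \<open>N\<close> tends to infinity, so a limit is a genuine solution of action at
  most \<beta>, which \<open>cover\<close> places in a known class.\<close>

lemma palais_smale: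
  assumes zs: "\<forall>j<l. sol (zs j)"
    and cover: "\<forall>z. sol z \<longrightarrow> Act z \<le> \<beta> \<longrightarrow> (\<exists>j<l. \<exists>m\<in>Lat P. \<exists>\<theta>. \<forall>t. z t = zs j (t + \<theta>) + m)"
    and \<epsilon>: "0 < \<epsilon>"
  obtains \<eta> N0 where "0 < \<eta>" "\<And>N Z. N0 \<le> N \<Longrightarrow> 0 < N \<Longrightarrow> Z \<in> X N \<Longrightarrow> nr N (rho N Z) \<le> \<eta> \<Longrightarrow> act N Z \<le> \<beta> \<Longrightarrow>
    \<exists>c. nearby N zs l \<epsilon> Z c \<and> \<bar>act N Z - Act (zs (fst c))\<bar> \<le> \<epsilon>"
proof -
  define Q where "Q N Z \<longleftrightarrow> (\<exists>c. nearby N zs l \<epsilon> Z c \<and> \<bar>act N Z - Act (zs (fst c))\<bar> \<le> \<epsilon>)" for N Z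
  have "\<exists>n. \<forall>N\<ge>Suc n. \<forall>Z\<in>X N. nr N (rho N Z) \<le> 1 / real (Suc n) \<longrightarrow> act N Z \<le> \<beta> \<longrightarrow> Q N Z"
  proof (rule ccontr)
    assume "\<nexists>n. \<forall>N\<ge>Suc n. \<forall>Z\<in>X N. nr N (rho N Z) \<le> 1 / real (Suc n) \<longrightarrow> act N Z \<le> \<beta> \<longrightarrow> Q N Z"
    then have "\<forall>n. \<exists>N Z. Suc n \<le> N \<and> Z \<in> X N \<and> nr N (rho N Z) \<le> 1 / real (Suc n) \<and> act N Z \<le> \<beta> \<and> \<not> Q N Z" by blast
    then obtain Ns Z where *: "\<And>n. Suc n \<le> Ns n" "\<And>n. Z n \<in> X (Ns n)" "\<And>n. nr (Ns n) (rho (Ns n) (Z n)) \<le> 1 / real (Suc n)"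
      "\<And>n. act (Ns n) (Z n) \<le> \<beta>" "\<And>n. \<not> Q (Ns n) (Z n)" by metis
    have Npos: "0 < Ns n" for n using *(1)[of n] by simp
    have Ninf: "filterlim Ns at_top sequentially"
    proof (rule filterlim_at_top_mono[OF filterlim_ident])
      show "\<forall>\<^sub>F n in sequentially. n \<le> Ns n"
        using *(1) by (intro always_eventually allI) (rule Suc_leD)
    qed
    have r0: "(\<lambda>i. res (Ns i) (Z i)) \<longlonglongrightarrow> 0"
    proof (rule Lim_null_comparison[OF always_eventually])
      show "\<forall>i. norm (res (Ns i) (Z i)) \<le> sqrt T * (1 / real (Suc i))"
        using mult_left_mono[OF *(3), of "sqrt T"] T0 res_nonneg by (simp add: res_def)
      show "(\<lambda>i. sqrt T * (1 / real (Suc i))) \<longlonglongrightarrow> 0"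
        using tendsto_mult_right[OF LIMSEQ_inverse_real_of_nat, of "sqrt T"] by (simp add: inverse_eq_divide)
    qed
    obtain k z m where k: "strict_mono k" "\<And>t. z (t + T) = z t + V" "\<And>t. (z has_vector_derivative Jm (G (z t))) (at t)"
      "\<And>n. m n \<in> Lat P" "\<And>\<epsilon>. 0 < \<epsilon> \<Longrightarrow> \<forall>\<^sub>F n in sequentially. \<forall>j. norm (Z (k n) j + m n - z (hs (Ns (k n)) * of_int j)) \<le> \<epsilon>"
      by (rule compactness[OF Npos Ninf *(2) r0]) (rule that; assumption)
    have z: "sol z" using k(2,3) by (simp add: sol_def)
    have Nk: "filterlim (\<lambda>n. Ns (k n)) at_top sequentially"
      by (rule filterlim_compose[OF Ninf filterlim_subseq[OF k(1)]])
    have WX: "(\<lambda>j. Z (k n) j + \<mu>) \<in> X (Ns (k n))" for n \<mu> using *(2)[of "k n"] by (simp add: X_def)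
    have rW: "(\<lambda>n. res (Ns (k n)) (\<lambda>j. Z (k n) j + \<mu> n)) \<longlonglongrightarrow> 0" if "\<And>n. \<mu> n \<in> Lat P" for \<mu>
      using LIMSEQ_subseq_LIMSEQ[OF r0 k(1)] by (simp add: res_def rho_translate[OF that] o_def)
    have aW: "act (Ns (k n)) (\<lambda>j. Z (k n) j + \<mu>) = act (Ns (k n)) (Z (k n))" if "\<mu> \<in> Lat P" for n \<mu>
      by (rule act_translate[OF that *(2)])
    have "(\<lambda>n. act (Ns (k n)) (\<lambda>j. Z (k n) j + m n)) \<longlonglongrightarrow> Act z"
      by (rule act_limit[OF z Npos Nk WX rW[OF k(4)], where \<theta> = 0]) (use k(5) in simp)
    then have "(\<lambda>n. act (Ns (k n)) (Z (k n))) \<longlonglongrightarrow> Act z" by (simp add: aW k(4))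
    then have "Act z \<le> \<beta>" by (rule LIMSEQ_le_const2) (use *(4) in blast)
    then obtain j \<mu> \<theta> where j: "j < l" "\<mu> \<in> Lat P" "\<And>t. z t = zs j (t + \<theta>) + \<mu>" using cover z by blast
    have mm: "m n - \<mu> \<in> Lat P" for n unfolding diff_conv_add_uminus by (intro Lat_add Lat_uminus k(4) j(2))
    have close: "\<forall>\<^sub>F n in sequentially. \<forall>r. norm (Z (k n) r + (m n - \<mu>) - zs j (\<theta> + hs (Ns (k n)) * of_int r)) \<le> e" if "0 < e" for e
      using k(5)[OF that] by eventually_elim (simp add: j(3) algebra_simps)
    have "(\<lambda>n. act (Ns (k n)) (\<lambda>j. Z (k n) j + (m n - \<mu>))) \<longlonglongrightarrow> Act (zs j)"
      by (rule act_limit[OF zs[rule_format, OF j(1)] Npos Nk WX rW[OF mm], where \<theta> = \<theta>]) (use close in simp)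
    then have "(\<lambda>n. act (Ns (k n)) (Z (k n))) \<longlonglongrightarrow> Act (zs j)" by (simp only: aW[OF mm])
    then have "\<forall>\<^sub>F n in sequentially. dist (act (Ns (k n)) (Z (k n))) (Act (zs j)) < \<epsilon>" using \<epsilon> by (rule tendstoD)
    moreover have "\<forall>\<^sub>F n in sequentially. \<forall>r. norm (Z (k n) r + (m n - \<mu>) - zs j (\<theta> + hs (Ns (k n)) * of_int r)) \<le> \<epsilon> / sqrt T"
      by (rule close) (use \<epsilon> T0 in simp)
    ultimately have "\<forall>\<^sub>F n in sequentially. Q (Ns (k n)) (Z (k n))"
    proof eventually_elim
      case (elim n)
      have "nr (Ns (k n)) (\<lambda>r. Z (k n) r - sample (Ns (k n)) (zs j) \<theta> (\<mu> - m n) r) \<le> sqrt T * (\<epsilon> / sqrt T)"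
      proof (rule nr_le[OF Npos])
        show "norm (Z (k n) (int i) - sample (Ns (k n)) (zs j) \<theta> (\<mu> - m n) (int i)) \<le> \<epsilon> / sqrt T" for i
          using elim(2)[rule_format, of "int i"] by (simp add: sample_def algebra_simps)
      qed (use \<epsilon> T0 in simp)
      also have "\<dots> = \<epsilon>" using T0 by simp
      finally have "nr (Ns (k n)) (\<lambda>r. Z (k n) r - sample (Ns (k n)) (zs j) \<theta> (\<mu> - m n) r) \<le> \<epsilon>" .
      moreover have "\<mu> - m n \<in> Lat P" using Lat_uminus[OF mm[of n]] by simp
      ultimately have "nearby (Ns (k n)) zs l \<epsilon> (Z (k n)) (j, red (\<mu> - m n))"
        using j(1) unfolding nearby_def by auto
      then show ?case unfolding Q_def using elim(1) by (intro exI[of _ "(j, red (\<mu> - m n))"]) (simp add: dist_real_def)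
    qed
    then obtain n where "Q (Ns (k n)) (Z (k n))" unfolding eventually_sequentially by blast
    then show False using *(5) by blast
  qed
  then obtain n where n: "\<And>N Z. Suc n \<le> N \<Longrightarrow> Z \<in> X N \<Longrightarrow> nr N (rho N Z) \<le> 1 / real (Suc n) \<Longrightarrow> act N Z \<le> \<beta> \<Longrightarrow> Q N Z" by blast
  show thesis
    by (rule that[of "1 / real (Suc n)" "Suc n"]) (use n in \<open>simp_all add: Q_def\<close>)
qed

text \<open>The constants are chosen in the order \<delta>, \<eta>, \<epsilon>, \<eta>', N. Hence
  two uses of \<open>palais_smale\<close>: \<eta> is the price of leaving a \<delta>-neighbourhood,
  and only once it is known can the accuracy \<epsilon> of the levels be made small against \<eta>
  \<delta>.\<close>

theorem orbits_at_least:
  assumes l: "l + 1 \<le> card (- P)" and zs: "\<forall>j<l. sol (zs j)"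
    and distinct: "\<forall>i<l. \<forall>j<l. \<forall>m\<in>Lat P. \<forall>\<Delta>. (\<forall>t. zs i (t + \<Delta>) + m = zs j t) \<longrightarrow> i = j"
    and cover: "\<forall>z. sol z \<longrightarrow> Act z \<le> T * C0 + (norm V)\<^sup>2 \<longrightarrow>
      (\<exists>j<l. \<exists>m\<in>Lat P. \<exists>\<theta>. \<forall>t. z t = zs j (t + \<theta>) + m)"
  shows False
proof -
  obtain \<delta> N0 where \<delta>: "0 < \<delta>" "\<And>N Z c c'. N0 \<le> N \<Longrightarrow> 0 < N \<Longrightarrow> Z \<in> X N \<Longrightarrow>
    nearby N zs l (2 * \<delta>) Z c \<Longrightarrow> nearby N zs l (2 * \<delta>) Z c' \<Longrightarrow> c = c'"
    by (rule separation[OF zs distinct]) (rule that; assumption)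
  obtain \<eta> N1 where \<eta>: "0 < \<eta>" "\<And>N Z. N1 \<le> N \<Longrightarrow> 0 < N \<Longrightarrow> Z \<in> X N \<Longrightarrow> nr N (rho N Z) \<le> \<eta> \<Longrightarrow>
      act N Z \<le> T * C0 + (norm V)\<^sup>2 \<Longrightarrow> \<exists>c. nearby N zs l \<delta> Z c \<and> \<bar>act N Z - Act (zs (fst c))\<bar> \<le> \<delta>"
    by (rule palais_smale[OF zs cover \<delta>(1)]) (rule that; assumption)
  define \<epsilon> where "\<epsilon> = min \<delta> (\<eta> * \<delta> / 16)"
  have \<epsilon>: "0 < \<epsilon>" "\<epsilon> \<le> \<delta>" "8 * \<epsilon> < \<eta> * \<delta>"
  proof -
    have "0 < \<eta> * \<delta>" using \<eta> \<delta> by simp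
    then show "0 < \<epsilon>" "\<epsilon> \<le> \<delta>" "8 * \<epsilon> < \<eta> * \<delta>" using \<delta> by (auto simp: \<epsilon>_def)
  qed
  obtain \<eta>' N2 where \<eta>': "0 < \<eta>'" "\<And>N Z. N2 \<le> N \<Longrightarrow> 0 < N \<Longrightarrow> Z \<in> X N \<Longrightarrow> nr N (rho N Z) \<le> \<eta>' \<Longrightarrow>
      act N Z \<le> T * C0 + (norm V)\<^sup>2 \<Longrightarrow> \<exists>c. nearby N zs l \<epsilon> Z c \<and> \<bar>act N Z - Act (zs (fst c))\<bar> \<le> \<epsilon>"
    by (rule palais_smale[OF zs cover \<epsilon>(1)]) (rule that; assumption)
  define N where "N = Suc (N0 + N1 + N2)"
  have N: "0 < N" "N0 \<le> N" "N1 \<le> N" "N2 \<le> N" by (auto simp: N_def)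
  have nm: "nearby N zs l \<delta> Z c" if "nearby N zs l \<epsilon> Z c" for Z c
    using that \<epsilon>(2) unfolding nearby_def by (meson order_trans)
  show False
  proof (rule too_few_classes[OF N(1) l, where zs = zs and \<eta> = \<eta> and \<eta>' = "\<eta>' / 2" and \<delta> = \<delta> and \<epsilon> = \<epsilon>
        and \<beta> = "T * C0 + (norm V)\<^sup>2" and A = "\<lambda>j. Act (zs j)"])
    show "zs j (t + T) = zs j t + V" if "j < l" for j t using zs that by (simp add: sol_def)
    show "continuous_on UNIV (zs j)" if "j < l" for j by (rule sol_continuous[OF zs[rule_format, OF that]])
    show "\<exists>c. nearby N zs l \<delta> Z c \<and> \<bar>act N Z - Act (zs (fst c))\<bar> \<le> \<epsilon>"
      if "Z \<in> X N" "nr N (rho N Z) \<le> 2 * (\<eta>' / 2)" "act N Z \<le> T * C0 + (norm V)\<^sup>2" for Z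
    proof -
      have "nr N (rho N Z) \<le> \<eta>'" using that(2) by simp
      then show ?thesis using \<eta>'(2)[OF N(4,1) that(1) _ that(3)] nm by meson
    qed
    show "\<exists>c. nearby N zs l \<delta> Z c"
      if "Z \<in> X N" "nr N (rho N Z) < \<eta>" "act N Z \<le> T * C0 + (norm V)\<^sup>2" for Z
      using \<eta>(2)[OF N(3,1) that(1) _ that(3)] that(2) by (meson less_imp_le)
    show "c = c'" if "Z \<in> X N" "nearby N zs l (2 * \<delta>) Z c" "nearby N zs l (2 * \<delta>) Z c'" for Z c c'
      by (rule \<delta>(2)[OF N(2,1) that])
  qed (use \<eta> \<eta>' \<delta> \<epsilon> in auto)
qed

end

section \<open>Truncation of the Hamiltonian\<close>

text \<open>The normalized antiderivative of max 0 (u (1 - u)). One continuous derivative suffices,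
  as the truncated Hamiltonian only has to be C1.\<close>

lemma smooth_step:
  obtains S S' :: "real \<Rightarrow> real" where "\<And>u. (S has_real_derivative S' u) (at u)" "continuous_on UNIV S'"
    "\<And>u. 0 \<le> S' u" "\<And>u. 0 \<le> S u" "\<And>u. S u \<le> 1" "\<And>u. u \<le> 0 \<Longrightarrow> S u = 0" "\<And>u. u \<le> 0 \<Longrightarrow> S' u = 0"
    "\<And>u. 1 \<le> u \<Longrightarrow> S u = 1" "\<And>u. 1 \<le> u \<Longrightarrow> S' u = 0"
proof -
  define g :: "real \<Rightarrow> real" where "g u = max 0 (u * (1 - u))" for u
  have cg: "continuous_on UNIV g" unfolding g_def by (intro continuous_intros)
  have g0: "0 \<le> g u" for u by (simp add: g_def)
  have gz: "g u = 0" if "u \<le> 0 \<or> 1 \<le> u" for u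
  proof -
    have "u * (1 - u) \<le> 0" using that by (auto simp: mult_le_0_iff)
    then show ?thesis by (simp add: g_def)
  qed
  have "\<exists>F. \<forall>x. -\<infinity> < ereal x \<longrightarrow> ereal x < \<infinity> \<longrightarrow> (F has_vector_derivative g x) (at x)"
    by (rule einterval_antiderivative) (use cg in \<open>auto simp: continuous_on_eq_continuous_at\<close>)
  then obtain F where F: "\<And>x. (F has_real_derivative g x) (at x)"
    by (auto simp: has_real_derivative_iff_has_vector_derivative)
  have mono: "F x \<le> F y" if "x \<le> y" for x y
    by (rule DERIV_nonneg_imp_nondecreasing[OF that]) (use F g0 in blast)
  have lo: "F x = F 0" if "x \<le> 0" for x
  proof (rule antisym[OF mono[OF that]])
    show "F 0 \<le> F x" by (rule DERIV_nonpos_imp_nonincreasing[OF that]) (use F gz in \<open>metis order_refl\<close>)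
  qed
  have hi: "F x = F 1" if "1 \<le> x" for x
  proof (rule antisym[OF _ mono[OF that]])
    show "F x \<le> F 1" by (rule DERIV_nonpos_imp_nonincreasing[OF that]) (use F gz in \<open>metis order_refl\<close>)
  qed
  have lt: "F 0 < F 1"
  proof -
    obtain x where "0 < x" "x < 1" "F 1 - F 0 = (1 - 0) * g x" using MVT2[of 0 1 F g] F by auto
    moreover have "0 < g x" using calculation by (simp add: g_def)
    ultimately show ?thesis by simp
  qed
  define w where "w = F 1 - F 0"
  have w: "0 < w" using lt by (simp add: w_def)
  show thesis
  proof (rule that[of "\<lambda>u. (F u - F 0) / w" "\<lambda>u. g u / w"])
    show "((\<lambda>u. (F u - F 0) / w) has_real_derivative g u / w) (at u)" for u
      using w by (auto intro!: derivative_eq_intros F)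
    show "continuous_on UNIV (\<lambda>u. g u / w)" using w by (intro continuous_on_divide cg continuous_on_const) auto
    show "0 \<le> (F u - F 0) / w" for u using w mono[of 0 u] lo[of u] by (cases "0 \<le> u") auto
    show "(F u - F 0) / w \<le> 1" for u
      using w mono[of u 1] hi[of u] by (cases "u \<le> 1") (auto simp: divide_le_eq w_def)
    show "0 \<le> g u / w" for u using w g0 by simp
    show "(F u - F 0) / w = 0" "g u / w = 0" if "u \<le> 0" for u using lo[OF that] gz[of u] that by simp_all
    show "(F u - F 0) / w = 1" "g u / w = 0" if "1 \<le> u" for u using hi[OF that] gz[of u] that w by (simp_all add: w_def)
  qed
qed

text \<open>The same map as \<open>Jm\<close>, stated without the truncated data, because solutions
  of the original and of the truncated system are to be compared.\<close>

definition JM :: "'d set \<Rightarrow> ('d \<Rightarrow> 'd) \<Rightarrow> real ^ 'd \<Rightarrow> real ^ 'd::finite" where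
  "JM Mom cj v = (\<chi> c. if c \<in> Mom then - v $ cj c else v $ cj c)"

section \<open>Compact cells modulo the lattice\<close>

lemma bounded_linear_proj_on: "bounded_linear (proj_on P)"
  by (rule linear_conv_bounded_linear[THEN iffD1]) (auto simp: linear_iff vec_eq_iff)

lemma proj_on_inner: "proj_on P x \<bullet> y = (\<Sum>c\<in>P. x $ c * y $ c)"
proof -
  have "proj_on P x \<bullet> y = (\<Sum>c\<in>UNIV. if c \<in> P then x $ c * y $ c else 0)"
    unfolding inner_vec_def by (intro sum.cong) auto
  then show ?thesis by (simp add: sum.If_cases)
qed

text \<open>Lattice translations bring the periodic coordinates into [0, 1]; the margin of 1 on both
  sides keeps those of nearby points in range as well, as uniform continuity requires.\<close>

definition cell :: "'d set \<Rightarrow> real \<Rightarrow> (real ^ 'd::finite) set" where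
  "cell P B = {z. norm (proj_on P z) \<le> B \<and> (\<forall>c. c \<notin> P \<longrightarrow> - 1 \<le> z $ c \<and> z $ c \<le> 2)}"

lemma compact_cell: "compact (cell P B)"
proof -
  have "closed (cell P B)"
  proof -
    have "closed {z. norm (proj_on P z) \<le> B}"
      by (intro closed_Collect_le continuous_on_norm continuous_on_proj_on continuous_on_id continuous_on_const)
    moreover have "closed {z :: real ^ 'a. - 1 \<le> z $ c \<and> z $ c \<le> 2}" for c
      by (intro closed_Collect_conj closed_Collect_le continuous_on_component continuous_on_id continuous_on_const)
    then have "closed (\<Inter>c\<in>- P. {z :: real ^ 'a. - 1 \<le> z $ c \<and> z $ c \<le> 2})" by (intro closed_INT) auto
    ultimately have "closed ({z. norm (proj_on P z) \<le> B} \<inter> (\<Inter>c\<in>- P. {z. - 1 \<le> z $ c \<and> z $ c \<le> 2}))"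
      by (rule closed_Int)
    moreover have "cell P B = {z. norm (proj_on P z) \<le> B} \<inter> (\<Inter>c\<in>- P. {z. - 1 \<le> z $ c \<and> z $ c \<le> 2})"
      by (auto simp: cell_def)
    ultimately show ?thesis by simp
  qed
  moreover have "bounded (cell P B)"
    unfolding bounded_iff
  proof (intro exI ballI)
    fix z assume z: "z \<in> cell P B"
    have "norm z \<le> (\<Sum>c\<in>UNIV. \<bar>z $ c\<bar>)" by (rule norm_le_l1_cart)
    also have "\<dots> \<le> (\<Sum>c\<in>(UNIV::'a set). \<bar>B\<bar> + 2)"
    proof (rule sum_mono)
      fix c
      show "\<bar>z $ c\<bar> \<le> \<bar>B\<bar> + 2"
      proof (cases "c \<in> P")
        case True
        then show ?thesis using component_le_norm_cart[of "proj_on P z" c] z by (auto simp: cell_def)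
      next
        case False
        then show ?thesis using z by (auto simp: cell_def abs_le_iff)
      qed
    qed
    finally show "norm z \<le> (\<Sum>c\<in>(UNIV::'a set). \<bar>B\<bar> + 2)" .
  qed
  ultimately show ?thesis by (simp add: compact_eq_bounded_closed)
qed

lemma Lat_cell:
  obtains m where "m \<in> Lat P" "\<And>c. c \<notin> P \<Longrightarrow> 0 \<le> (z + m) $ c \<and> (z + m) $ c \<le> 1" "proj_on P (z + m) = proj_on P z"
proof -
  define m :: "real ^ 'a" where "m = (\<chi> c. if c \<in> P then 0 else - of_int \<lfloor>z $ c\<rfloor>)"
  have "0 \<le> x + - of_int \<lfloor>x\<rfloor> \<and> x + - of_int \<lfloor>x\<rfloor> \<le> 1" for x :: real by linarith
  then show thesis by (intro that[of m]) (auto simp: m_def Lat_def vec_eq_iff)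
qed

lemma periodic_bounded_on_cell:
  fixes f :: "real ^ 'd \<Rightarrow> 'b::real_normed_vector"
  assumes "continuous_on UNIV f" "\<And>m z. m \<in> Lat P \<Longrightarrow> f (z + m) = f z"
  obtains M where "0 \<le> M" "\<And>z. norm (proj_on P z) \<le> B \<Longrightarrow> norm (f z) \<le> M"
proof -
  have "compact (f ` cell P B)"
    by (rule compact_continuous_image[OF continuous_on_subset[OF assms(1)] compact_cell]) auto
  then obtain M where M: "\<And>z. z \<in> cell P B \<Longrightarrow> norm (f z) \<le> M"
    using compact_imp_bounded bounded_iff by (metis (no_types, lifting) image_eqI)
  have "norm (f z) \<le> max 0 M" if z: "norm (proj_on P z) \<le> B" for z
  proof -
    obtain m where m: "m \<in> Lat P" "\<And>c. c \<notin> P \<Longrightarrow> 0 \<le> (z + m) $ c \<and> (z + m) $ c \<le> 1" "proj_on P (z + m) = proj_on P z"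
      using Lat_cell[of P z] by metis
    have "z + m \<in> cell P B" using m(2,3) z unfolding cell_def mem_Collect_eq by fastforce
    then show ?thesis using M assms(2)[OF m(1), of z] by fastforce
  qed
  then show thesis by (intro that[of "max 0 M"]) auto
qed

section \<open>Superlinear growth of the Hamiltonian\<close>

locale ham =
  fixes P Mom :: "'d::finite set" and cj :: "'d \<Rightarrow> 'd" and H :: "real ^ 'd \<Rightarrow> real" and G :: "real ^ 'd \<Rightarrow> real ^ 'd"
    and r \<mu> a b s :: real
  assumes cj: "cj (cj c) = c" "cj c \<in> Mom \<longleftrightarrow> c \<notin> Mom"
    and PM: "P \<subseteq> Mom"
    and H: "(H has_derivative (\<lambda>h. h \<bullet> G z)) (at z)"
    and contG: "continuous_on UNIV G"
    and perH: "m \<in> Lat P \<Longrightarrow> H (z + m) = H z"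
    and r: "0 < r" and \<mu>: "1 < \<mu>"
    and AR: "r \<le> norm (proj_on P z) \<Longrightarrow> 0 < \<mu> * H z" "r \<le> norm (proj_on P z) \<Longrightarrow> \<mu> * H z \<le> proj_on P z \<bullet> G z"
    and ab: "0 < a" "0 < b" "0 < s"
    and growth: "norm (proj_on (- P) (G z)) \<le> a * norm (proj_on P z) powr s + b"
begin

lemma perG: "m \<in> Lat P \<Longrightarrow> G (z + m) = G z"
proof -
  assume m: "m \<in> Lat P"
  have "((\<lambda>x. H (x + m)) has_derivative (\<lambda>h. h \<bullet> G (z + m))) (at z)"
    by (rule has_derivative_compose[OF _ H, of "\<lambda>x. x + m" "\<lambda>h. h"]) (auto intro!: derivative_eq_intros)
  then have "(H has_derivative (\<lambda>h. h \<bullet> G (z + m))) (at z)" by (simp add: perH[OF m])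
  then have "(\<lambda>h. h \<bullet> G (z + m)) = (\<lambda>h. h \<bullet> G z)" using H has_derivative_unique by blast
  then have "h \<bullet> G (z + m) = h \<bullet> G z" for h by meson
  then show ?thesis by (metis inner_commute vector_eq_rdot)
qed

lemma contH: "continuous_on UNIV H"
  by (intro continuous_at_imp_continuous_on ballI has_derivative_continuous[OF H])

lemma H_pos: "r \<le> norm (proj_on P z) \<Longrightarrow> 0 < H z"
  using AR(1)[of z] \<mu> by (simp add: zero_less_mult_iff)

text \<open>Along the ray that scales only z_I, condition \<open>AR\<close> says that t^(-\<mu>) H
  is nondecreasing; periodicity and compactness give a positive lower bound on |z_I| = r.\<close>

lemma power_growth:
  obtains c where "0 < c" "\<And>z. r \<le> norm (proj_on P z) \<Longrightarrow> c * norm (proj_on P z) powr \<mu> \<le> H z"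
proof -
  define C where "C = cell P r \<inter> {z. r \<le> norm (proj_on P z)}"
  have "compact C" unfolding C_def
    by (intro compact_Int_closed compact_cell closed_Collect_le continuous_on_norm continuous_on_proj_on
        continuous_on_id continuous_on_const)
  have ex: "\<exists>m0>0. \<forall>z\<in>C. m0 \<le> H z"
  proof (cases "C = {}")
    case False
    then obtain z0 where "z0 \<in> C" "\<And>z. z \<in> C \<Longrightarrow> H z0 \<le> H z"
      using continuous_attains_inf[OF \<open>compact C\<close> False continuous_on_subset[OF contH]] by auto
    then show ?thesis using H_pos[of z0] by (auto simp: C_def)
  qed (auto intro: exI[of _ 1])
  then obtain m0 where m0: "0 < m0" "\<And>z. z \<in> C \<Longrightarrow> m0 \<le> H z" by blast
  have sphere: "m0 \<le> H z" if z: "norm (proj_on P z) = r" for z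
  proof -
    obtain m where m: "m \<in> Lat P" "\<And>c. c \<notin> P \<Longrightarrow> 0 \<le> (z + m) $ c \<and> (z + m) $ c \<le> 1" "proj_on P (z + m) = proj_on P z"
      using Lat_cell[of P z] by metis
    have "z + m \<in> C" using m(2,3) z unfolding C_def cell_def by fastforce
    then show ?thesis using m0(2) perH[OF m(1)] by metis
  qed
  show thesis
  proof (rule that[of "m0 / r powr \<mu>"])
    show "0 < m0 / r powr \<mu>" using m0 r by simp
    fix z assume z: "r \<le> norm (proj_on P z)"
    define x where "x = norm (proj_on P z)"
    have x: "0 < x" "r \<le> x" using z r by (auto simp: x_def)
    define p where "p = proj_on P z"
    define y where "y t = z + (t - 1) *\<^sub>R p" for t :: real
    have py: "proj_on P (y t) = t *\<^sub>R p" for t by (simp add: y_def p_def vec_eq_iff algebra_simps)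
    have "((\<lambda>t. H (y t) * t powr (- \<mu>)) has_real_derivative
        (p \<bullet> G (y t)) * t powr (- \<mu>) + H (y t) * (- \<mu> * t powr (- \<mu> - 1))) (at t)" if "0 < t" for t
    proof -
      have "(y has_derivative (\<lambda>h. h *\<^sub>R p)) (at t)" unfolding y_def by (auto intro!: derivative_eq_intros)
      from has_derivative_compose[OF this H] have d1: "((\<lambda>t. H (y t)) has_real_derivative p \<bullet> G (y t)) (at t)"
        by (simp add: has_field_derivative_def mult_commute_abs)
      have d2: "((\<lambda>t. t powr (- \<mu>)) has_real_derivative - \<mu> * t powr (- \<mu> - 1)) (at t)"
        using has_real_derivative_powr[OF that, of "- \<mu>"] by simp
      show ?thesis using DERIV_mult[OF d1 d2] by (simp add: algebra_simps)
    qed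
    note der = this
    have "H (y (r / x)) * (r / x) powr (- \<mu>) \<le> H (y 1) * 1 powr (- \<mu>)"
    proof (rule DERIV_nonneg_imp_nondecreasing[of "r / x" 1 "\<lambda>t. H (y t) * t powr (- \<mu>)"])
      show "r / x \<le> 1" using x by simp
      fix t assume t: "r / x \<le> t" "t \<le> 1"
      have "0 < r / x" using x r by simp
      then have t0: "0 < t" using t(1) by linarith
      have "norm (proj_on P (y t)) = t * x" using t0 by (simp add: py p_def x_def)
      then have "r \<le> norm (proj_on P (y t))" using t x by (simp add: divide_le_eq)
      then have "\<mu> * H (y t) \<le> t * (p \<bullet> G (y t))" using AR(2)[of "y t"] by (simp add: py)
      then have "t powr (- \<mu> - 1) * (\<mu> * H (y t)) \<le> t powr (- \<mu> - 1) * (t * (p \<bullet> G (y t)))"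
        by (intro mult_left_mono) auto
      moreover have "t powr (- \<mu>) = t powr (- \<mu> - 1) * t" using t0 by (simp add: powr_diff)
      ultimately have "0 \<le> (p \<bullet> G (y t)) * t powr (- \<mu>) + H (y t) * (- \<mu> * t powr (- \<mu> - 1))"
        by (simp add: algebra_simps)
      then show "\<exists>D. ((\<lambda>t. H (y t) * t powr (- \<mu>)) has_real_derivative D) (at t) \<and> 0 \<le> D"
        using der[OF t0] by blast
    qed
    moreover have "m0 \<le> H (y (r / x))" by (rule sphere) (use x r in \<open>simp add: py p_def x_def\<close>)
    then have "m0 * (r / x) powr (- \<mu>) \<le> H (y (r / x)) * (r / x) powr (- \<mu>)" by (intro mult_right_mono) auto
    moreover have "y 1 = z" by (simp add: y_def)
    moreover have "(r / x) powr (- \<mu>) = x powr \<mu> / r powr \<mu>"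
      using x r by (simp add: powr_minus powr_divide)
    ultimately show "m0 / r powr \<mu> * norm (proj_on P z) powr \<mu> \<le> H z" by (simp add: x_def)
  qed
qed

end

text \<open>\<open>S\<close> switches from \<open>H\<close> to a linear function of |z_I| between R
  and R + 1. The long inequality on \<open>R\<close> is contradicted by a solution of small action
  that leaves |z_I| \<le> R; the first condition on \<open>K\<close> puts the linear function above
  \<open>H\<close> in the transition zone.\<close>

locale trunc = ham P Mom cj H G r \<mu> a b s
  for P Mom :: "'d::finite set" and cj H G r \<mu> a b s +
  fixes V :: "real ^ 'd" and T :: real and i0 :: 'd and c C0 Mr R K Mh :: real and S S' :: "real \<Rightarrow> real"
  assumes T: "0 < T" and V: "V $ j \<noteq> 0 \<Longrightarrow> cj j \<in> P" and VL: "V \<in> Lat P" and i0: "V $ i0 \<noteq> 0"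
    and c: "0 < c" "r \<le> norm (proj_on P z) \<Longrightarrow> c * norm (proj_on P z) powr \<mu> \<le> H z"
    and Mr: "norm (proj_on P z) \<le> r \<Longrightarrow> \<bar>H z\<bar> \<le> Mr"
    and C0: "norm V / T * norm (proj_on P z) - C0 \<le> H z"
    and R: "r \<le> R" "\<mu> < R + 1" "Mr < c * R powr \<mu>"
      "T * C0 + (norm V)\<^sup>2 + real CARD('d) * T\<^sup>2 * (a * (R + 1) powr s + b)\<^sup>2 < (\<mu> - 1) * (c * R powr \<mu>) * T"
    and Mh: "norm (proj_on P z) \<le> R + 1 \<Longrightarrow> \<bar>H z\<bar> \<le> Mh"
    and K: "Mh \<le> K * ((R + 1) / \<mu> - 1)" "norm V < K * T" "0 < K"
    and S: "\<And>u. (S has_real_derivative S' u) (at u)" "continuous_on UNIV S'"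
      "\<And>u. 0 \<le> S' u" "\<And>u. 0 \<le> S u" "\<And>u. S u \<le> 1" "\<And>u. u \<le> 0 \<Longrightarrow> S u = 0" "\<And>u. u \<le> 0 \<Longrightarrow> S' u = 0"
      "\<And>u. 1 \<le> u \<Longrightarrow> S u = 1" "\<And>u. 1 \<le> u \<Longrightarrow> S' u = 0"
begin

text \<open>With this constant \<mu> (K x - L) \<le> K x holds up to x = R + 1, with equality there,
  so condition \<open>AR\<close> survives the transition. At x = R the linear function equals K ((R
  + 1) / \<mu> - 1), which is at least \<open>Mh\<close>.\<close>

definition L :: real where "L = (1 - 1 / \<mu>) * K * (R + 1)"
abbreviation nP :: "real ^ 'd \<Rightarrow> real" where "nP z \<equiv> norm (proj_on P z)"

definition Ht :: "real ^ 'd \<Rightarrow> real" where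
  "Ht z = (1 - S (nP z - R)) * H z + S (nP z - R) * (K * nP z - L)"

definition Gt :: "real ^ 'd \<Rightarrow> real ^ 'd" where
  "Gt z = (1 - S (nP z - R)) *\<^sub>R G z +
     ((S' (nP z - R) * (K * nP z - L - H z) + S (nP z - R) * K) / nP z) *\<^sub>R proj_on P z"

lemma R_pos: "0 < R"
  using R(1) r by simp

lemma near: "nP z \<le> R \<Longrightarrow> Ht z = H z" "nP z \<le> R \<Longrightarrow> Gt z = G z"
  using S(6,7)[of "nP z - R"] by (simp_all add: Ht_def Gt_def)

lemma far: "R + 1 \<le> nP z \<Longrightarrow> Ht z = K * nP z - L" "R + 1 \<le> nP z \<Longrightarrow> Gt z = (K / nP z) *\<^sub>R proj_on P z"
  using S(8,9)[of "nP z - R"] by (simp_all add: Ht_def Gt_def)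

lemma line_ge: "R \<le> x \<Longrightarrow> Mh \<le> K * x - L"
proof -
  assume "R \<le> x"
  then have "K * R \<le> K * x" using K(3) by simp
  moreover have "K * R - L = K * ((R + 1) / \<mu> - 1)" using \<mu> by (simp add: L_def field_simps)
  ultimately show ?thesis using K(1) by linarith
qed

lemma gap: "nP z \<le> R + 1 \<Longrightarrow> R \<le> nP z \<Longrightarrow> 0 \<le> K * nP z - L - H z"
  using line_ge[of "nP z"] Mh[of z] by linarith

lemma Ht_ge: "nP z \<le> R + 1 \<Longrightarrow> H z \<le> Ht z"
proof (cases "nP z \<le> R")
  case False
  assume "nP z \<le> R + 1"
  then have "0 \<le> S (nP z - R) * (K * nP z - L - H z)" using gap[of z] False S(4) by (intro mult_nonneg_nonneg) auto
  then show ?thesis by (simp add: Ht_def algebra_simps)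
qed (simp add: near)

lemma proj_on_translate: "m \<in> Lat P \<Longrightarrow> proj_on P (z + m) = proj_on P z"
  by (simp add: Lat_def vec_eq_iff)

lemma per_t: "m \<in> Lat P \<Longrightarrow> Ht (z + m) = Ht z" "m \<in> Lat P \<Longrightarrow> Gt (z + m) = Gt z"
  by (simp_all add: Ht_def Gt_def proj_on_translate perH perG)

lemma Ht_derivative: "(Ht has_derivative (\<lambda>h. h \<bullet> Gt z)) (at z)"
proof (cases "nP z < R")
  case True
  have "open {y. nP y < R}"
    by (intro open_Collect_less continuous_on_norm continuous_on_proj_on continuous_on_id continuous_on_const)
  then have "(Ht has_derivative (\<lambda>h. h \<bullet> G z)) (at z)"
    by (rule has_derivative_transform_within_open[OF H]) (use True in \<open>auto simp: near\<close>)
  then show ?thesis using True near(2)[of z] by simp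
next
  case False
  define p where "p = proj_on P z"
  define x where "x = norm p"
  have x: "0 < x" using False R_pos unfolding x_def p_def by linarith
  have hp: "proj_on P h \<bullet> sgn p = h \<bullet> p / x" for h
  proof -
    have "p \<bullet> proj_on P h = h \<bullet> p"
      unfolding p_def using proj_on_inner[of P h "proj_on P z"] proj_on_inner[of P z h]
      by (simp add: inner_commute mult.commute)
    then show ?thesis by (simp add: sgn_div_norm x_def divide_inverse mult.commute inner_commute)
  qed
  have dx: "((\<lambda>z. nP z) has_derivative (\<lambda>h. h \<bullet> p / x)) (at z)"
  proof -
    have "(norm has_derivative (\<lambda>h. h \<bullet> sgn p)) (at p)"
      using x by (intro has_derivative_norm) (auto simp: x_def)
    from has_derivative_compose[OF bounded_linear_imp_has_derivative[OF bounded_linear_proj_on] this[unfolded p_def]]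
    show ?thesis by (simp add: hp[unfolded p_def] p_def)
  qed
  have dS: "((\<lambda>z. S (nP z - R)) has_derivative (\<lambda>h. S' (x - R) * (h \<bullet> p / x))) (at z)"
  proof -
    have "((\<lambda>z. nP z - R) has_derivative (\<lambda>h. h \<bullet> p / x)) (at z)" by (auto intro!: derivative_eq_intros dx)
    from has_derivative_compose[OF this S(1)[of "nP z - R", unfolded has_field_derivative_def]]
    show ?thesis by (simp add: x_def p_def)
  qed
  have "(Ht has_derivative (\<lambda>h. (1 - S (x - R)) * (h \<bullet> G z) - S' (x - R) * (h \<bullet> p / x) * H z
      + (S (x - R) * (K * (h \<bullet> p / x)) + S' (x - R) * (h \<bullet> p / x) * (K * x - L)))) (at z)"
    unfolding Ht_def
    by (rule derivative_eq_intros dS dx H refl)+ (simp add: x_def p_def algebra_simps)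
  moreover have "(\<lambda>h. (1 - S (x - R)) * (h \<bullet> G z) - S' (x - R) * (h \<bullet> p / x) * H z
      + (S (x - R) * (K * (h \<bullet> p / x)) + S' (x - R) * (h \<bullet> p / x) * (K * x - L))) = (\<lambda>h. h \<bullet> Gt z)"
    using x by (simp add: Gt_def x_def[symmetric] p_def[symmetric] inner_add_right fun_eq_iff add_divide_distrib
        diff_divide_distrib algebra_simps)
  ultimately show ?thesis by simp
qed

lemma Gt_cont: "continuous_on UNIV Gt"
proof -
  define A where "A = {z. 0 < nP z}"
  define B where "B = {z. nP z < R}"
  have cn: "continuous_on X (\<lambda>z. nP z)" for X
    by (intro continuous_on_norm continuous_on_proj_on continuous_on_id)
  have "open A" "open B" unfolding A_def B_def by (intro open_Collect_less cn continuous_on_const)+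
  moreover have "continuous_on A Gt"
  proof -
    have cS: "continuous_on X (\<lambda>z. S (nP z - R))" for X
    proof (rule continuous_on_compose2[of UNIV S])
      show "continuous_on UNIV S" using S(1) by (meson DERIV_isCont continuous_at_imp_continuous_on)
    qed (auto intro: continuous_on_diff cn)
    have cS': "continuous_on X (\<lambda>z. S' (nP z - R))" for X
      by (rule continuous_on_compose2[OF S(2)]) (auto intro: continuous_on_diff cn)
    have cH: "continuous_on X (\<lambda>z. H z)" "continuous_on X (\<lambda>z. G z)" for X
      using continuous_on_subset[OF contH] continuous_on_subset[OF contG] by auto
    show ?thesis unfolding Gt_def
      by (intro continuous_on_add continuous_on_scaleR continuous_on_diff continuous_on_const cS cS' cH
          continuous_on_divide continuous_on_mult cn continuous_on_proj_on continuous_on_id) (auto simp: A_def)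
  qed
  moreover have "continuous_on B Gt"
    by (rule continuous_on_eq[OF continuous_on_subset[OF contG]]) (auto simp: B_def near)
  ultimately have "continuous_on (A \<union> B) Gt" by (rule continuous_on_open_Un)
  moreover have "A \<union> B = UNIV" using R_pos by (auto simp: A_def B_def)
  ultimately show ?thesis by simp
qed

lemma far_diff:
  assumes "R + 1 \<le> nP x" "R + 1 \<le> nP y"
  shows "norm (Gt x - Gt y) \<le> 2 * K / (R + 1) * norm (x - y)"
proof -
  have pos: "0 < nP x" "0 < nP y" using assms R_pos by linarith+
  have "norm (Gt x - Gt y) = K * norm (sgn (proj_on P x) - sgn (proj_on P y))"
  proof -
    have "Gt x - Gt y = K *\<^sub>R (sgn (proj_on P x) - sgn (proj_on P y))"
      using far(2)[OF assms(1)] far(2)[OF assms(2)] by (simp add: sgn_div_norm scaleR_right_diff_distrib divide_inverse)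
    then show ?thesis using K(3) by simp
  qed
  also have "\<dots> \<le> K * (2 / nP y * norm (proj_on P x - proj_on P y))"
    using pos K(3) by (intro mult_left_mono norm_sgn_diff_le) auto
  also have "\<dots> \<le> K * (2 / (R + 1) * norm (x - y))"
  proof -
    have "proj_on P x - proj_on P y = proj_on P (x - y)" by (simp add: vec_eq_iff)
    then have "norm (proj_on P x - proj_on P y) \<le> norm (x - y)" using norm_proj_on_le by metis
    then show ?thesis using assms(2) R_pos pos K(3) by (intro mult_left_mono mult_mono divide_left_mono) auto
  qed
  finally show ?thesis by (simp add: mult_ac)
qed

text \<open>For bounded z_I a compact cell modulo the lattice is enough, and far out
  \<open>far_diff\<close> gives an explicit bound; R + 2 leaves room for two points at distance at
  most 1.\<close>

lemma Gt_unif: "uniformly_continuous_on UNIV Gt"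
  unfolding uniformly_continuous_on_def
proof (intro allI impI)
  fix \<epsilon> :: real assume \<epsilon>: "0 < \<epsilon>"
  have uc: "uniformly_continuous_on (cell P (R + 2)) Gt"
    by (rule compact_uniformly_continuous[OF continuous_on_subset[OF Gt_cont] compact_cell]) auto
  obtain d where d: "0 < d" "\<And>x y. x \<in> cell P (R + 2) \<Longrightarrow> y \<in> cell P (R + 2) \<Longrightarrow> dist y x < d \<Longrightarrow> dist (Gt y) (Gt x) < \<epsilon>"
    using uc[unfolded uniformly_continuous_on_def, rule_format, OF \<epsilon>] by auto
  define \<delta> where "\<delta> = min (min d 1) (\<epsilon> * (R + 1) / (2 * K))"
  have \<delta>: "0 < \<delta>" "\<delta> \<le> d" "\<delta> \<le> 1" "\<delta> \<le> \<epsilon> * (R + 1) / (2 * K)"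
    using d(1) \<epsilon> K(3) R_pos by (auto simp: \<delta>_def)
  have "dist (Gt y) (Gt x) < \<epsilon>" if xy: "dist y x < \<delta>" for x y
  proof (cases "R + 1 \<le> nP x \<and> R + 1 \<le> nP y")
    case True
    then have "norm (Gt y - Gt x) \<le> 2 * K / (R + 1) * norm (y - x)" by (intro far_diff) auto
    also have "\<dots> < 2 * K / (R + 1) * (\<epsilon> * (R + 1) / (2 * K))"
      using xy \<delta>(4) K(3) R_pos by (intro mult_strict_left_mono) (auto simp: dist_norm)
    also have "\<dots> = \<epsilon>" using K(3) R_pos by simp
    finally show ?thesis by (simp add: dist_norm)
  next
    case False
    have "proj_on P y - proj_on P x = proj_on P (y - x)" by (simp add: vec_eq_iff)
    then have "norm (proj_on P y - proj_on P x) \<le> norm (y - x)" using norm_proj_on_le by metis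
    moreover have "norm (y - x) \<le> 1" using xy \<delta>(3) by (simp add: dist_norm)
    ultimately have n: "\<bar>nP y - nP x\<bar> \<le> 1" using norm_triangle_ineq3[of "proj_on P y" "proj_on P x"] by linarith
    then have le: "nP x \<le> R + 2" "nP y \<le> R + 2" using False by linarith+
    obtain m where m: "m \<in> Lat P" "\<And>c. c \<notin> P \<Longrightarrow> 0 \<le> (x + m) $ c \<and> (x + m) $ c \<le> 1" "proj_on P (x + m) = proj_on P x"
      using Lat_cell[of P x] by metis
    have yc: "\<bar>y $ c - x $ c\<bar> \<le> 1" for c
      using component_le_norm_cart[of "y - x" c] \<open>norm (y - x) \<le> 1\<close> by simp
    have "x + m \<in> cell P (R + 2)" using m(2,3) le(1) unfolding cell_def mem_Collect_eq by fastforce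
    moreover have "y + m \<in> cell P (R + 2)"
    proof -
      have "- 1 \<le> (y + m) $ c \<and> (y + m) $ c \<le> 2" if "c \<notin> P" for c
        using m(2)[OF that] yc[of c] by (simp add: abs_le_iff)
      then show ?thesis using le(2) by (simp add: cell_def proj_on_translate[OF m(1)])
    qed
    ultimately have "dist (Gt (y + m)) (Gt (x + m)) < \<epsilon>" by (rule d(2)) (use xy \<delta>(2) in simp)
    then show ?thesis by (simp add: per_t(2)[OF m(1)])
  qed
  then show "\<exists>d>0. \<forall>x\<in>UNIV. \<forall>x'\<in>UNIV. dist x' x < d \<longrightarrow> dist (Gt x') (Gt x) < \<epsilon>" using \<delta>(1) by blast
qed

lemma Gt_bounded: "\<exists>CG. \<forall>z. norm (Gt z) \<le> CG"
proof -
  obtain M where M: "\<And>z. nP z \<le> R + 1 \<Longrightarrow> norm (Gt z) \<le> M"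
    using periodic_bounded_on_cell[where f = Gt and P = P and B = "R + 1", OF Gt_cont per_t(2)] by metis
  have "norm (Gt z) \<le> max M K" for z
  proof (cases "nP z \<le> R + 1")
    case False
    then have "0 < nP z" "R + 1 \<le> nP z" using R_pos by linarith+
    then have "norm (Gt z) = K" using far(2)[of z] K(3) by simp
    then show ?thesis by simp
  qed (use M in \<open>auto simp: le_max_iff_disj\<close>)
  then show ?thesis by blast
qed

definition C1 :: real where "C1 = Mh + 2 * (K * (R + 1)) + \<bar>L\<bar>"

lemma Ht_abs: "nP z \<le> R + 1 \<Longrightarrow> \<bar>Ht z\<bar> \<le> Mh + K * (R + 1) + \<bar>L\<bar>"
proof -
  assume z: "nP z \<le> R + 1"
  define w where "w = S (nP z - R)"
  have w: "0 \<le> w" "w \<le> 1" using S(4,5) by (auto simp: w_def)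
  have f1: "\<bar>(1 - w) * H z\<bar> \<le> 1 * Mh" unfolding abs_mult using w Mh[OF z] by (intro mult_mono) auto
  have f2: "\<bar>w * (K * nP z - L)\<bar> \<le> 1 * (K * (R + 1) + \<bar>L\<bar>)"
  proof -
    have "0 \<le> K * nP z" "K * nP z \<le> K * (R + 1)" using K(3) z by auto
    then have "\<bar>K * nP z - L\<bar> \<le> K * (R + 1) + \<bar>L\<bar>" by linarith
    then show ?thesis unfolding abs_mult using w by (intro mult_mono) auto
  qed
  show ?thesis
    unfolding Ht_def w_def[symmetric]
    by (rule order_trans[OF abs_triangle_ineq order_trans[OF add_mono[OF f1 f2]]]) simp
qed

text \<open>Beyond R + 1 the comparison point has |z_I| = R + 1 and the same other coordinates.
  There the linear function is at least \<open>Mh\<close>, and from there on its slope K beats |V| /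
  T.\<close>

lemma low0_t: "norm V / T * nP z - C0 \<le> Ht z"
proof (cases "nP z \<le> R + 1")
  case True
  then show ?thesis using C0[of z] Ht_ge[of z] by linarith
next
  case False
  define x where "x = nP z"
  have x: "R + 1 < x" using False by (simp add: x_def)
  define y where "y = z + ((R + 1) / x - 1) *\<^sub>R proj_on P z"
  have "proj_on P y = ((R + 1) / x) *\<^sub>R proj_on P z" by (simp add: y_def vec_eq_iff algebra_simps)
  then have ny: "nP y = R + 1" using x R_pos by (simp add: x_def[symmetric])
  have "norm V / T * (R + 1) - C0 \<le> Mh" using C0[of y] Mh[of y] ny by simp
  moreover have "Mh \<le> K * (R + 1) - L" by (rule line_ge) simp
  moreover have "norm V / T \<le> K" using K(2) T by (simp add: divide_le_eq)
  then have "norm V / T * (x - (R + 1)) \<le> K * (x - (R + 1))" using x by (intro mult_right_mono) auto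
  ultimately show ?thesis using far(1)[of z] x by (simp add: x_def[symmetric] algebra_simps)
qed

lemma low1_t: "K * nP z - C1 \<le> Ht z" and up_t: "Ht z \<le> K * nP z + C1"
proof -
  have "proj_on P 0 = 0" by (simp add: vec_eq_iff)
  then have "\<bar>H 0\<bar> \<le> Mh" using R_pos by (intro Mh) simp
  then have Mh0: "0 \<le> Mh" by linarith
  have "0 \<le> K * nP z" "0 \<le> K * (R + 1)" using K(3) R_pos by auto
  moreover have "K * nP z \<le> K * (R + 1)" if "nP z \<le> R + 1" using K(3) that by simp
  ultimately show "K * nP z - C1 \<le> Ht z" "Ht z \<le> K * nP z + C1"
    using Ht_abs[of z] far(1)[of z] Mh0 unfolding C1_def by (cases "nP z \<le> R + 1"; linarith)+
qed

text \<open>Three contributions: condition \<open>AR\<close> for \<open>H\<close>; the derivative of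
  the cut-off, nonnegative because the linear function lies above \<open>H\<close>; and the linear
  part, by the choice of \<open>L\<close>.\<close>

lemma AR_t:
  assumes z: "r \<le> nP z" "nP z \<le> R + 1"
  shows "\<mu> * Ht z \<le> proj_on P z \<bullet> Gt z"
proof -
  define x where "x = nP z"
  define w where "w = S (x - R)"
  have w: "0 \<le> w" "w \<le> 1" using S(4,5) by (auto simp: w_def)
  have x: "0 < x" using z r unfolding x_def by linarith
  have pp: "proj_on P z \<bullet> proj_on P z = x * x" by (simp add: x_def dot_square_norm power2_eq_square)
  have "proj_on P z \<bullet> Gt z = (1 - w) * (proj_on P z \<bullet> G z) +
      ((S' (x - R) * (K * x - L - H z) + w * K) / x) * (proj_on P z \<bullet> proj_on P z)"
    by (simp only: Gt_def x_def w_def inner_add_right inner_scaleR_right)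
  also have "((S' (x - R) * (K * x - L - H z) + w * K) / x) * (proj_on P z \<bullet> proj_on P z) =
      (S' (x - R) * (K * x - L - H z) + w * K) * x"
    unfolding pp using x by simp
  finally have eq: "proj_on P z \<bullet> Gt z = (1 - w) * (proj_on P z \<bullet> G z) + S' (x - R) * (K * x - L - H z) * x + w * (K * x)"
    by (simp add: distrib_right)
  have 1: "(1 - w) * (\<mu> * H z) \<le> (1 - w) * (proj_on P z \<bullet> G z)" using AR(2)[OF z(1)] w by (intro mult_left_mono) auto
  have 2: "0 \<le> S' (x - R) * (K * x - L - H z) * x"
  proof (cases "R \<le> x")
    case True
    then show ?thesis using gap[of z] z S(3) x by (auto simp: x_def)
  qed (use S(7)[of "x - R"] in simp)
  have "\<mu> * (K * x - L) \<le> K * x"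
  proof -
    have "\<mu> * L = (\<mu> - 1) * (K * (R + 1))" using \<mu> by (simp add: L_def field_simps)
    moreover have "(\<mu> - 1) * (K * x) \<le> (\<mu> - 1) * (K * (R + 1))"
      using \<mu> K(3) z(2) by (intro mult_left_mono) (auto simp: x_def)
    ultimately show ?thesis by (simp add: algebra_simps)
  qed
  then have "w * (\<mu> * (K * x - L)) \<le> w * (K * x)" using w by (intro mult_left_mono) auto
  then have "\<mu> * ((1 - w) * H z + w * (K * x - L)) \<le> proj_on P z \<bullet> Gt z"
    unfolding eq using 1 2 by (simp add: algebra_simps)
  then show ?thesis by (simp add: Ht_def w_def x_def)
qed

text \<open>The cut-off depends on z_I only, so the other components of the gradient are merely
  damped.\<close>

lemma growth_t:
  assumes z: "nP z \<le> R + 1" and j: "j \<notin> P"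
  shows "\<bar>Gt z $ j\<bar> \<le> a * (R + 1) powr s + b"
proof -
  define w where "w = S (nP z - R)"
  have w: "0 \<le> w" "w \<le> 1" using S(4,5) by (auto simp: w_def)
  have "\<bar>Gt z $ j\<bar> = (1 - w) * \<bar>proj_on (- P) (G z) $ j\<bar>" using j w by (simp add: Gt_def w_def abs_mult)
  also have "\<dots> \<le> 1 * norm (proj_on (- P) (G z))"
    using w component_le_norm_cart[of "proj_on (- P) (G z)" j] by (intro mult_mono) auto
  also have "\<dots> \<le> a * nP z powr s + b" using growth[of z] by simp
  also have "\<dots> \<le> a * (R + 1) powr s + b"
    using z ab by (intro add_right_mono mult_left_mono powr_mono2) auto
  finally show ?thesis .
qed

end

section \<open>A priori bounds for solutions\<close>

definition hsol :: "'d set \<Rightarrow> ('d \<Rightarrow> 'd) \<Rightarrow> (real ^ 'd \<Rightarrow> real ^ 'd) \<Rightarrow> real ^ 'd \<Rightarrow> real \<Rightarrow> (real \<Rightarrow> real ^ 'd::finite) \<Rightarrow> bool" where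
  "hsol Mom cj G V T z \<longleftrightarrow> (\<forall>t. z (t + T) = z t + V) \<and> (\<forall>t. (z has_vector_derivative JM Mom cj (G (z t))) (at t))"

context trunc
begin

lemma dsys_cpt_trunc: "(\<And>z. norm (Gt z) \<le> CG) \<Longrightarrow> dsys_cpt P Mom cj V T Ht Gt CG i0 K C0 C1 (R + 1)"
proof unfold_locales
  show "0 < T" by (rule T)
  show "cj (cj j) = j" "(cj j \<in> Mom) = (j \<notin> Mom)" for j using cj by auto
  show "P \<subseteq> Mom" by (rule PM)
  show "V $ j \<noteq> 0 \<Longrightarrow> cj j \<in> P" for j by (rule V)
  show "(Ht has_derivative (\<lambda>h. h \<bullet> Gt z)) (at z)" for z by (rule Ht_derivative)
  show "uniformly_continuous_on UNIV Gt" by (rule Gt_unif)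
  show "V $ i0 \<noteq> 0" "V \<in> Lat P" by (rule i0, rule VL)
  show "m \<in> Lat P \<Longrightarrow> Ht (z + m) = Ht z" "m \<in> Lat P \<Longrightarrow> Gt (z + m) = Gt z" for m z by (rule per_t; assumption)+
  show "norm V / T * nP z - C0 \<le> Ht z" "K * nP z - C1 \<le> Ht z" "Ht z \<le> K * nP z + C1" for z
    by (rule low0_t, rule low1_t, rule up_t)
  show "norm V < K * T" by (rule K)
  show "0 < R + 1" using R_pos by simp
  show "R + 1 \<le> nP z \<Longrightarrow> Gt z = (K / nP z) *\<^sub>R proj_on P z" for z by (rule far)
qed

lemma JM_inner: "JM Mom cj v \<bullet> v = 0"
proof -
  have "JM Mom cj v \<bullet> v = (\<Sum>j\<in>Mom \<union> - Mom. JM Mom cj v $ j * v $ j)" by (simp add: inner_vec_def)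
  also have "\<dots> = (\<Sum>j\<in>Mom. JM Mom cj v $ j * v $ j) + (\<Sum>j\<in>- Mom. JM Mom cj v $ j * v $ j)"
    by (rule sum.union_disjoint) auto
  also have "\<dots> = (\<Sum>j\<in>Mom. - (v $ cj j * v $ j)) + (\<Sum>j\<in>- Mom. v $ cj j * v $ j)"
    by (simp add: JM_def)
  also have "(\<Sum>j\<in>- Mom. v $ cj j * v $ j) = (\<Sum>j\<in>Mom. v $ cj j * v $ j)"
    by (rule sum.reindex_bij_witness[of _ cj cj]) (auto simp: cj mult.commute)
  finally show ?thesis by (simp add: sum_negf)
qed

lemma energy:
  assumes "hsol Mom cj Gt V T z"
  shows "Ht (z t) = Ht (z 0)"
proof -
  have "((\<lambda>t. Ht (z t)) has_real_derivative 0) (at t)" for t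
  proof -
    have "(z has_derivative (\<lambda>h. h *\<^sub>R JM Mom cj (Gt (z t)))) (at t)"
      using assms by (simp add: hsol_def has_vector_derivative_def)
    from has_derivative_compose[OF this Ht_derivative] show ?thesis
      by (simp add: has_field_derivative_def JM_inner lambda_zero)
  qed
  then show ?thesis using DERIV_isconst_all[of "\<lambda>t. Ht (z t)"] by blast
qed

lemma component_derivative:
  assumes "hsol Mom cj G' V T z"
  shows "((\<lambda>t. z t $ j) has_real_derivative (if j \<in> Mom then - G' (z t) $ cj j else G' (z t) $ cj j)) (at t)"
proof -
  have "(z has_derivative (\<lambda>h. h *\<^sub>R JM Mom cj (G' (z t)))) (at t)"
    using assms by (simp add: hsol_def has_vector_derivative_def)
  from bounded_linear.has_derivative[OF bounded_linear_vec_nth this, of j] show ?thesis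
    by (simp add: has_field_derivative_def JM_def mult_commute_abs split: if_splits)
qed

text \<open>On |z_I| \<le> R + 1 the energy is at most K (R + 1) - L, so an orbit that is ever
  beyond this radius always is. There z_I is constant and the conjugate positions move with constant
  velocity of norm K, so |V| = K T, contrary to the choice of K.\<close>

lemma confined:
  assumes sol: "hsol Mom cj Gt V T z"
  shows "nP (z t) \<le> R + 1"
proof (rule ccontr)
  assume out: "\<not> nP (z t) \<le> R + 1"
  define h0 where "h0 = Ht (z t)"
  have en: "Ht (z u) = h0" for u using energy[OF sol, of u] energy[OF sol, of t] by (simp add: h0_def)
  have h0: "K * (R + 1) - L < h0" using far(1)[of "z t"] out K(3) by (simp add: h0_def)
  have all_out: "R + 1 < nP (z u)" for u
  proof (rule ccontr)
    assume "\<not> R + 1 < nP (z u)"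
    then have le: "nP (z u) \<le> R + 1" by simp
    define w where "w = S (nP (z u) - R)"
    have w: "0 \<le> w" "w \<le> 1" using S(4,5) by (auto simp: w_def)
    have "H (z u) \<le> K * (R + 1) - L" using Mh[OF le] line_ge[of "R + 1"] by linarith
    moreover have "K * nP (z u) - L \<le> K * (R + 1) - L" using K(3) le by simp
    ultimately have "(1 - w) * H (z u) + w * (K * nP (z u) - L) \<le> (1 - w) * (K * (R + 1) - L) + w * (K * (R + 1) - L)"
      using w by (intro add_mono mult_left_mono) auto
    then have "Ht (z u) \<le> K * (R + 1) - L" by (simp add: Ht_def w_def[symmetric] algebra_simps)
    then show False using en h0 by simp
  qed
  have Gu: "Gt (z u) = (K / nP (z u)) *\<^sub>R proj_on P (z u)" for u using far(2)[of "z u"] all_out[of u] by simp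
  have nconst: "nP (z u) = nP (z 0)" for u
  proof -
    have "K * nP (z u) = K * nP (z 0)"
      using en[of u] en[of 0] far(1)[of "z u"] far(1)[of "z 0"] all_out[of u] all_out[of 0] by linarith
    then show ?thesis using K(3) by simp
  qed
  have cjP: "cj j \<notin> P" if "j \<in> Mom" for j using PM cj that by blast
  have pconst: "z u $ j = z 0 $ j" if "j \<in> P" for u j
  proof -
    have "((\<lambda>t. z t $ j) has_real_derivative 0) (at u)" for u
      using component_derivative[OF sol, of j u] that PM cjP[of j] by (auto simp: Gu)
    then show ?thesis using DERIV_isconst_all[of "\<lambda>t. z t $ j"] by blast
  qed
  have VK: "V $ j = T * (K / nP (z 0) * proj_on P (z 0) $ cj j)" for j
  proof (cases "cj j \<in> P")
    case True
    then have j: "j \<notin> Mom" using PM cj by blast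
    have "((\<lambda>t. z t $ j) has_real_derivative K / nP (z 0) * z 0 $ cj j) (at u)" for u
      using component_derivative[OF sol, of j u] j True by (simp add: Gu nconst[of u] pconst[OF True, of u])
    from MVT2[OF T this] obtain \<xi> where "z T $ j - z 0 $ j = (T - 0) * (K / nP (z 0) * z 0 $ cj j)" by blast
    moreover have "z T = z 0 + V" using sol unfolding hsol_def by (metis add_0)
    ultimately show ?thesis using True by simp
  next
    case False
    then show ?thesis using V[of j] by auto
  qed
  have "(norm V)\<^sup>2 = (\<Sum>j\<in>UNIV. (T * K / nP (z 0))\<^sup>2 * (proj_on P (z 0) $ cj j)\<^sup>2)"
    unfolding norm_square_vec VK by (simp add: power_mult_distrib power_divide mult.assoc)
  also have "\<dots> = (T * K / nP (z 0))\<^sup>2 * (\<Sum>j\<in>UNIV. (proj_on P (z 0) $ cj j)\<^sup>2)"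
    by (simp add: sum_distrib_left)
  also have "(\<Sum>j\<in>UNIV. (proj_on P (z 0) $ cj j)\<^sup>2) = (\<Sum>j\<in>UNIV. (proj_on P (z 0) $ j)\<^sup>2)"
    by (rule sum.reindex_bij_witness[of _ cj cj]) (auto simp: cj)
  also have "\<dots> = (nP (z 0))\<^sup>2" by (simp add: norm_square_vec)
  finally have nV2: "(norm V)\<^sup>2 = (T * K / nP (z 0))\<^sup>2 * (nP (z 0))\<^sup>2" .
  have "(norm V)\<^sup>2 = (T * K)\<^sup>2"
  proof -
    have "0 < nP (z 0)" using all_out[of 0] R_pos by linarith
    then show ?thesis unfolding nV2 by (simp add: power_divide)
  qed
  then have "norm V = T * K" using T K(3) by (simp add: power2_eq_iff_nonneg)
  then show False using K(2) by (simp add: mult.commute)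
qed

text \<open>A solution beyond R has energy h0 \<ge> c R^\<mu> > Mr, so by conservation it never
  meets |z_I| < r, and condition \<open>AR\<close> holds along all of it. The action is then at
  least T (\<mu> - 1) h0 minus a contribution of the momenta outside \<open>P\<close>, which is more
  than allowed.\<close>

lemma a_priori:
  assumes sol: "hsol Mom cj Gt V T z"
    and F: "\<And>t. (F has_real_derivative (\<Sum>j\<in>Mom. z t $ j * Gt (z t) $ j) - Ht (z t)) (at t)"
    and le: "F T - F 0 \<le> T * C0 + (norm V)\<^sup>2"
  shows "nP (z t) \<le> R"
proof (rule ccontr)
  assume "\<not> nP (z t) \<le> R"
  then have t: "R < nP (z t)" by simp
  define h0 where "h0 = Ht (z t)"
  have en: "Ht (z u) = h0" for u using energy[OF sol, of u] energy[OF sol, of t] by (simp add: h0_def)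
  note conf = confined[OF sol]
  have "c * R powr \<mu> \<le> c * nP (z t) powr \<mu>"
    using t R_pos c(1) \<mu> by (intro mult_left_mono powr_mono2) auto
  also have "\<dots> \<le> H (z t)" using c(2)[of "z t"] t R(1) by simp
  also have "\<dots> \<le> h0" using Ht_ge[OF conf] by (simp add: h0_def)
  finally have h0: "c * R powr \<mu> \<le> h0" .
  have out: "r \<le> nP (z u)" for u
  proof (rule ccontr)
    assume "\<not> r \<le> nP (z u)"
    then have "\<bar>H (z u)\<bar> \<le> Mr" "Ht (z u) = H (z u)" using Mr[of "z u"] near(1)[of "z u"] R(1) by auto
    then show False using en[of u] h0 R(3) by linarith
  qed
  define \<sigma> where "\<sigma> = a * (R + 1) powr s + b"
  have \<sigma>0: "0 \<le> \<sigma>" using ab by (simp add: \<sigma>_def)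
  have \<sigma>: "\<bar>Gt (z u) $ j\<bar> \<le> \<sigma>" if "j \<notin> P" for u j using growth_t[OF conf that] by (simp add: \<sigma>_def)
  have cjP: "cj j \<notin> P" if "j \<in> Mom" for j using PM cj that by blast
  have Vc: "V $ cj j = 0" if "j \<notin> P" for j using V[of "cj j"] cj that by auto
  \<comment> \<open>Subtracting the initial momenta outside \<open>P\<close> times the conjugate
    positions does not change the increment over a period, as \<open>V\<close> does not move these
    positions. Only deviations of these momenta, at most T \<sigma>, remain to be estimated.\<close>
  define D where "D u = F u - (\<Sum>j\<in>Mom - P. z 0 $ j * z u $ cj j)" for u
  have dD: "(D has_real_derivative ((\<Sum>j\<in>Mom. z u $ j * Gt (z u) $ j) - h0) - (\<Sum>j\<in>Mom - P. z 0 $ j * Gt (z u) $ j)) (at u)" for u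
  proof -
    have "((\<lambda>u. z u $ cj j) has_real_derivative Gt (z u) $ j) (at u)" if "j \<in> Mom" for j
      using component_derivative[OF sol, of "cj j" u] that cj by simp
    then show ?thesis unfolding D_def
      using F[of u] by (intro DERIV_diff DERIV_sum DERIV_cmult) (auto simp: en)
  qed
  obtain \<xi> where \<xi>: "0 < \<xi>" "\<xi> < T" "D T - D 0 = (T - 0) * (((\<Sum>j\<in>Mom. z \<xi> $ j * Gt (z \<xi>) $ j) - h0) - (\<Sum>j\<in>Mom - P. z 0 $ j * Gt (z \<xi>) $ j))"
    using MVT2[OF T dD] by blast
  have zT: "z T = z 0 + V" using sol unfolding hsol_def by (metis add_0)
  have "D T - D 0 = F T - F 0" by (simp add: D_def zT Vc)
  moreover have "(\<mu> - 1) * h0 - real CARD('d) * T * \<sigma>\<^sup>2 \<le> ((\<Sum>j\<in>Mom. z \<xi> $ j * Gt (z \<xi>) $ j) - h0) - (\<Sum>j\<in>Mom - P. z 0 $ j * Gt (z \<xi>) $ j)"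
  proof -
    have "(\<Sum>j\<in>Mom. z \<xi> $ j * Gt (z \<xi>) $ j) = (\<Sum>j\<in>P. z \<xi> $ j * Gt (z \<xi>) $ j) + (\<Sum>j\<in>Mom - P. z \<xi> $ j * Gt (z \<xi>) $ j)"
      using sum.subset_diff[OF PM, of "\<lambda>j. z \<xi> $ j * Gt (z \<xi>) $ j"] by (simp add: add.commute)
    moreover have "(\<Sum>j\<in>P. z \<xi> $ j * Gt (z \<xi>) $ j) = proj_on P (z \<xi>) \<bullet> Gt (z \<xi>)" by (simp add: proj_on_inner)
    moreover have "\<mu> * h0 \<le> proj_on P (z \<xi>) \<bullet> Gt (z \<xi>)" using AR_t[OF out conf, of \<xi>] en by simp
    moreover have "(\<Sum>j\<in>Mom - P. z \<xi> $ j * Gt (z \<xi>) $ j) - (\<Sum>j\<in>Mom - P. z 0 $ j * Gt (z \<xi>) $ j) =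
       (\<Sum>j\<in>Mom - P. (z \<xi> $ j - z 0 $ j) * Gt (z \<xi>) $ j)" by (simp add: sum_subtractf algebra_simps)
    moreover have "\<bar>\<Sum>j\<in>Mom - P. (z \<xi> $ j - z 0 $ j) * Gt (z \<xi>) $ j\<bar> \<le> real CARD('d) * T * \<sigma>\<^sup>2"
    proof -
      have "\<bar>\<Sum>j\<in>Mom - P. (z \<xi> $ j - z 0 $ j) * Gt (z \<xi>) $ j\<bar> \<le> (\<Sum>j\<in>Mom - P. T * \<sigma>\<^sup>2)"
      proof (rule order_trans[OF sum_abs sum_mono])
        fix j assume j: "j \<in> Mom - P"
        have "((\<lambda>t. z t $ j) has_real_derivative - Gt (z u) $ cj j) (at u)" for u
          using component_derivative[OF sol, of j u] j by simp
        from MVT2[OF \<xi>(1) this] obtain \<zeta> where "z \<xi> $ j - z 0 $ j = (\<xi> - 0) * (- Gt (z \<zeta>) $ cj j)" by blast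
        moreover have "\<bar>Gt (z \<zeta>) $ cj j\<bar> \<le> \<sigma>" using \<sigma> cjP j by blast
        then have "\<xi> * \<bar>Gt (z \<zeta>) $ cj j\<bar> \<le> T * \<sigma>" using \<xi> by (intro mult_mono) auto
        ultimately have "\<bar>z \<xi> $ j - z 0 $ j\<bar> \<le> T * \<sigma>" using \<xi>(1) by (simp add: abs_mult)
        then have "\<bar>z \<xi> $ j - z 0 $ j\<bar> * \<bar>Gt (z \<xi>) $ j\<bar> \<le> T * \<sigma> * \<sigma>"
          using \<sigma>[of j \<xi>] j T \<sigma>0 by (intro mult_mono) auto
        then show "\<bar>(z \<xi> $ j - z 0 $ j) * Gt (z \<xi>) $ j\<bar> \<le> T * \<sigma>\<^sup>2" by (simp add: abs_mult power2_eq_square mult.assoc)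
      qed
      also have "\<dots> = real (card (Mom - P)) * (T * \<sigma>\<^sup>2)" by simp
      also have "\<dots> \<le> real CARD('d) * (T * \<sigma>\<^sup>2)" using T by (intro mult_right_mono) (auto intro: card_mono)
      finally show ?thesis by simp
    qed
    ultimately show ?thesis by (simp add: algebra_simps abs_le_iff)
  qed
  then have "T * ((\<mu> - 1) * h0 - real CARD('d) * T * \<sigma>\<^sup>2) \<le> D T - D 0"
    unfolding \<xi>(3) diff_0_right using T by (intro mult_left_mono) auto
  moreover have "(\<mu> - 1) * (c * R powr \<mu>) * T \<le> (\<mu> - 1) * h0 * T"
    using h0 \<mu> T by (intro mult_right_mono mult_left_mono) auto
  moreover have "T * ((\<mu> - 1) * h0 - real CARD('d) * T * \<sigma>\<^sup>2) = (\<mu> - 1) * h0 * T - real CARD('d) * T\<^sup>2 * \<sigma>\<^sup>2"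
    by (simp add: algebra_simps power2_eq_square)
  ultimately show False using R(4) le unfolding \<sigma>_def by linarith
qed

text \<open>Truncated solutions below the minimax bound satisfy |z_I| \<le> R and thus solve the
  original system. Conversely, the representatives kept in \<open>\<Y>\<close> stay in that region
  and so solve the truncated system too.\<close>

theorem few_orbits:
  assumes fin: "finite \<Z>" and crd: "card \<Z> + 1 \<le> card (- P)" and sol: "\<forall>z\<in>\<Z>. hsol Mom cj G V T z"
    and distinct: "\<forall>z\<in>\<Z>. \<forall>z'\<in>\<Z>. \<forall>m\<in>Lat P. \<forall>\<Delta>. (\<forall>t. z (t + \<Delta>) + m = z' t) \<longrightarrow> z = z'"
    and cover: "\<forall>z. hsol Mom cj G V T z \<longrightarrow> (\<exists>z'\<in>\<Z>. \<exists>m\<in>Lat P. \<exists>\<theta>. \<forall>t. z t = z' (t + \<theta>) + m)"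
  shows False
proof -
  obtain CG where CG: "\<And>z. norm (Gt z) \<le> CG" using Gt_bounded by blast
  interpret D: dsys_cpt P Mom cj V T Ht Gt CG i0 K C0 C1 "R + 1" by (rule dsys_cpt_trunc[OF CG])
  have Jm: "D.Jm = JM Mom cj" by (simp add: fun_eq_iff D.Jm_def JM_def)
  have sol_eq: "D.sol = hsol Mom cj Gt V T" by (simp add: fun_eq_iff D.sol_def hsol_def Jm)
  define \<Y> where "\<Y> = {z \<in> \<Z>. \<forall>t. nP (z t) \<le> R}"
  have finY: "finite \<Y>" and cY: "card \<Y> \<le> card \<Z>" using fin by (auto simp: \<Y>_def intro: card_mono)
  obtain zs where zs: "bij_betw zs {..<card \<Y>} \<Y>"
    using ex_bij_betw_nat_finite[OF finY] by (auto simp: atLeast0LessThan)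
  have zsY: "zs j \<in> \<Y>" if "j < card \<Y>" for j using zs that by (auto simp: bij_betw_def)
  show False
  proof (rule D.orbits_at_least[of "card \<Y>" zs])
    show "card \<Y> + 1 \<le> card (- P)" using cY crd by simp
    show "\<forall>j<card \<Y>. D.sol (zs j)"
      using zsY sol unfolding sol_eq \<Y>_def hsol_def by (auto simp: near(2))
    show "\<forall>i<card \<Y>. \<forall>j<card \<Y>. \<forall>m\<in>Lat P. \<forall>\<Delta>. (\<forall>t. zs i (t + \<Delta>) + m = zs j t) \<longrightarrow> i = j"
    proof (intro allI impI ballI)
      fix i j m \<Delta> assume ij: "i < card \<Y>" "j < card \<Y>" and m: "m \<in> Lat P" "\<forall>t. zs i (t + \<Delta>) + m = zs j t"
      then have "zs i = zs j" using distinct zsY unfolding \<Y>_def by blast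
      then show "i = j" using zs ij by (auto simp: bij_betw_def inj_on_def)
    qed
    show "\<forall>z. D.sol z \<longrightarrow> D.Act z \<le> T * C0 + (norm V)\<^sup>2 \<longrightarrow>
      (\<exists>j<card \<Y>. \<exists>m\<in>Lat P. \<exists>\<theta>. \<forall>t. z t = zs j (t + \<theta>) + m)"
    proof (intro allI impI)
      fix z assume z: "D.sol z" "D.Act z \<le> T * C0 + (norm V)\<^sup>2"
      obtain F where F: "\<And>t. (F has_real_derivative D.lag (z t)) (at t)" "\<And>\<theta>. F (\<theta> + T) - F \<theta> = D.Act z"
        using D.action_antiderivative[OF z(1)] by blast
      have hz: "hsol Mom cj Gt V T z" using z(1) by (simp add: sol_eq)
      have zR: "nP (z t) \<le> R" for t
      proof (rule a_priori[OF hz])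
        show "(F has_real_derivative (\<Sum>j\<in>Mom. z t $ j * Gt (z t) $ j) - Ht (z t)) (at t)" for t
          using F(1)[of t] by (simp add: D.lag_def)
        show "F T - F 0 \<le> T * C0 + (norm V)\<^sup>2" using F(2)[of 0] z(2) by simp
      qed
      then have "hsol Mom cj G V T z" using hz unfolding hsol_def by (simp add: near(2))
      then obtain z' m \<theta> where z': "z' \<in> \<Z>" "m \<in> Lat P" "\<And>t. z t = z' (t + \<theta>) + m" using cover by blast
      have "nP (z' t) \<le> R" for t
        using zR[of "t - \<theta>"] by (simp add: z'(3) proj_on_translate[OF z'(2)])
      then have "z' \<in> zs ` {..<card \<Y>}" using z'(1) zs by (simp add: \<Y>_def bij_betw_def)
      then obtain j where "j < card \<Y>" "zs j = z'" by auto
      then show "\<exists>j<card \<Y>. \<exists>m\<in>Lat P. \<exists>\<theta>. \<forall>t. z t = zs j (t + \<theta>) + m" using z' by blast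
    qed
  qed
qed

end

section \<open>The choice of the truncation radius\<close>

text \<open>The left side grows at most like R^(2 s), the right side like R^\<mu>, and 2 s < \<mu>;
  so a large R works whatever T is.\<close>

lemma eventually_params:
  fixes c Mr B r \<mu> a b s D T :: real
  assumes c: "0 < c" and r: "0 < r" and \<mu>: "1 < \<mu>" and ab: "0 < a" "0 < b" "0 < s" and D: "0 \<le> D"
    and T: "0 < T" and s: "2 * s < \<mu>"
  shows "\<exists>R. r \<le> R \<and> \<mu> < R + 1 \<and> Mr < c * R powr \<mu> \<and> B + D * T\<^sup>2 * (a * (R + 1) powr s + b)\<^sup>2 < (\<mu> - 1) * (c * R powr \<mu>) * T"
proof -
  define A where "A = a * 2 powr s + b"
  have lim: "((\<lambda>R. B * R powr (- \<mu>) + D * T\<^sup>2 * A\<^sup>2 * R powr (2 * s - \<mu>)) \<longlongrightarrow> B * 0 + D * T\<^sup>2 * A\<^sup>2 * 0) at_top"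
    by (intro tendsto_intros tendsto_neg_powr filterlim_ident) (use \<mu> s in auto)
  have pos: "0 < (\<mu> - 1) * c * T" using \<mu> c T by simp
  have ev1: "\<forall>\<^sub>F R in at_top. B * R powr (- \<mu>) + D * T\<^sup>2 * A\<^sup>2 * R powr (2 * s - \<mu>) < (\<mu> - 1) * c * T"
    using order_tendstoD(2)[OF lim, of "(\<mu> - 1) * c * T"] pos by simp
  have lim2: "((\<lambda>R. Mr * R powr (- \<mu>)) \<longlongrightarrow> Mr * 0) at_top"
    by (intro tendsto_intros tendsto_neg_powr filterlim_ident) (use \<mu> in auto)
  have ev2: "\<forall>\<^sub>F R in at_top. Mr * R powr (- \<mu>) < c" using order_tendstoD(2)[OF lim2, of c] c by simp
  have "\<forall>\<^sub>F R in at_top. max 1 (max r \<mu>) \<le> R" by (rule eventually_ge_at_top)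
  with ev1 ev2 have "\<forall>\<^sub>F R in at_top. max 1 (max r \<mu>) \<le> R \<and> Mr * R powr (- \<mu>) < c \<and>
      B * R powr (- \<mu>) + D * T\<^sup>2 * A\<^sup>2 * R powr (2 * s - \<mu>) < (\<mu> - 1) * c * T"
    by eventually_elim auto
  then obtain R where R: "max 1 (max r \<mu>) \<le> R" "Mr * R powr (- \<mu>) < c"
      "B * R powr (- \<mu>) + D * T\<^sup>2 * A\<^sup>2 * R powr (2 * s - \<mu>) < (\<mu> - 1) * c * T"
    by (metis (mono_tags, lifting) eventually_happens' trivial_limit_at_top_linorder)
  have R1: "1 \<le> R" "r \<le> R" "\<mu> \<le> R" using R(1) by auto
  have inv: "R powr (- \<mu>) * R powr \<mu> = 1" using R1 by (simp flip: powr_add)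
  have p: "0 < R powr \<mu>" using R1 by simp
  have "Mr * R powr (- \<mu>) * R powr \<mu> < c * R powr \<mu>" using R(2) p by (intro mult_strict_right_mono)
  then have M: "Mr < c * R powr \<mu>" using inv by (simp add: mult.assoc)
  have "(B * R powr (- \<mu>) + D * T\<^sup>2 * A\<^sup>2 * R powr (2 * s - \<mu>)) * R powr \<mu> < (\<mu> - 1) * c * T * R powr \<mu>"
    using R(3) p by (intro mult_strict_right_mono)
  moreover have "R powr (2 * s - \<mu>) * R powr \<mu> = R powr (2 * s)" using R1 by (simp flip: powr_add)
  ultimately have "B + D * T\<^sup>2 * (A\<^sup>2 * R powr (2 * s)) < (\<mu> - 1) * (c * R powr \<mu>) * T"
    using inv by (simp add: distrib_right mult.assoc) (simp add: mult_ac)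
  moreover have "(a * (R + 1) powr s + b)\<^sup>2 \<le> A\<^sup>2 * R powr (2 * s)"
  proof -
    have "(R + 1) powr s \<le> (2 * R) powr s" using R1 ab by (intro powr_mono2) auto
    also have "\<dots> = 2 powr s * R powr s" using R1 by (simp add: powr_mult)
    finally have "a * (R + 1) powr s \<le> a * (2 powr s * R powr s)" using ab by (intro mult_left_mono) auto
    moreover have "b * 1 \<le> b * R powr s" using ab R1 by (intro mult_left_mono ge_one_powr_ge_zero) auto
    ultimately have "a * (R + 1) powr s + b \<le> A * R powr s" by (simp add: A_def algebra_simps)
    then have "(a * (R + 1) powr s + b)\<^sup>2 \<le> (A * R powr s)\<^sup>2" using ab by (intro power_mono) auto
    also have "\<dots> = A\<^sup>2 * R powr (2 * s)" by (simp add: power_mult_distrib power2_eq_square flip: powr_add)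
    finally show ?thesis .
  qed
  then have "D * T\<^sup>2 * (a * (R + 1) powr s + b)\<^sup>2 \<le> D * T\<^sup>2 * (A\<^sup>2 * R powr (2 * s))"
    using D by (intro mult_left_mono) auto
  ultimately have "B + D * T\<^sup>2 * (a * (R + 1) powr s + b)\<^sup>2 < (\<mu> - 1) * (c * R powr \<mu>) * T" by linarith
  then show ?thesis using R1 M by (intro exI[of _ R]) auto
qed

text \<open>The radius is \<open>R = \<rho> T powr (- 1 / (\<mu> - 1))\<close>; with \<open>w = R / \<rho>\<close>, hence \<open>T = w powr (1 - \<mu>)\<close>, the inequality
  divided by \<open>w\<close> has limit \<open>nV * X0 < (\<mu> - 1) * c * \<rho> powr \<mu>\<close>. The exponent \<open>2 * s - 2 * \<mu> + 1\<close> of the last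
  term is negative precisely when \<open>s < \<mu> - 1 / 2\<close>.\<close>

lemma small_period_params:
  fixes c Mr nV r \<mu> a b s D :: real
  assumes c: "0 < c" and r: "0 < r" and \<mu>: "1 < \<mu>" and ab: "0 < a" "0 < b" "0 < s" and D: "0 \<le> D"
    and nV: "0 \<le> nV" and s: "s < \<mu> - 1 / 2"
  shows "\<exists>\<delta>>0. \<forall>T. 0 < T \<longrightarrow> T < \<delta> \<longrightarrow> (\<exists>R. r \<le> R \<and> \<mu> < R + 1 \<and> Mr < c * R powr \<mu> \<and>
    (T * Mr + nV * r + nV * (nV / (c * T)) powr (1 / (\<mu> - 1)) + nV\<^sup>2) + D * T\<^sup>2 * (a * (R + 1) powr s + b)\<^sup>2
      < (\<mu> - 1) * (c * R powr \<mu>) * T)"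
proof -
  define A where "A = a * 2 powr s + b"
  define X0 where "X0 = (nV / c) powr (1 / (\<mu> - 1))"
  \<comment> \<open>Large enough that (\<mu> - 1) c \<rho>^\<mu> exceeds the limit nV X0; the
    maximum with 1 gives R \<ge> w.\<close>
  define \<rho> where "\<rho> = max 1 (((nV * X0 + 1) / ((\<mu> - 1) * c)) powr (1 / \<mu>))"
  have \<rho>: "1 \<le> \<rho>" by (simp add: \<rho>_def)
  have X0: "0 \<le> nV * X0" using nV by (simp add: X0_def)
  have rho: "nV * X0 < (\<mu> - 1) * c * \<rho> powr \<mu>"
  proof -
    define y where "y = (nV * X0 + 1) / ((\<mu> - 1) * c)"
    have y: "0 < y" using X0 \<mu> c by (simp add: y_def)
    have "(y powr (1 / \<mu>)) powr \<mu> \<le> \<rho> powr \<mu>" using \<mu> by (intro powr_mono2) (auto simp: \<rho>_def y_def)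
    then have "y \<le> \<rho> powr \<mu>" using y \<mu> by (simp add: powr_powr)
    then have "(\<mu> - 1) * c * y \<le> (\<mu> - 1) * c * \<rho> powr \<mu>" using \<mu> c by (intro mult_left_mono) auto
    then show ?thesis using \<mu> c by (simp add: y_def)
  qed
  have lim: "((\<lambda>w. Mr * w powr (- \<mu>) + (nV * r + nV\<^sup>2) * w powr (- 1) + nV * X0 +
      D * A\<^sup>2 * \<rho> powr (2 * s) * w powr (2 * s - 2 * \<mu> + 1))
      \<longlongrightarrow> Mr * 0 + (nV * r + nV\<^sup>2) * 0 + nV * X0 + D * A\<^sup>2 * \<rho> powr (2 * s) * 0) at_top"
    by (intro tendsto_intros tendsto_neg_powr filterlim_ident) (use \<mu> s in auto)
  have ev1: "\<forall>\<^sub>F w in at_top. Mr * w powr (- \<mu>) + (nV * r + nV\<^sup>2) * w powr (- 1) + nV * X0 +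
      D * A\<^sup>2 * \<rho> powr (2 * s) * w powr (2 * s - 2 * \<mu> + 1) < (\<mu> - 1) * c * \<rho> powr \<mu>"
    using order_tendstoD(2)[OF lim, of "(\<mu> - 1) * c * \<rho> powr \<mu>"] rho by simp
  have lim2: "((\<lambda>w. Mr * w powr (- \<mu>)) \<longlongrightarrow> Mr * 0) at_top"
    by (intro tendsto_intros tendsto_neg_powr filterlim_ident) (use \<mu> in auto)
  have ev2: "\<forall>\<^sub>F w in at_top. Mr * w powr (- \<mu>) < c" using order_tendstoD(2)[OF lim2, of c] c by simp
  have "\<forall>\<^sub>F w in at_top. max 1 (max r \<mu>) \<le> w" by (rule eventually_ge_at_top)
  with ev1 ev2 have "\<forall>\<^sub>F w in at_top. max 1 (max r \<mu>) \<le> w \<and> Mr * w powr (- \<mu>) < c \<and>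
      Mr * w powr (- \<mu>) + (nV * r + nV\<^sup>2) * w powr (- 1) + nV * X0 +
      D * A\<^sup>2 * \<rho> powr (2 * s) * w powr (2 * s - 2 * \<mu> + 1) < (\<mu> - 1) * c * \<rho> powr \<mu>"
    by eventually_elim auto
  then obtain w1 where w1: "\<And>w. w1 \<le> w \<Longrightarrow> max 1 (max r \<mu>) \<le> w \<and> Mr * w powr (- \<mu>) < c \<and>
      Mr * w powr (- \<mu>) + (nV * r + nV\<^sup>2) * w powr (- 1) + nV * X0 +
      D * A\<^sup>2 * \<rho> powr (2 * s) * w powr (2 * s - 2 * \<mu> + 1) < (\<mu> - 1) * c * \<rho> powr \<mu>"
    unfolding eventually_at_top_linorder by blast
  have w1_1: "1 \<le> w1" using w1[of w1] by simp
  \<comment> \<open>The exponent 1 - \<mu> is negative, so T < \<delta> means w > w1.\<close>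
  define \<delta> where "\<delta> = w1 powr (1 - \<mu>)"
  have "\<exists>R. r \<le> R \<and> \<mu> < R + 1 \<and> Mr < c * R powr \<mu> \<and>
    (T * Mr + nV * r + nV * (nV / (c * T)) powr (1 / (\<mu> - 1)) + nV\<^sup>2) + D * T\<^sup>2 * (a * (R + 1) powr s + b)\<^sup>2
      < (\<mu> - 1) * (c * R powr \<mu>) * T" if T: "0 < T" "T < \<delta>" for T
  proof -
    define w where "w = T powr (- (1 / (\<mu> - 1)))"
    have Tw: "T = w powr (1 - \<mu>)"
    proof -
      have "- (1 / (\<mu> - 1)) * (1 - \<mu>) = 1" using \<mu> by (simp add: field_simps)
      then show ?thesis using T by (simp add: w_def powr_powr)
    qed
    have "w1 \<le> w"
    proof (rule ccontr)
      assume "\<not> w1 \<le> w"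
      then have "w1 powr (1 - \<mu>) < w powr (1 - \<mu>)" using \<mu> T by (intro powr_less_mono2_neg) (auto simp: w_def)
      then show False using T(2) Tw by (simp add: \<delta>_def)
    qed
    note w = w1[OF this]
    have wp: "1 \<le> w" "r \<le> w" "\<mu> \<le> w" "0 < w" using w by auto
    define R where "R = \<rho> * w"
    have "1 * w \<le> \<rho> * w" using \<rho> wp by (intro mult_right_mono) auto
    then have Rw: "w \<le> R" by (simp add: R_def)
    have p: "0 < w powr \<mu>" using wp by simp
    have X: "(nV / (c * T)) powr (1 / (\<mu> - 1)) = X0 * w"
    proof -
      have eq: "nV / (c * T) = nV / c * (1 / T)" by simp
      have "(nV / c * (1 / T)) powr (1 / (\<mu> - 1)) = (nV / c) powr (1 / (\<mu> - 1)) * (1 / T) powr (1 / (\<mu> - 1))"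
        by (rule powr_mult)
      moreover have "(1 / T) powr (1 / (\<mu> - 1)) = w" using T by (simp add: w_def powr_minus divide_inverse inverse_powr)
      ultimately show ?thesis by (simp only: eq X0_def)
    qed
    have "Mr * w powr (- \<mu>) * w powr \<mu> < c * w powr \<mu>" using w p by (intro mult_strict_right_mono) auto
    then have "Mr < c * w powr \<mu>" using wp by (simp add: mult.assoc flip: powr_add)
    also have "\<dots> \<le> c * R powr \<mu>" using Rw wp c \<mu> by (intro mult_left_mono powr_mono2) auto
    finally have 1: "Mr < c * R powr \<mu>" .
    have f0: "(Mr * w powr (- \<mu>) + (nV * r + nV\<^sup>2) * w powr (- 1) + nV * X0 +
      D * A\<^sup>2 * \<rho> powr (2 * s) * w powr (2 * s - 2 * \<mu> + 1)) * w < (\<mu> - 1) * c * \<rho> powr \<mu> * w"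
      using w wp by (intro mult_strict_right_mono) auto
    have f1: "w powr (- \<mu>) * w = T"
      unfolding Tw using powr_add[of w "- \<mu>" 1] wp by (simp add: algebra_simps)
    have f2: "w powr (- 1) * w = 1" using wp by (simp add: powr_minus_divide)
    have f3: "w powr (2 * s - 2 * \<mu> + 1) * w = T\<^sup>2 * w powr (2 * s)"
    proof -
      have "w powr (2 * s - 2 * \<mu> + 1) * w = w powr (2 * s - 2 * \<mu> + 1 + 1)"
        using wp powr_add[of w "2 * s - 2 * \<mu> + 1" 1] by simp
      moreover have "T\<^sup>2 = w powr ((1 - \<mu>) + (1 - \<mu>))" unfolding Tw power2_eq_square by (rule powr_add[symmetric])
      moreover have "w powr ((1 - \<mu>) + (1 - \<mu>)) * w powr (2 * s) = w powr (2 * s - 2 * \<mu> + 1 + 1)"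
      proof -
        have "(1 - \<mu>) + (1 - \<mu>) + 2 * s = 2 * s - 2 * \<mu> + 1 + 1" by simp
        then show ?thesis by (metis powr_add)
      qed
      ultimately show ?thesis by simp
    qed
    have f4: "(\<mu> - 1) * (c * R powr \<mu>) * T = (\<mu> - 1) * c * \<rho> powr \<mu> * w"
    proof -
      have "w powr \<mu> * T = w" unfolding Tw using wp by (simp flip: powr_add)
      then show ?thesis using \<rho> wp by (simp add: R_def powr_mult)
    qed
    have "(a * (R + 1) powr s + b)\<^sup>2 \<le> A\<^sup>2 * (\<rho> powr (2 * s) * w powr (2 * s))"
    proof -
      have R1: "1 \<le> R" using Rw wp by simp
      have "(R + 1) powr s \<le> (2 * R) powr s" using R1 ab by (intro powr_mono2) auto
      also have "\<dots> = 2 powr s * R powr s" using R1 by (simp add: powr_mult)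
      finally have "a * (R + 1) powr s \<le> a * (2 powr s * R powr s)" using ab by (intro mult_left_mono) auto
      moreover have "b * 1 \<le> b * R powr s" using ab R1 by (intro mult_left_mono ge_one_powr_ge_zero) auto
      ultimately have "a * (R + 1) powr s + b \<le> A * R powr s" by (simp add: A_def algebra_simps)
      then have "(a * (R + 1) powr s + b)\<^sup>2 \<le> (A * R powr s)\<^sup>2" using ab by (intro power_mono) auto
      also have "\<dots> = A\<^sup>2 * R powr (2 * s)" by (simp add: power_mult_distrib power2_eq_square flip: powr_add)
      also have "\<dots> = A\<^sup>2 * (\<rho> powr (2 * s) * w powr (2 * s))" using \<rho> wp by (simp add: R_def powr_mult)
      finally show ?thesis .
    qed
    then have f5: "D * T\<^sup>2 * (a * (R + 1) powr s + b)\<^sup>2 \<le> D * T\<^sup>2 * (A\<^sup>2 * (\<rho> powr (2 * s) * w powr (2 * s)))"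
      using D by (intro mult_left_mono) auto
    have f6: "(Mr * w powr (- \<mu>) + (nV * r + nV\<^sup>2) * w powr (- 1) + nV * X0 +
      D * A\<^sup>2 * \<rho> powr (2 * s) * w powr (2 * s - 2 * \<mu> + 1)) * w =
      Mr * (w powr (- \<mu>) * w) + (nV * r + nV\<^sup>2) * (w powr (- 1) * w) + nV * X0 * w +
      D * A\<^sup>2 * \<rho> powr (2 * s) * (w powr (2 * s - 2 * \<mu> + 1) * w)"
      by (simp only: distrib_right mult.assoc)
    have "(T * Mr + nV * r + nV * (X0 * w) + nV\<^sup>2) + D * T\<^sup>2 * (a * (R + 1) powr s + b)\<^sup>2
      < (\<mu> - 1) * (c * R powr \<mu>) * T"
      using f0 f5 unfolding f4 f6 f1 f2 f3 by (simp add: mult_ac)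
    then show ?thesis using 1 Rw wp unfolding X by (intro exI[of _ R]) auto
  qed
  moreover have "0 < \<delta>" using w1_1 by (simp add: \<delta>_def)
  ultimately show ?thesis by blast
qed

section \<open>The remaining constants of the truncation\<close>

context ham
begin

theorem few_orbits_ham:
  fixes V :: "real ^ 'd" and T :: real
  assumes T: "0 < T" and V: "\<And>j. V $ j \<noteq> 0 \<Longrightarrow> cj j \<in> P" and VL: "V \<in> Lat P" and V0: "V \<noteq> 0"
    and c: "0 < c" "\<And>z. r \<le> norm (proj_on P z) \<Longrightarrow> c * norm (proj_on P z) powr \<mu> \<le> H z"
    and Mr: "0 \<le> Mr" "\<And>z. norm (proj_on P z) \<le> r \<Longrightarrow> \<bar>H z\<bar> \<le> Mr"
    and R: "r \<le> R" "\<mu> < R + 1" "Mr < c * R powr \<mu>"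
      "(T * Mr + norm V * r + norm V * (norm V / (c * T)) powr (1 / (\<mu> - 1)) + (norm V)\<^sup>2) +
        real CARD('d) * T\<^sup>2 * (a * (R + 1) powr s + b)\<^sup>2 < (\<mu> - 1) * (c * R powr \<mu>) * T"
    and Z: "finite \<Z>" "card \<Z> + 1 \<le> card (- P)" "\<forall>z\<in>\<Z>. hsol Mom cj G V T z"
      "\<forall>z\<in>\<Z>. \<forall>z'\<in>\<Z>. \<forall>m\<in>Lat P. \<forall>\<Delta>. (\<forall>t. z (t + \<Delta>) + m = z' t) \<longrightarrow> z = z'"
      "\<forall>z. hsol Mom cj G V T z \<longrightarrow> (\<exists>z'\<in>\<Z>. \<exists>m\<in>Lat P. \<exists>\<theta>. \<forall>t. z t = z' (t + \<theta>) + m)"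
  shows False
proof -
  \<comment> \<open>From |z_I| = X on, c |z_I|^\<mu> dominates |V| |z_I| / T. In \<open>C0\<close>
    the first term bounds \<open>H\<close> from below for |z_I| \<le> r, the other two bound the
    linear term up to r and up to X; this is the origin of the terms in the inequality for
    R.\<close>
  define X where "X = (norm V / (c * T)) powr (1 / (\<mu> - 1))"
  define C0 where "C0 = Mr + norm V * r / T + norm V * X / T"
  have X: "0 \<le> X" by (simp add: X_def)
  have TC0: "T * C0 = T * Mr + norm V * r + norm V * X" using T by (simp add: C0_def field_simps)
  have C0: "norm V / T * norm (proj_on P z) - C0 \<le> H z" for z
  proof -
    define x where "x = norm (proj_on P z)"
    have x: "0 \<le> x" by (simp add: x_def)
    have nv: "0 \<le> norm V * r / T" "0 \<le> norm V * X / T" using T r X by simp_all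
    have mono: "norm V / T * x \<le> norm V / T * y" if "x \<le> y" for y using that T by (intro mult_left_mono) auto
    show ?thesis
    proof (cases "x \<le> r")
      case True
      then have "norm V / T * x \<le> norm V * r / T" using mono[of r] by simp
      then show ?thesis using Mr(2)[of z] True nv by (simp add: x_def[symmetric] C0_def)
    next
      case False
      then have H: "c * x powr \<mu> \<le> H z" "0 < x" using c(2)[of z] r by (auto simp: x_def)
      show ?thesis
      proof (cases "x \<le> X")
        case True
        then have "norm V / T * x \<le> norm V * X / T" using mono[of X] by simp
        moreover have "0 \<le> c * x powr \<mu>" using c by simp
        ultimately show ?thesis using H nv Mr(1) by (simp add: x_def[symmetric] C0_def)
      next
        case F: False
        have "X powr (\<mu> - 1) \<le> x powr (\<mu> - 1)" using F X \<mu> by (intro powr_mono2) auto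
        moreover have "X powr (\<mu> - 1) = norm V / (c * T)" using \<mu> V0 c T by (simp add: X_def powr_powr)
        ultimately have "c * x * (norm V / (c * T)) \<le> c * x * x powr (\<mu> - 1)"
          using c H by (intro mult_left_mono) auto
        moreover have "x * x powr (\<mu> - 1) = x powr \<mu>" using H(2) powr_add[of x 1 "\<mu> - 1"] by simp
        moreover have "c * x * (norm V / (c * T)) = norm V / T * x" using c by simp
        ultimately have "norm V / T * x \<le> c * x powr \<mu>" by (simp add: mult.assoc)
        then show ?thesis using H nv Mr(1) by (simp add: x_def[symmetric] C0_def)
      qed
    qed
  qed
  obtain i0 where i0: "V $ i0 \<noteq> 0" using V0 by (auto simp: vec_eq_iff)
  obtain S S' :: "real \<Rightarrow> real" where S: "\<And>u. (S has_real_derivative S' u) (at u)" "continuous_on UNIV S'"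
    "\<And>u. 0 \<le> S' u" "\<And>u. 0 \<le> S u" "\<And>u. S u \<le> 1" "\<And>u. u \<le> 0 \<Longrightarrow> S u = 0" "\<And>u. u \<le> 0 \<Longrightarrow> S' u = 0"
    "\<And>u. 1 \<le> u \<Longrightarrow> S u = 1" "\<And>u. 1 \<le> u \<Longrightarrow> S' u = 0"
    by (rule smooth_step) (rule that; assumption)
  obtain Mh where Mh: "0 \<le> Mh" "\<And>z. norm (proj_on P z) \<le> R + 1 \<Longrightarrow> norm (H z) \<le> Mh"
    using periodic_bounded_on_cell[where f = H and P = P and B = "R + 1", OF contH perH] by metis
  define \<kappa> where "\<kappa> = (R + 1) / \<mu> - 1"
  have \<kappa>: "0 < \<kappa>" using R(2) \<mu> by (simp add: \<kappa>_def less_divide_eq)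
  \<comment> \<open>The first term lifts the linear function above \<open>H\<close> in the
    transition zone, the others make its slope exceed |V| / T.\<close>
  define K where "K = Mh / \<kappa> + norm V / T + 1"
  have k0: "0 \<le> Mh / \<kappa>" "0 \<le> norm V / T" using Mh \<kappa> T by simp_all
  have K: "Mh \<le> K * \<kappa>" "norm V < K * T" "0 < K"
  proof -
    have "Mh / \<kappa> * \<kappa> \<le> K * \<kappa>" using k0 \<kappa> by (intro mult_right_mono) (auto simp: K_def)
    then show "Mh \<le> K * \<kappa>" using \<kappa> by simp
    have "norm V / T * T < K * T" using k0 T by (intro mult_strict_right_mono) (auto simp: K_def)
    then show "norm V < K * T" using T by simp
    show "0 < K" using k0 by (simp add: K_def)
  qed
  interpret Tr: trunc P Mom cj H G r \<mu> a b s V T i0 c C0 Mr R K Mh S S'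
  proof unfold_locales
    show "T * C0 + (norm V)\<^sup>2 + real CARD('d) * T\<^sup>2 * (a * (R + 1) powr s + b)\<^sup>2 < (\<mu> - 1) * (c * R powr \<mu>) * T"
      using R(4) by (simp add: TC0 X_def)
    show "\<bar>H z\<bar> \<le> Mh" if "norm (proj_on P z) \<le> R + 1" for z using Mh(2)[OF that] by simp
    show "Mh \<le> K * ((R + 1) / \<mu> - 1)" using K(1) by (simp add: \<kappa>_def)
  qed (fact T V VL i0 c Mr C0 R K S)+
  show False by (rule Tr.few_orbits[OF Z])
qed

end

section \<open>The boundary value problem in coordinates\<close>

lemma norm_proj_on_L2: "inj_on e A \<Longrightarrow> norm (proj_on (e ` A) z) = L2_set (\<lambda>i. z $ e i) A"
proof -
  assume e: "inj_on e A"
  have "(norm (proj_on (e ` A) z))\<^sup>2 = (\<Sum>i\<in>A. (z $ e i)\<^sup>2)"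
    unfolding norm_proj_on_square by (simp add: sum.reindex[OF e])
  then show ?thesis unfolding L2_set_def by (metis norm_ge_zero real_sqrt_unique)
qed

locale coordinates =
  fixes n k :: nat and e :: "nat \<Rightarrow> 'd::finite"
  assumes nk: "n < k" "k \<le> 2 * n - 1" and e: "bij_betw e {1..2 * n} UNIV"
begin

definition ei :: "'d \<Rightarrow> nat" where "ei = inv_into {1..2 * n} e"

text \<open>The exchange of i and n + i that underlies the matrix J.\<close>

definition pair :: "'d \<Rightarrow> 'd" where "pair c = (if ei c \<le> n then e (n + ei c) else e (ei c - n))"

abbreviation (input) PI :: "'d set" where "PI \<equiv> e ` {1..2 * n - k}"

abbreviation (input) Mo :: "'d set" where "Mo \<equiv> e ` {1..n}"

lemma inj_e: "inj_on e {1..2 * n}" using e by (simp add: bij_betw_def)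

lemma ei_e [simp]: "i \<in> {1..2 * n} \<Longrightarrow> ei (e i) = i" unfolding ei_def by (rule inv_into_f_f[OF inj_e])

lemma e_ei [simp]: "e (ei c) = c"
  unfolding ei_def by (rule f_inv_into_f) (use e in \<open>auto simp: bij_betw_def\<close>)

lemma ei_range: "1 \<le> ei c" "ei c \<le> 2 * n"
  using inv_into_into[of c e "{1..2 * n}"] e by (auto simp: bij_betw_def ei_def)

lemma mem_image_e: "A \<subseteq> {1..2 * n} \<Longrightarrow> c \<in> e ` A \<longleftrightarrow> ei c \<in> A"
  by (metis (no_types, lifting) e_ei ei_e image_iff subsetD)

lemma mem_PI: "c \<in> PI \<longleftrightarrow> ei c \<le> 2 * n - k"
  using mem_image_e[of "{1..2 * n - k}" c] ei_range[of c] by auto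

lemma mem_Mo: "c \<in> Mo \<longleftrightarrow> ei c \<le> n"
  using mem_image_e[of "{1..n}" c] ei_range[of c] by auto

lemma e_eq_iff: "i \<in> {1..2 * n} \<Longrightarrow> c = e i \<longleftrightarrow> ei c = i" by (metis ei_e e_ei)

lemma ei_pair: "ei (pair c) = (if ei c \<le> n then n + ei c else ei c - n)"
proof (cases "ei c \<le> n")
  case True
  then show ?thesis using ei_range[of c] by (simp add: pair_def)
next
  case False
  then have "ei c - n \<in> {1..2 * n}" using ei_range[of c] by auto
  from ei_e[OF this] show ?thesis using False by (simp add: pair_def)
qed

lemma pair_pair: "pair (pair c) = c"
  unfolding pair_def[of "pair c"] ei_pair using ei_range[of c] by auto

lemma pair_Mo: "pair c \<in> Mo \<longleftrightarrow> c \<notin> Mo"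
  unfolding mem_Mo ei_pair using ei_range[of c] by auto

lemma PI_Mo: "PI \<subseteq> Mo" using nk by (intro image_mono) auto

lemma compl_PI: "- PI = e ` {2 * n - k + 1..2 * n}"
proof (rule set_eqI)
  fix c
  show "c \<in> - PI \<longleftrightarrow> c \<in> e ` {2 * n - k + 1..2 * n}"
    using mem_PI[of c] mem_image_e[of "{2 * n - k + 1..2 * n}" c] ei_range[of c] by auto
qed

lemma card_compl_PI: "card (- PI) = k"
proof -
  have "card (e ` {2 * n - k + 1..2 * n}) = card {2 * n - k + 1..2 * n}"
    by (rule card_image, rule inj_on_subset[OF inj_e]) auto
  then show ?thesis unfolding compl_PI using nk by auto
qed

lemma J_matrix_JM: "J_matrix e n *v g = JM Mo pair g"
proof (rule vec_eq_iff[THEN iffD2], rule allI)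
  fix p
  have entry: "J_matrix e n $ p $ q = (if q = pair p then if p \<in> Mo then - 1 else 1 else 0)" for q
  proof -
    have 1: "(\<exists>i\<in>{1..n}. p = e i \<and> q = e (n + i)) \<longleftrightarrow> p \<in> Mo \<and> q = pair p"
    proof
      assume "\<exists>i\<in>{1..n}. p = e i \<and> q = e (n + i)"
      then obtain i where i: "i \<in> {1..n}" "p = e i" "q = e (n + i)" by blast
      then have "ei p = i" by auto
      then show "p \<in> Mo \<and> q = pair p" using i by (simp add: pair_def)
    next
      assume "p \<in> Mo \<and> q = pair p"
      then have "ei p \<le> n" "q = e (n + ei p)" by (auto simp: pair_def mem_Mo)
      then show "\<exists>i\<in>{1..n}. p = e i \<and> q = e (n + i)" using ei_range(1)[of p] by (intro bexI[of _ "ei p"]) auto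
    qed
    have 2: "(\<exists>i\<in>{1..n}. p = e (n + i) \<and> q = e i) \<longleftrightarrow> p \<notin> Mo \<and> q = pair p"
    proof
      assume "\<exists>i\<in>{1..n}. p = e (n + i) \<and> q = e i"
      then obtain i where i: "i \<in> {1..n}" "p = e (n + i)" "q = e i" by blast
      then have "ei p = n + i" by auto
      then show "p \<notin> Mo \<and> q = pair p" using i unfolding mem_Mo by (simp add: pair_def)
    next
      assume "p \<notin> Mo \<and> q = pair p"
      then have "n < ei p" "q = e (ei p - n)" unfolding mem_Mo by (auto simp: pair_def)
      then show "\<exists>i\<in>{1..n}. p = e (n + i) \<and> q = e i" using ei_range(2)[of p] by (intro bexI[of _ "ei p - n"]) auto
    qed
    show ?thesis unfolding J_matrix_def vec_lambda_beta 1 2 by auto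
  qed
  have "(J_matrix e n *v g) $ p = (\<Sum>q\<in>UNIV. (if q = pair p then (if p \<in> Mo then - 1 else 1) * g $ q else 0))"
    unfolding matrix_vector_mult_def vec_lambda_beta by (intro sum.cong refl) (simp add: entry)
  also have "\<dots> = (if p \<in> Mo then - 1 else 1) * g $ pair p" by simp
  also have "\<dots> = JM Mo pair g $ p" by (simp add: JM_def)
  finally show "(J_matrix e n *v g) $ p = JM Mo pair g $ p" .
qed

lemma norm_I_proj: "norm_I e n k z = norm (proj_on PI z)"
  unfolding norm_I_def by (rule norm_proj_on_L2[symmetric], rule inj_on_subset[OF inj_e]) auto

lemma norm_II_proj: "norm_II e n k z = norm (proj_on (- PI) z)"
  unfolding norm_II_def compl_PI by (rule norm_proj_on_L2[symmetric], rule inj_on_subset[OF inj_e]) auto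

lemma inner_I_proj: "inner_I e n k z w = proj_on PI z \<bullet> w"
proof -
  have "inj_on e {1..2 * n - k}" by (rule inj_on_subset[OF inj_e]) auto
  then show ?thesis unfolding inner_I_def proj_on_inner by (simp add: sum.reindex)
qed

lemma embed_II_nth: "embed_II e n k m $ c = (if c \<in> PI then 0 else of_int (m (ei c + k - 2 * n)))"
proof -
  have "embed_II e n k m $ c = (\<Sum>i=1..k. if i = ei c + k - 2 * n then (if c \<in> PI then 0 else real_of_int (m i)) else 0)"
    unfolding embed_II_def sum_component
  proof (rule sum.cong[OF refl])
    fix i assume i: "i \<in> {1..k}"
    have "c = e (2 * n - k + i) \<longleftrightarrow> ei c = 2 * n - k + i" by (rule e_eq_iff) (use i nk in auto)
    then show "(real_of_int (m i) *\<^sub>R axis (e (2 * n - k + i)) 1) $ c =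
        (if i = ei c + k - 2 * n then (if c \<in> PI then 0 else real_of_int (m i)) else 0)"
      unfolding mem_PI using i nk by (auto simp: axis_def)
  qed
  also have "\<dots> = (if c \<in> PI then 0 else of_int (m (ei c + k - 2 * n)))"
    unfolding mem_PI using ei_range[of c] nk by auto
  finally show ?thesis .
qed

lemma embed_II_Lat: "embed_II e n k m \<in> Lat PI"
  by (simp add: Lat_def embed_II_nth)

lemma Lat_embed_II:
  assumes "m \<in> Lat PI"
  shows "\<exists>v\<in>int_vectors k. m = embed_II e n k v"
proof -
  define v where "v i = (if i \<in> {1..k} then \<lfloor>m $ e (2 * n - k + i)\<rfloor> else 0)" for i
  have "m = embed_II e n k v"
  proof (rule vec_eq_iff[THEN iffD2], rule allI)
    fix c
    show "m $ c = embed_II e n k v $ c"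
    proof (cases "c \<in> PI")
      case True
      then have "m $ c = 0" using assms unfolding Lat_def by blast
      then show ?thesis using True by (simp add: embed_II_nth)
    next
      case False
      then have c: "2 * n - k < ei c" unfolding mem_PI by simp
      then have "2 * n - k + (ei c + k - 2 * n) = ei c" "ei c + k - 2 * n \<in> {1..k}" using ei_range[of c] nk by auto
      then have "embed_II e n k v $ c = of_int \<lfloor>m $ c\<rfloor>" using False by (simp add: embed_II_nth v_def)
      also have "\<dots> = m $ c"
        using assms unfolding Lat_def mem_Collect_eq by (metis Ints_cases floor_of_int)
      finally show ?thesis by (rule sym)
    qed
  qed
  moreover have "v \<in> int_vectors k" by (simp add: int_vectors_def v_def)
  ultimately show ?thesis by blast
qed

text \<open>The entries of v that may be nonzero have indices k - n + 1 to n. They sit at the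
  coordinates n + 1 to 3 n - k, whose conjugates 1 to 2 n - k are the indices of z_I.\<close>

lemma embed_II_pair:
  assumes "\<forall>i\<in>{1..k - n} \<union> {n + 1..k}. v i = 0" "embed_II e n k v $ c \<noteq> 0"
  shows "pair c \<in> PI"
proof -
  let ?i = "ei c + k - 2 * n"
  have c: "c \<notin> PI" "v ?i \<noteq> 0" using assms(2) by (auto simp: embed_II_nth split: if_splits)
  then have "2 * n - k < ei c" unfolding mem_PI by simp
  then have "?i \<in> {1..k}" using ei_range[of c] nk by auto
  with c(2) assms(1) have "k - n < ?i" "?i \<le> n" by (auto simp: not_le[symmetric])
  then show ?thesis unfolding mem_PI ei_pair using nk by auto
qed

lemma embed_II_nonzero:
  assumes "v \<in> prime_rotational_vectors k"
  shows "embed_II e n k v \<noteq> 0"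
proof -
  obtain i where i: "v i \<noteq> 0" using assms by (auto simp: prime_rotational_vectors_def)
  have "v \<in> int_vectors k" using assms by (simp add: prime_rotational_vectors_def)
  then have ik: "i \<in> {1..k}" using i by (auto simp: int_vectors_def)
  then have "ei (e (2 * n - k + i)) = 2 * n - k + i" using nk by (intro ei_e) auto
  moreover from this have "e (2 * n - k + i) \<notin> PI" unfolding mem_PI using ik by simp
  ultimately have "embed_II e n k v $ e (2 * n - k + i) = of_int (v i)" using nk by (simp add: embed_II_nth)
  then show ?thesis using i by (metis of_int_eq_0_iff zero_index)
qed

end

lemma finite_quotient_representatives:
  assumes "equiv A r" "finite (A // r)"
  obtains Z where "finite Z" "card Z \<le> card (A // r)" "Z \<subseteq> A"
    "\<And>x y. x \<in> Z \<Longrightarrow> y \<in> Z \<Longrightarrow> (x, y) \<in> r \<Longrightarrow> x = y" "\<And>x. x \<in> A \<Longrightarrow> \<exists>y\<in>Z. (y, x) \<in> r"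
proof
  define rep where "rep C = (SOME x. x \<in> C)" for C :: "'a set"
  have rep: "rep C \<in> C" if "C \<in> A // r" for C
    unfolding rep_def using in_quotient_imp_non_empty[OF assms(1) that] by (metis ex_in_conv someI)
  let ?Z = "rep ` (A // r)"
  show "finite ?Z" "card ?Z \<le> card (A // r)" using assms(2) by (auto intro: card_image_le)
  show "?Z \<subseteq> A" using rep in_quotient_imp_subset[OF assms(1)] by blast
  show "x = y" if xy: "x \<in> ?Z" "y \<in> ?Z" "(x, y) \<in> r" for x y
  proof -
    obtain C D where CD: "C \<in> A // r" "D \<in> A // r" "x = rep C" "y = rep D" using xy by blast
    then have "C = D" using quotient_eq_iff[OF assms(1) CD(1,2) rep[OF CD(1)] rep[OF CD(2)]] xy(3) by simp
    then show ?thesis using CD by simp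
  qed
  show "\<exists>y\<in>?Z. (y, x) \<in> r" if x: "x \<in> A" for x
  proof -
    have q: "r `` {x} \<in> A // r" using x by (rule quotientI)
    have "(x, rep (r `` {x})) \<in> r" using rep[OF q] by simp
    then have "(rep (r `` {x}), x) \<in> r" using assms(1) by (meson equivE symE)
    then show ?thesis using q by blast
  qed
qed

theorem theorem2:
  fixes n k :: nat
    and e :: "nat \<Rightarrow> 'd::finite"
    and H :: "real ^ 'd \<Rightarrow> real"
    and r \<mu> a b s :: real
  assumes "n < k" and "k \<le> 2 * n - 1"
    and "bij_betw e {1..2 * n} UNIV"
    and "C1_fun H"
    and "\<forall>z. \<forall>m\<in>int_vectors k. H (z + embed_II e n k m) = H z"
    and "r > 0" and "\<mu> > 1"
    and "\<forall>z. norm_I e n k z \<ge> r \<longrightarrow>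
           0 < \<mu> * H z \<and> \<mu> * H z \<le> inner_I e n k z (gradient H z)"
    and "a > 0" and "b > 0" and "s > 0" and "s < \<mu> - 1 / 2"
    and "\<forall>z. norm_II e n k (gradient H z) \<le> a * norm_I e n k z powr s + b"
  shows "\<forall>v\<in>prime_rotational_vectors k.
           (\<forall>i\<in>{1..k - n} \<union> {n + 1..k}. v i = 0) \<longrightarrow>
           (\<exists>\<delta>>0. \<forall>T\<in>period_interval \<mu> \<delta> s.
              infinite (distinct_solutions e n k H T v) \<or>
              k \<le> card (distinct_solutions e n k H T v))"
proof (intro ballI impI)
  fix v assume v: "v \<in> prime_rotational_vectors k" "\<forall>i\<in>{1..k - n} \<union> {n + 1..k}. v i = 0"
  interpret coordinates n k e by unfold_locales (fact assms)+
  let ?P = "e ` {1..2 * n - k}" and ?Mo = "e ` {1..n}" and ?G = "gradient H"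
  define V where "V = embed_II e n k v"
  interpret ham ?P ?Mo pair H ?G r \<mu> a b s
  proof unfold_locales
    show "pair (pair c) = c" "pair c \<in> ?Mo \<longleftrightarrow> c \<notin> ?Mo" for c by (rule pair_pair, rule pair_Mo)
    show "?P \<subseteq> ?Mo" by (rule PI_Mo)
    show "(H has_derivative (\<lambda>h. h \<bullet> ?G z)) (at z)" for z
      using GDERIV_gradient[of H z] assms(4) by (simp add: C1_fun_def gderiv_def)
    show "continuous_on UNIV ?G" using assms(4) by (simp add: C1_fun_def)
    show "H (z + m) = H z" if "m \<in> Lat ?P" for z m
      using Lat_embed_II[OF that] assms(5) by blast
    show "0 < \<mu> * H z" "\<mu> * H z \<le> proj_on ?P z \<bullet> ?G z" if "r \<le> norm (proj_on ?P z)" for z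
      using assms(8)[rule_format, of z] that by (simp_all add: norm_I_proj inner_I_proj)
    show "norm (proj_on (- ?P) (?G z)) \<le> a * norm (proj_on ?P z) powr s + b" for z
      using assms(13)[rule_format, of z] by (simp add: norm_I_proj norm_II_proj)
  qed (fact assms)+
  obtain c where c: "0 < c" "\<And>z. r \<le> norm (proj_on ?P z) \<Longrightarrow> c * norm (proj_on ?P z) powr \<mu> \<le> H z"
    by (rule power_growth) (rule that; assumption)
  obtain Mr where Mr: "0 \<le> Mr" "\<And>z. norm (proj_on ?P z) \<le> r \<Longrightarrow> norm (H z) \<le> Mr"
    using periodic_bounded_on_cell[where f = H and P = ?P and B = r, OF contH perH] by metis
  \<comment> \<open>The inequalities that \<open>few_orbits_ham\<close> asks for at the period
    T.\<close>
  define good where "good T \<longleftrightarrow> (\<exists>R. r \<le> R \<and> \<mu> < R + 1 \<and> Mr < c * R powr \<mu> \<and>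
    (T * Mr + norm V * r + norm V * (norm V / (c * T)) powr (1 / (\<mu> - 1)) + (norm V)\<^sup>2) +
      real CARD('d) * T\<^sup>2 * (a * (R + 1) powr s + b)\<^sup>2 < (\<mu> - 1) * (c * R powr \<mu>) * T)" for T
  have "\<exists>\<delta>>0. \<forall>T\<in>period_interval \<mu> \<delta> s. 0 < T \<and> good T"
  proof (cases "s < \<mu> / 2")
    case True
    have "good T" if "0 < T" for T
      unfolding good_def by (rule eventually_params) (use c r \<mu> ab that True in auto)
    \<comment> \<open>Here the interval is (0, \<infinity>) whatever \<delta> is, so any positive
      witness will do.\<close>
    then show ?thesis using True by (intro exI[of _ 1]) (auto simp: period_interval_def)
  next
    case False
    have "\<exists>\<delta>>0. \<forall>T. 0 < T \<longrightarrow> T < \<delta> \<longrightarrow> good T"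
      unfolding good_def by (rule small_period_params) (use c r \<mu> ab assms(12) in auto)
    then show ?thesis using False by (auto simp: period_interval_def)
  qed
  moreover have "infinite (distinct_solutions e n k H T v) \<or> k \<le> card (distinct_solutions e n k H T v)"
    if T: "0 < T" "good T" for T
  proof (rule ccontr)
    assume "\<not> ?thesis"
    then have few: "finite (distinct_solutions e n k H T v)" "card (distinct_solutions e n k H T v) < k" by auto
    \<comment> \<open>C1 smoothness is automatic: the right-hand side is continuous along a
      solution.\<close>
    have bvp: "z \<in> bvp_solutions e n k H T v \<longleftrightarrow> hsol ?Mo pair ?G V T z" for z
    proof
      assume "hsol ?Mo pair ?G V T z"
      then have z: "\<And>t. z (t + T) = z t + V" "\<And>t. (z has_vector_derivative JM ?Mo pair (?G (z t))) (at t)"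
        by (auto simp: hsol_def)
      have "continuous_on UNIV z"
        by (intro continuous_at_imp_continuous_on ballI has_vector_derivative_continuous[OF z(2)])
      then have "continuous_on UNIV (\<lambda>t. ?G (z t))"
        using continuous_on_compose2[OF contG] by blast
      then have "continuous_on UNIV (\<lambda>t. JM ?Mo pair (?G (z t)))"
        unfolding J_matrix_JM[symmetric]
        by (rule continuous_on_compose2[OF matrix_vector_mult_linear_continuous_on _ subset_UNIV])
      then have "z C1_differentiable_on UNIV" unfolding C1_differentiable_on_def
        by (intro exI[of _ "\<lambda>t. JM ?Mo pair (?G (z t))"] conjI ballI z(2))
      with z show "z \<in> bvp_solutions e n k H T v" by (simp add: bvp_solutions_def J_matrix_JM V_def)
    qed (auto simp: bvp_solutions_def J_matrix_JM V_def hsol_def)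
    obtain Z where Z: "finite Z" "card Z \<le> card (distinct_solutions e n k H T v)"
      "Z \<subseteq> bvp_solutions e n k H T v"
      "\<And>x y. x \<in> Z \<Longrightarrow> y \<in> Z \<Longrightarrow> (x, y) \<in> same_solution_rel e n k H T v \<Longrightarrow> x = y"
      "\<And>x. x \<in> bvp_solutions e n k H T v \<Longrightarrow> \<exists>y\<in>Z. (y, x) \<in> same_solution_rel e n k H T v"
      by (rule finite_quotient_representatives[OF equiv_same_solution_rel few(1)[unfolded distinct_solutions_def],
            folded distinct_solutions_def]) (rule that; assumption)
    obtain R where R: "r \<le> R" "\<mu> < R + 1" "Mr < c * R powr \<mu>"
      "(T * Mr + norm V * r + norm V * (norm V / (c * T)) powr (1 / (\<mu> - 1)) + (norm V)\<^sup>2) +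
        real CARD('d) * T\<^sup>2 * (a * (R + 1) powr s + b)\<^sup>2 < (\<mu> - 1) * (c * R powr \<mu>) * T"
      using T(2) unfolding good_def by blast
    show False
    proof (rule few_orbits_ham[where V = V and T = T and c = c and Mr = Mr and R = R and \<Z> = Z])
      show "pair j \<in> ?P" if "V $ j \<noteq> 0" for j using embed_II_pair[OF v(2)] that by (simp add: V_def)
      show "V \<in> Lat ?P" unfolding V_def by (rule embed_II_Lat)
      show "V \<noteq> 0" using embed_II_nonzero[OF v(1)] by (simp add: V_def)
      show "card Z + 1 \<le> card (- ?P)" unfolding card_compl_PI using Z(2) few(2) by linarith
      show "\<bar>H z\<bar> \<le> Mr" if "norm (proj_on ?P z) \<le> r" for z using Mr(2)[OF that] by simp
      show "\<forall>z\<in>Z. hsol ?Mo pair ?G V T z" using Z(3) bvp by blast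
      show "\<forall>z\<in>Z. \<forall>z'\<in>Z. \<forall>m\<in>Lat ?P. \<forall>\<Delta>. (\<forall>t. z (t + \<Delta>) + m = z' t) \<longrightarrow> z = z'"
      proof (intro ballI allI impI)
        fix z z' m \<Delta> assume h: "z \<in> Z" "z' \<in> Z" "m \<in> Lat ?P" "\<forall>t. z (t + \<Delta>) + m = z' t"
        obtain w where w: "w \<in> int_vectors k" "m = embed_II e n k w" using Lat_embed_II[OF h(3)] by blast
        have "same_solution e n k z z'"
          unfolding same_solution_def by (intro exI[of _ \<Delta>] bexI[OF _ w(1)]) (use h(4) w(2) in simp)
        then show "z = z'" using Z(3,4) h(1,2) by (auto simp: same_solution_rel_def)
      qed
      show "\<forall>z. hsol ?Mo pair ?G V T z \<longrightarrow> (\<exists>z'\<in>Z. \<exists>m\<in>Lat ?P. \<exists>\<theta>. \<forall>t. z t = z' (t + \<theta>) + m)"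
      proof (intro allI impI)
        fix z assume "hsol ?Mo pair ?G V T z"
        then obtain z' where z': "z' \<in> Z" "same_solution e n k z' z"
          using Z(5)[of z] bvp by (auto simp: same_solution_rel_def)
        then show "\<exists>z'\<in>Z. \<exists>m\<in>Lat ?P. \<exists>\<theta>. \<forall>t. z t = z' (t + \<theta>) + m"
          unfolding same_solution_def using embed_II_Lat by blast
      qed
    qed (fact T(1) c Mr(1) R Z(1))+
  qed
  ultimately show "\<exists>\<delta>>0. \<forall>T\<in>period_interval \<mu> \<delta> s.
      infinite (distinct_solutions e n k H T v) \<or> k \<le> card (distinct_solutions e n k H T v)"
    by meson
qed

end
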